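(* Let $E=\mathrm{L}_0(X,\Sigma,\mu)$, where $\mu$ is a semi-finite measure. Then $E$ admits a (necessarily unique) Hausdorff uo-Lebesgue topology $\widehat\tau_E$. Take a net $(f_\alpha)_{\alpha\in\mathcal A}$ in $E$. Then the following are equivalent for every $p$ such that $1\le p<\infty$: (1) $f_\alpha\to 0$ in $\widehat\tau_E$; (2) $\int_X |f_\alpha|^p\wedge 1_A\,d\mu=\big\|\,|f_\alpha|\wedge|1_A|\,\big\|_p^p\to 0$ for every measurable subset $A$ of $X$ with finite measure; (3) $\int_X |f_\alpha|^p\wedge|f|^p\,d\mu=\big\|\,|f_\alpha|\wedge|f|\,\big\|_p^p\to 0$ for every $f\in\mathrm{L}_p(X,\Sigma,\mu)$; (4) $f_\alpha\to 0$ in measure on subsets of finite measure.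
   Context: $\mathrm{L}_0(X,\Sigma,\mu)$ is the vector lattice of all real-valued $\Sigma$-measurable functions on $X$, with identification of functions that agree $\mu$-almost everywhere. A measure $\mu$ (with values in $[0,\infty]$) is semi-finite if every $A\in\Sigma$ with $\mu(A)=\infty$ has a measurable subset $A'$ with $0<\mu(A')<\infty$. A net $(f_\alpha)$ in $\mathrm{L}_0(X,\Sigma,\mu)$ converges to $f$ in measure on subsets of finite measure if for all $A\in\Sigma$ with $\mu(A)<\infty$ and all $\varepsilon>0$, $\mu(\{x\in A:|f_\alpha(x)-f(x)|\ge\varepsilon\})\to 0$. A net $(x_\alpha)_{\alpha\in\mathcal A}$ in a vector lattice $E$ is order convergent to $x$ if there is a net $(y_\beta)_{\beta\in\mathcal B}$ in $E$ (possibly with a different index set) with $y_\beta\downarrow 0$ such that for every $\beta_0\in\mathcal B$ there is $\alpha_0\in\mathcal A$ with $|x-x_\alpha|\le y_{\beta_0}$ for all $\alpha\ge\alpha_0$; it is unbounded order convergent (uo-convergent) to $x$ if the net $|x_\alpha-x|\wedge y$ is order convergent to $0$ in $E$ for all $y\in E^+$. A uo-Lebesgue topology on $E$ is a locally solid linear topology (a vector space topology, not necessarily Hausdorff, with a base of solid neighbourhoods of $0$) such that uo-convergence of a net to $x$ implies its topological convergence to $x$. *)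

theory Defs
  imports "HOL-Algebra.Lattice" "HOL-Analysis.Analysis"
begin

section \<open>Nets\<close>

definition directed_preorder :: "'i set \<Rightarrow> 'i rel \<Rightarrow> bool" where
  "directed_preorder A r \<longleftrightarrow>
     A \<noteq> {} \<and> preorder_on A r \<and> (\<forall>a\<in>A. \<forall>b\<in>A. \<exists>c\<in>A. (a, c) \<in> r \<and> (b, c) \<in> r)"

text \<open>The filter of tails, by which the library's filter-based limits apply to nets.\<close>

definition tail_filter :: "'i set \<Rightarrow> 'i rel \<Rightarrow> 'i filter" where
  "tail_filter A r = (INF a\<in>A. principal {b \<in> A. (a, b) \<in> r})"

lemma eventually_tail_filter:
  assumes "directed_preorder A r"
  shows "eventually P (tail_filter A r) \<longleftrightarrow> (\<exists>a\<in>A. \<forall>b\<in>A. (a, b) \<in> r \<longrightarrow> P b)"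
proof -
  have tr: "trans r" and ne: "A \<noteq> {}"
    and dir: "\<And>a b. a \<in> A \<Longrightarrow> b \<in> A \<Longrightarrow> \<exists>c\<in>A. (a, c) \<in> r \<and> (b, c) \<in> r"
    using assms by (auto simp: directed_preorder_def preorder_on_def)
  have "eventually P (tail_filter A r)
        \<longleftrightarrow> (\<exists>a\<in>A. eventually P (principal {b \<in> A. (a, b) \<in> r}))"
    unfolding tail_filter_def
  proof (rule eventually_INF_base[OF ne])
    fix a b assume "a \<in> A" "b \<in> A"
    then obtain c where "c \<in> A" "(a, c) \<in> r" "(b, c) \<in> r" using dir by blast
    then show "\<exists>x\<in>A. principal {b \<in> A. (x, b) \<in> r}
        \<le> Lattices.inf (principal {b \<in> A. (a, b) \<in> r}) (principal {ba \<in> A. (b, ba) \<in> r})"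
      using tr by (auto simp: trans_def intro!: bexI[of _ c])
  qed
  then show ?thesis by (auto simp: eventually_principal)
qed


section \<open>Vector lattices\<close>

record 'e vlattice = "'e gorder" +
  vadd :: "'e \<Rightarrow> 'e \<Rightarrow> 'e"
  vzero :: 'e
  vscale :: "real \<Rightarrow> 'e \<Rightarrow> 'e"

locale vector_lattice = lattice E for E :: "('e, 'm) vlattice_scheme" (structure) +
  assumes vadd_closed: "x \<in> carrier E \<Longrightarrow> y \<in> carrier E \<Longrightarrow> vadd E x y \<in> carrier E"
    and vzero_closed: "vzero E \<in> carrier E"
    and vscale_closed: "x \<in> carrier E \<Longrightarrow> vscale E c x \<in> carrier E"
    and vadd_assoc: "x \<in> carrier E \<Longrightarrow> y \<in> carrier E \<Longrightarrow> z \<in> carrier E \<Longrightarrow>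
          vadd E (vadd E x y) z = vadd E x (vadd E y z)"
    and vadd_commute: "x \<in> carrier E \<Longrightarrow> y \<in> carrier E \<Longrightarrow> vadd E x y = vadd E y x"
    and vadd_vzero: "x \<in> carrier E \<Longrightarrow> vadd E x (vzero E) = x"
    and vadd_neg: "x \<in> carrier E \<Longrightarrow> vadd E x (vscale E (- 1) x) = vzero E"
    and vscale_vadd: "x \<in> carrier E \<Longrightarrow> y \<in> carrier E \<Longrightarrow>
          vscale E c (vadd E x y) = vadd E (vscale E c x) (vscale E c y)"
    and vscale_add: "x \<in> carrier E \<Longrightarrow>
          vscale E (c + d) x = vadd E (vscale E c x) (vscale E d x)"
    and vscale_mult: "x \<in> carrier E \<Longrightarrow> vscale E (c * d) x = vscale E c (vscale E d x)"
    and vscale_one: "x \<in> carrier E \<Longrightarrow> vscale E 1 x = x"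
    and vadd_mono: "x \<in> carrier E \<Longrightarrow> y \<in> carrier E \<Longrightarrow> z \<in> carrier E \<Longrightarrow> x \<sqsubseteq> y \<Longrightarrow>
          vadd E x z \<sqsubseteq> vadd E y z"
    and vscale_mono: "x \<in> carrier E \<Longrightarrow> y \<in> carrier E \<Longrightarrow> 0 \<le> c \<Longrightarrow> x \<sqsubseteq> y \<Longrightarrow>
          vscale E c x \<sqsubseteq> vscale E c y"

definition vdiff :: "('e, 'm) vlattice_scheme \<Rightarrow> 'e \<Rightarrow> 'e \<Rightarrow> 'e" where
  "vdiff E x y = vadd E x (vscale E (- 1) y)"

definition vabs :: "('e, 'm) vlattice_scheme \<Rightarrow> 'e \<Rightarrow> 'e" where
  "vabs E x = x \<squnion>\<^bsub>E\<^esub> vscale E (- 1) x"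

definition vpos :: "('e, 'm) vlattice_scheme \<Rightarrow> 'e set" where
  "vpos E = {y \<in> carrier E. vzero E \<sqsubseteq>\<^bsub>E\<^esub> y}"

definition decreases_to_zero ::
    "('e, 'm) vlattice_scheme \<Rightarrow> 'j set \<Rightarrow> 'j rel \<Rightarrow> ('j \<Rightarrow> 'e) \<Rightarrow> bool" where
  "decreases_to_zero E B s y \<longleftrightarrow>
     (\<forall>b\<in>B. \<forall>c\<in>B. (b, c) \<in> s \<longrightarrow> y c \<sqsubseteq>\<^bsub>E\<^esub> y b) \<and> greatest E (vzero E) (Lower E (y ` B))"

text \<open>
  The index set of the dominating net is a subset of the type of \<open>E\<close>; this is no restriction,
  since a decreasing net can be indexed by its own range (see \<open>order_convergesI\<close>).
\<close>

definition order_converges ::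
    "('e, 'm) vlattice_scheme \<Rightarrow> 'i set \<Rightarrow> 'i rel \<Rightarrow> ('i \<Rightarrow> 'e) \<Rightarrow> 'e \<Rightarrow> bool" where
  "order_converges E A r x l \<longleftrightarrow>
     (\<exists>(B :: 'e set) s y.
        directed_preorder B s \<and> y \<in> B \<rightarrow> carrier E \<and> decreases_to_zero E B s y \<and>
        (\<forall>b0\<in>B. \<exists>a0\<in>A. \<forall>a\<in>A. (a0, a) \<in> r \<longrightarrow> vabs E (vdiff E l (x a)) \<sqsubseteq>\<^bsub>E\<^esub> y b0))"

definition uo_converges ::
    "('e, 'm) vlattice_scheme \<Rightarrow> 'i set \<Rightarrow> 'i rel \<Rightarrow> ('i \<Rightarrow> 'e) \<Rightarrow> 'e \<Rightarrow> bool" where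
  "uo_converges E A r x l \<longleftrightarrow>
     (\<forall>y\<in>vpos E. order_converges E A r (\<lambda>a. vabs E (vdiff E (x a) l) \<sqinter>\<^bsub>E\<^esub> y) (vzero E))"

lemma order_convergesI:
  fixes B :: "'j set"
  assumes B: "directed_preorder B s" and y: "y \<in> B \<rightarrow> carrier E"
    and dec: "decreases_to_zero E B s y"
    and dom: "\<forall>b0\<in>B. \<exists>a0\<in>A. \<forall>a\<in>A. (a0, a) \<in> r \<longrightarrow> vabs E (vdiff E l (x a)) \<sqsubseteq>\<^bsub>E\<^esub> y b0"
    and E: "partial_order E"
  shows "order_converges E A r x l"
proof -
  interpret partial_order E by (rule E)
  let ?s = "{(u, v). u \<in> y ` B \<and> v \<in> y ` B \<and> v \<sqsubseteq>\<^bsub>E\<^esub> u}"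
  have car: "\<And>b. b \<in> B \<Longrightarrow> y b \<in> carrier E" using y by auto
  have "preorder_on (y ` B) ?s"
    unfolding preorder_on_def refl_on_def trans_def using car by (auto intro: le_trans)
  moreover have "\<exists>w\<in>y ` B. (u, w) \<in> ?s \<and> (v, w) \<in> ?s" if "u \<in> y ` B" "v \<in> y ` B" for u v
  proof -
    from that obtain b c where bc: "b \<in> B" "c \<in> B" "u = y b" "v = y c" by auto
    with B obtain d where "d \<in> B" "(b, d) \<in> s" "(c, d) \<in> s"
      unfolding directed_preorder_def by blast
    with bc dec show ?thesis by (intro bexI[of _ "y d"]) (auto simp: decreases_to_zero_def)
  qed
  ultimately have "directed_preorder (y ` B) ?s"
    using B unfolding directed_preorder_def by blast
  moreover have "decreases_to_zero E (y ` B) ?s id"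
    using dec by (auto simp: decreases_to_zero_def)
  moreover have "id \<in> y ` B \<rightarrow> carrier E" using car by auto
  ultimately show ?thesis
    unfolding order_converges_def using dom
    by (intro exI[of _ "y ` B"] exI[of _ ?s] exI[of _ id]) simp
qed


section \<open>Topologies on vector lattices\<close>

definition solid :: "('e, 'm) vlattice_scheme \<Rightarrow> 'e set \<Rightarrow> bool" where
  "solid E S \<longleftrightarrow> S \<subseteq> carrier E \<and>
     (\<forall>x\<in>S. \<forall>y\<in>carrier E. vabs E y \<sqsubseteq>\<^bsub>E\<^esub> vabs E x \<longrightarrow> y \<in> S)"

definition linear_topology :: "('e, 'm) vlattice_scheme \<Rightarrow> 'e topology \<Rightarrow> bool" where
  "linear_topology E \<tau> \<longleftrightarrow>
     topspace \<tau> = carrier E \<and>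
     continuous_map (prod_topology \<tau> \<tau>) \<tau> (\<lambda>(x, y). vadd E x y) \<and>
     continuous_map (prod_topology euclideanreal \<tau>) \<tau> (\<lambda>(c, x). vscale E c x)"

definition nbhd_of :: "'e topology \<Rightarrow> 'e \<Rightarrow> 'e set \<Rightarrow> bool" where
  "nbhd_of \<tau> x V \<longleftrightarrow> V \<subseteq> topspace \<tau> \<and> (\<exists>W. openin \<tau> W \<and> x \<in> W \<and> W \<subseteq> V)"

definition locally_solid_topology :: "('e, 'm) vlattice_scheme \<Rightarrow> 'e topology \<Rightarrow> bool" where
  "locally_solid_topology E \<tau> \<longleftrightarrow>
     linear_topology E \<tau> \<and>
     (\<forall>U. nbhd_of \<tau> (vzero E) U \<longrightarrow> (\<exists>V. nbhd_of \<tau> (vzero E) V \<and> solid E V \<and> V \<subseteq> U))"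

text \<open>
  HOL cannot quantify over index types inside a definition. The nets here are indexed by subsets
  of the type \<open>'e set \<times> 'e\<close>, which is large enough to reindex every net in \<open>E\<close> with
  the same tails: \<open>uo_Lebesgue_topologyD\<close> gives the implication for all index types.
\<close>

definition uo_Lebesgue_topology :: "('e, 'm) vlattice_scheme \<Rightarrow> 'e topology \<Rightarrow> bool" where
  "uo_Lebesgue_topology E \<tau> \<longleftrightarrow>
     locally_solid_topology E \<tau> \<and>
     (\<forall>(A :: ('e set \<times> 'e) set) r x l.
        directed_preorder A r \<and> x \<in> A \<rightarrow> carrier E \<and> l \<in> carrier E \<and> uo_converges E A r x l
        \<longrightarrow> limitin \<tau> x l (tail_filter A r))"

lemma order_converges_tails:
  assumes A: "directed_preorder A r" and A': "directed_preorder A' r'"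
    and ev: "\<And>P. eventually (\<lambda>a. P (x a)) (tail_filter A r)
                  \<longleftrightarrow> eventually (\<lambda>a. P (x' a)) (tail_filter A' r')"
  shows "order_converges E A r (\<lambda>a. g (x a)) l \<longleftrightarrow> order_converges E A' r' (\<lambda>a. g (x' a)) l"
proof -
  have "(\<exists>a0\<in>A. \<forall>a\<in>A. (a0, a) \<in> r \<longrightarrow> vabs E (vdiff E l (g (x a))) \<sqsubseteq>\<^bsub>E\<^esub> z) \<longleftrightarrow>
        (\<exists>a0\<in>A'. \<forall>a\<in>A'. (a0, a) \<in> r' \<longrightarrow> vabs E (vdiff E l (g (x' a))) \<sqsubseteq>\<^bsub>E\<^esub> z)" for z
    using ev[of "\<lambda>u. vabs E (vdiff E l (g u)) \<sqsubseteq>\<^bsub>E\<^esub> z"]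
    by (simp add: eventually_tail_filter[OF A] eventually_tail_filter[OF A'])
  then show ?thesis unfolding order_converges_def by simp
qed

lemma uo_Lebesgue_topologyD:
  fixes A :: "'i set" and E :: "('e, 'm) vlattice_scheme"
  assumes \<tau>: "uo_Lebesgue_topology E \<tau>" and A: "directed_preorder A r"
    and x: "x \<in> A \<rightarrow> carrier E" and l: "l \<in> carrier E" and uo: "uo_converges E A r x l"
  shows "limitin \<tau> x l (tail_filter A r)"
proof -
  define tl where "tl a = x ` {b \<in> A. (a, b) \<in> r}" for a
  define A' where "A' = {(tl a, x b) | a b. a \<in> A \<and> b \<in> A \<and> (a, b) \<in> r}"
  define r' where "r' = {(p, q). p \<in> A' \<and> q \<in> A' \<and> fst q \<subseteq> fst p}"
  have tr: "trans r" and rf: "\<And>a. a \<in> A \<Longrightarrow> (a, a) \<in> r" and ne: "A \<noteq> {}"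
    and dir: "\<And>a b. a \<in> A \<Longrightarrow> b \<in> A \<Longrightarrow> \<exists>c\<in>A. (a, c) \<in> r \<and> (b, c) \<in> r"
    using A by (auto simp: directed_preorder_def preorder_on_def refl_on_def)
  have tl_mono: "tl c \<subseteq> tl a" if "(a, c) \<in> r" for a c
    using that tr unfolding tl_def trans_def by blast
  have mem: "(tl a, x b) \<in> A'" if "a \<in> A" "b \<in> A" "(a, b) \<in> r" for a b
    using that unfolding A'_def by blast
  have A': "directed_preorder A' r'"
    unfolding directed_preorder_def
  proof (intro conjI ballI)
    show "A' \<noteq> {}" using ne mem rf by blast
    show "preorder_on A' r'"
      unfolding preorder_on_def refl_on_def trans_def r'_def by auto
    fix p q assume pq: "p \<in> A'" "q \<in> A'"
    then obtain a b where ab: "a \<in> A" "b \<in> A" "fst p = tl a" "fst q = tl b"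
      unfolding A'_def by auto
    then obtain c where c: "c \<in> A" "(a, c) \<in> r" "(b, c) \<in> r" using dir by blast
    then show "\<exists>z\<in>A'. (p, z) \<in> r' \<and> (q, z) \<in> r'"
      using pq ab mem[of c c] rf[of c] tl_mono
      by (intro bexI[of _ "(tl c, x c)"]) (auto simp: r'_def)
  qed
  have ev: "eventually (\<lambda>a. P (x a)) (tail_filter A r)
            \<longleftrightarrow> eventually (\<lambda>a. P (snd a)) (tail_filter A' r')" for P
    unfolding eventually_tail_filter[OF A] eventually_tail_filter[OF A']
  proof
    assume "\<exists>a\<in>A. \<forall>b\<in>A. (a, b) \<in> r \<longrightarrow> P (x b)"
    then obtain a where a: "a \<in> A" "\<And>b. b \<in> A \<Longrightarrow> (a, b) \<in> r \<Longrightarrow> P (x b)" by blast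
    have "P (snd q)" if "q \<in> A'" "((tl a, x a), q) \<in> r'" for q
    proof -
      from that obtain c d where q: "q = (tl c, x d)" "d \<in> A" "(c, d) \<in> r"
        unfolding A'_def by auto
      have "tl c \<subseteq> tl a" using that(2) q(1) by (simp add: r'_def)
      moreover have "x d \<in> tl c" using q unfolding tl_def by blast
      ultimately obtain b where "b \<in> A" "(a, b) \<in> r" "x d = x b" unfolding tl_def by blast
      then show ?thesis using a(2) q(1) by simp
    qed
    then show "\<exists>p\<in>A'. \<forall>q\<in>A'. (p, q) \<in> r' \<longrightarrow> P (snd q)"
      using mem[OF a(1) a(1) rf[OF a(1)]] by blast
  next
    assume "\<exists>p\<in>A'. \<forall>q\<in>A'. (p, q) \<in> r' \<longrightarrow> P (snd q)"
    then obtain p where p: "p \<in> A'" "\<And>q. q \<in> A' \<Longrightarrow> (p, q) \<in> r' \<Longrightarrow> P (snd q)" by blast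
    then obtain a where a: "a \<in> A" "fst p = tl a" unfolding A'_def by auto
    have "P (x b)" if "b \<in> A" "(a, b) \<in> r" for b
      using p(2)[of "(tl a, x b)"] mem[OF a(1) that] p(1) a(2) by (auto simp: r'_def)
    then show "\<exists>a\<in>A. \<forall>b\<in>A. (a, b) \<in> r \<longrightarrow> P (x b)" using a(1) by blast
  qed
  have "uo_converges E A' r' snd l"
    unfolding uo_converges_def
  proof
    fix y assume "y \<in> vpos E"
    with uo have "order_converges E A r (\<lambda>a. vabs E (vdiff E (x a) l) \<sqinter>\<^bsub>E\<^esub> y) (vzero E)"
      unfolding uo_converges_def by blast
    then show "order_converges E A' r' (\<lambda>a. vabs E (vdiff E (snd a) l) \<sqinter>\<^bsub>E\<^esub> y) (vzero E)"
      using order_converges_tails[OF A A' ev, where g = "\<lambda>u. vabs E (vdiff E u l) \<sqinter>\<^bsub>E\<^esub> y"]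
      by (rule iffD1[rotated])
  qed
  moreover have "snd \<in> A' \<rightarrow> carrier E" using x unfolding A'_def by auto
  ultimately have "limitin \<tau> snd l (tail_filter A' r')"
    using \<tau> A' l unfolding uo_Lebesgue_topology_def by blast
  then show ?thesis
    unfolding limitin_def using ev[of "\<lambda>u. u \<in> _"] by simp
qed


section \<open>The vector lattice of measurable functions modulo null sets\<close>

definition ae_eq_rel :: "'a measure \<Rightarrow> ('a \<Rightarrow> real) rel" where
  "ae_eq_rel M = {(f, g). f \<in> borel_measurable M \<and> g \<in> borel_measurable M \<and> (AE x in M. f x = g x)}"

definition L0 :: "'a measure \<Rightarrow> ('a \<Rightarrow> real) set vlattice" where
  "L0 M = \<lparr> carrier = borel_measurable M // ae_eq_rel M,
            eq = (=),
            le = (\<lambda>F G. \<exists>f\<in>F. \<exists>g\<in>G. AE x in M. f x \<le> g x),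
            vadd = (\<lambda>F G. \<Union>f\<in>F. \<Union>g\<in>G. ae_eq_rel M `` {\<lambda>x. f x + g x}),
            vzero = ae_eq_rel M `` {\<lambda>x. 0},
            vscale = (\<lambda>c F. \<Union>f\<in>F. ae_eq_rel M `` {\<lambda>x. c * f x}) \<rparr>"

lemma equiv_ae_eq_rel: "equiv (borel_measurable M) (ae_eq_rel M)"
  unfolding equiv_def refl_on_def sym_def trans_def ae_eq_rel_def
  by (auto elim: AE_mp)

lemma L0_carrierE:
  assumes "F \<in> carrier (L0 M)"
  obtains f where "f \<in> borel_measurable M" "F = ae_eq_rel M `` {f}"
  using assms by (auto simp: L0_def elim: quotientE)

lemma L0_class_closed: "f \<in> borel_measurable M \<Longrightarrow> ae_eq_rel M `` {f} \<in> carrier (L0 M)"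
  by (simp add: L0_def quotientI)

lemma L0_class_eq_iff:
  assumes "f \<in> borel_measurable M" "g \<in> borel_measurable M"
  shows "ae_eq_rel M `` {f} = ae_eq_rel M `` {g} \<longleftrightarrow> (AE x in M. f x = g x)"
  using eq_equiv_class_iff[OF equiv_ae_eq_rel assms] assms by (simp add: ae_eq_rel_def)

lemma L0_le_iff:
  assumes "f \<in> borel_measurable M" "g \<in> borel_measurable M"
  shows "ae_eq_rel M `` {f} \<sqsubseteq>\<^bsub>L0 M\<^esub> ae_eq_rel M `` {g} \<longleftrightarrow> (AE x in M. f x \<le> g x)"
proof
  assume "ae_eq_rel M `` {f} \<sqsubseteq>\<^bsub>L0 M\<^esub> ae_eq_rel M `` {g}"
  then obtain f' g' where "AE x in M. f x = f' x" "AE x in M. g x = g' x" "AE x in M. f' x \<le> g' x"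
    by (auto simp: L0_def ae_eq_rel_def)
  then show "AE x in M. f x \<le> g x" by eventually_elim simp
qed (use assms in \<open>auto simp: L0_def ae_eq_rel_def\<close>)

lemma L0_vadd_class:
  assumes "f \<in> borel_measurable M" "g \<in> borel_measurable M"
  shows "vadd (L0 M) (ae_eq_rel M `` {f}) (ae_eq_rel M `` {g}) = ae_eq_rel M `` {\<lambda>x. f x + g x}"
proof -
  have "(\<lambda>f g. ae_eq_rel M `` {\<lambda>x. f x + g x}) respects2 ae_eq_rel M"
  proof (rule congruent2I')
    fix y1 z1 y2 z2 assume *: "(y1, z1) \<in> ae_eq_rel M" "(y2, z2) \<in> ae_eq_rel M"
    then have "AE x in M. y1 x = z1 x" "AE x in M. y2 x = z2 x" by (auto simp: ae_eq_rel_def)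
    then have "AE x in M. y1 x + y2 x = z1 x + z2 x" by eventually_elim simp
    then show "ae_eq_rel M `` {\<lambda>x. y1 x + y2 x} = ae_eq_rel M `` {\<lambda>x. z1 x + z2 x}"
      using * by (subst L0_class_eq_iff) (auto simp: ae_eq_rel_def)
  qed
  from UN_equiv_class2[OF equiv_ae_eq_rel equiv_ae_eq_rel this assms]
  show ?thesis by (simp add: L0_def)
qed

lemma L0_vscale_class:
  assumes "f \<in> borel_measurable M"
  shows "vscale (L0 M) c (ae_eq_rel M `` {f}) = ae_eq_rel M `` {\<lambda>x. c * f x}"
proof -
  have "(\<lambda>f. ae_eq_rel M `` {\<lambda>x. c * f x}) respects ae_eq_rel M"
  proof (rule congruentI)
    fix y z assume *: "(y, z) \<in> ae_eq_rel M"
    then have "AE x in M. y x = z x" by (auto simp: ae_eq_rel_def)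
    then have "AE x in M. c * y x = c * z x" by eventually_elim simp
    then show "ae_eq_rel M `` {\<lambda>x. c * y x} = ae_eq_rel M `` {\<lambda>x. c * z x}"
      using * by (subst L0_class_eq_iff) (auto simp: ae_eq_rel_def)
  qed
  from UN_equiv_class[OF equiv_ae_eq_rel this assms]
  show ?thesis by (simp add: L0_def)
qed

lemma L0_vzero: "vzero (L0 M) = ae_eq_rel M `` {\<lambda>x. 0}"
  by (simp add: L0_def)

lemma partial_order_L0: "partial_order (L0 M)"
proof
  show "(.=\<^bsub>L0 M\<^esub>) = (=)" by (simp add: L0_def)
  fix x y z
  show "x \<in> carrier (L0 M) \<Longrightarrow> x .=\<^bsub>L0 M\<^esub> x" by (simp add: L0_def)
  show "x .=\<^bsub>L0 M\<^esub> y \<Longrightarrow> y .=\<^bsub>L0 M\<^esub> x" by (simp add: L0_def)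
  show "x .=\<^bsub>L0 M\<^esub> y \<Longrightarrow> y .=\<^bsub>L0 M\<^esub> z \<Longrightarrow> x .=\<^bsub>L0 M\<^esub> z" by (simp add: L0_def)
  show "x \<in> carrier (L0 M) \<Longrightarrow> x \<sqsubseteq>\<^bsub>L0 M\<^esub> x"
    by (auto elim!: L0_carrierE simp: L0_le_iff)
  show "x \<sqsubseteq>\<^bsub>L0 M\<^esub> y \<Longrightarrow> y \<sqsubseteq>\<^bsub>L0 M\<^esub> x \<Longrightarrow> x \<in> carrier (L0 M) \<Longrightarrow> y \<in> carrier (L0 M) \<Longrightarrow> x .=\<^bsub>L0 M\<^esub> y"
  proof -
    assume a: "x \<sqsubseteq>\<^bsub>L0 M\<^esub> y" "y \<sqsubseteq>\<^bsub>L0 M\<^esub> x" "x \<in> carrier (L0 M)" "y \<in> carrier (L0 M)"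
    obtain f where f: "f \<in> borel_measurable M" "x = ae_eq_rel M `` {f}" using L0_carrierE[OF a(3)] .
    obtain g where g: "g \<in> borel_measurable M" "y = ae_eq_rel M `` {g}" using L0_carrierE[OF a(4)] .
    have "AE x in M. f x \<le> g x" "AE x in M. g x \<le> f x" using a f g by (simp_all add: L0_le_iff)
    then have "AE x in M. f x = g x" by eventually_elim simp
    then have "x = y" using f g by (simp add: L0_class_eq_iff)
    then show "x .=\<^bsub>L0 M\<^esub> y" by (simp add: L0_def)
  qed
  show "x \<sqsubseteq>\<^bsub>L0 M\<^esub> y \<Longrightarrow> y \<sqsubseteq>\<^bsub>L0 M\<^esub> z \<Longrightarrow> x \<in> carrier (L0 M) \<Longrightarrow> y \<in> carrier (L0 M) \<Longrightarrow>
      z \<in> carrier (L0 M) \<Longrightarrow> x \<sqsubseteq>\<^bsub>L0 M\<^esub> z"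
  proof -
    assume a: "x \<sqsubseteq>\<^bsub>L0 M\<^esub> y" "y \<sqsubseteq>\<^bsub>L0 M\<^esub> z" "x \<in> carrier (L0 M)" "y \<in> carrier (L0 M)" "z \<in> carrier (L0 M)"
    obtain f where f: "f \<in> borel_measurable M" "x = ae_eq_rel M `` {f}" using L0_carrierE[OF a(3)] .
    obtain g where g: "g \<in> borel_measurable M" "y = ae_eq_rel M `` {g}" using L0_carrierE[OF a(4)] .
    obtain h where h: "h \<in> borel_measurable M" "z = ae_eq_rel M `` {h}" using L0_carrierE[OF a(5)] .
    have "AE x in M. f x \<le> g x" "AE x in M. g x \<le> h x" using a f g h by (simp_all add: L0_le_iff)
    then have "AE x in M. f x \<le> h x" by eventually_elim simp
    then show ?thesis using f h by (simp add: L0_le_iff)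
  qed
  fix w
  show "x .=\<^bsub>L0 M\<^esub> y \<Longrightarrow> z .=\<^bsub>L0 M\<^esub> w \<Longrightarrow> (x \<sqsubseteq>\<^bsub>L0 M\<^esub> z) = (y \<sqsubseteq>\<^bsub>L0 M\<^esub> w)"
    by (simp add: L0_def)
qed

lemma L0_lub_class:
  assumes f: "f \<in> borel_measurable M" and g: "g \<in> borel_measurable M"
  shows "least (L0 M) (ae_eq_rel M `` {\<lambda>x. max (f x) (g x)})
           (Upper (L0 M) {ae_eq_rel M `` {f}, ae_eq_rel M `` {g}})"
  unfolding least_def
proof (intro conjI ballI)
  let ?U = "Upper (L0 M) {ae_eq_rel M `` {f}, ae_eq_rel M `` {g}}"
  show "?U \<subseteq> carrier (L0 M)" by (auto simp: Upper_def)
  show "ae_eq_rel M `` {\<lambda>x. max (f x) (g x)} \<in> ?U"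
    using f g by (auto simp: Upper_def L0_class_closed L0_le_iff)
  fix z assume z: "z \<in> ?U"
  then obtain h where h: "h \<in> borel_measurable M" "z = ae_eq_rel M `` {h}"
    by (auto simp: Upper_def elim: L0_carrierE)
  have "AE x in M. f x \<le> h x" "AE x in M. g x \<le> h x"
    using z h f g L0_class_closed[OF f] L0_class_closed[OF g] by (auto simp: Upper_def L0_le_iff)
  then have "AE x in M. max (f x) (g x) \<le> h x" by eventually_elim simp
  then show "ae_eq_rel M `` {\<lambda>x. max (f x) (g x)} \<sqsubseteq>\<^bsub>L0 M\<^esub> z"
    using f g h by (simp add: L0_le_iff)
qed

lemma L0_glb_class:
  assumes f: "f \<in> borel_measurable M" and g: "g \<in> borel_measurable M"
  shows "greatest (L0 M) (ae_eq_rel M `` {\<lambda>x. min (f x) (g x)})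
           (Lower (L0 M) {ae_eq_rel M `` {f}, ae_eq_rel M `` {g}})"
  unfolding greatest_def
proof (intro conjI ballI)
  let ?U = "Lower (L0 M) {ae_eq_rel M `` {f}, ae_eq_rel M `` {g}}"
  show "?U \<subseteq> carrier (L0 M)" by (auto simp: Lower_def)
  show "ae_eq_rel M `` {\<lambda>x. min (f x) (g x)} \<in> ?U"
    using f g by (auto simp: Lower_def L0_class_closed L0_le_iff)
  fix z assume z: "z \<in> ?U"
  then obtain h where h: "h \<in> borel_measurable M" "z = ae_eq_rel M `` {h}"
    by (auto simp: Lower_def elim: L0_carrierE)
  have "AE x in M. h x \<le> f x" "AE x in M. h x \<le> g x"
    using z h f g L0_class_closed[OF f] L0_class_closed[OF g] by (auto simp: Lower_def L0_le_iff)
  then have "AE x in M. h x \<le> min (f x) (g x)" by eventually_elim simp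
  then show "z \<sqsubseteq>\<^bsub>L0 M\<^esub> ae_eq_rel M `` {\<lambda>x. min (f x) (g x)}"
    using f g h by (simp add: L0_le_iff)
qed

lemma vector_lattice_L0: "vector_lattice (L0 M)"
proof -
  interpret partial_order "L0 M" by (rule partial_order_L0)
  show ?thesis
    apply unfold_locales
    apply (elim L0_carrierE; hypsubst; use L0_lub_class L0_glb_class in blast)
    apply (elim L0_carrierE; hypsubst; use L0_lub_class L0_glb_class in blast)
    apply (((elim L0_carrierE)?; simp add: L0_vadd_class L0_vscale_class L0_vzero
              L0_class_closed L0_le_iff algebra_simps)+)[11]
    apply (elim L0_carrierE; simp add: L0_vadd_class L0_le_iff)
    apply (elim L0_carrierE; simp add: L0_vscale_class L0_le_iff; elim AE_mp; simp add: mult_left_mono)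
    done
qed

lemma L0_join_class:
  assumes "f \<in> borel_measurable M" "g \<in> borel_measurable M"
  shows "ae_eq_rel M `` {f} \<squnion>\<^bsub>L0 M\<^esub> ae_eq_rel M `` {g} = ae_eq_rel M `` {\<lambda>x. max (f x) (g x)}"
proof -
  interpret vector_lattice "L0 M" by (rule vector_lattice_L0)
  show ?thesis
    unfolding join_def sup_def
    by (rule some_equality, rule L0_lub_class[OF assms], erule least_unique, rule L0_lub_class[OF assms])
qed

lemma L0_meet_class:
  assumes "f \<in> borel_measurable M" "g \<in> borel_measurable M"
  shows "ae_eq_rel M `` {f} \<sqinter>\<^bsub>L0 M\<^esub> ae_eq_rel M `` {g} = ae_eq_rel M `` {\<lambda>x. min (f x) (g x)}"
proof -
  interpret vector_lattice "L0 M" by (rule vector_lattice_L0)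
  show ?thesis
    unfolding meet_def inf_def
    by (rule some_equality, rule L0_glb_class[OF assms], erule greatest_unique, rule L0_glb_class[OF assms])
qed

lemma L0_vabs_class:
  assumes "f \<in> borel_measurable M"
  shows "vabs (L0 M) (ae_eq_rel M `` {f}) = ae_eq_rel M `` {\<lambda>x. \<bar>f x\<bar>}"
proof -
  have "(\<lambda>x. max (f x) (- f x)) = (\<lambda>x. \<bar>f x\<bar>)" by auto
  then show ?thesis
    using assms by (simp add: vabs_def L0_vscale_class L0_join_class)
qed


section \<open>Measure-theoretic notions\<close>

text \<open>
  The library locale \<open>semifinite_measure\<close> does not ask for \<open>0 < emeasure M B\<close>, so it holds
  for every measure and cannot be used here.
\<close>

definition semi_finite :: "'a measure \<Rightarrow> bool" where
  "semi_finite M \<longleftrightarrow>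
     (\<forall>S\<in>sets M. emeasure M S = \<infinity> \<longrightarrow>
        (\<exists>T\<in>sets M. T \<subseteq> S \<and> 0 < emeasure M T \<and> emeasure M T < \<infinity>))"

definition finite_measure_sets :: "'a measure \<Rightarrow> 'a set set" where
  "finite_measure_sets M = {S \<in> sets M. emeasure M S < \<infinity>}"

definition Lp_functions :: "'a measure \<Rightarrow> real \<Rightarrow> ('a \<Rightarrow> real) set" where
  "Lp_functions M p = {f \<in> borel_measurable M. integrable M (\<lambda>x. \<bar>f x\<bar> powr p)}"

text \<open>The Bochner integral is \<open>0\<close> for non-integrable functions, so \<open>Lp_norm\<close> is meaningful only on
  \<open>Lp_functions M p\<close>.\<close>

definition Lp_norm :: "'a measure \<Rightarrow> real \<Rightarrow> ('a \<Rightarrow> real) \<Rightarrow> real" where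
  "Lp_norm M p f = (\<integral>x. \<bar>f x\<bar> powr p \<partial>M) powr (1 / p)"

definition tendsto_in_measure_on_finite ::
    "'a measure \<Rightarrow> ('i \<Rightarrow> 'a \<Rightarrow> real) \<Rightarrow> ('a \<Rightarrow> real) \<Rightarrow> 'i filter \<Rightarrow> bool" where
  "tendsto_in_measure_on_finite M f g \<F> \<longleftrightarrow>
     (\<forall>S\<in>finite_measure_sets M. \<forall>\<epsilon>>0.
        ((\<lambda>\<alpha>. emeasure M {x \<in> S. \<epsilon> \<le> \<bar>f \<alpha> x - g x\<bar>}) \<longlongrightarrow> 0) \<F>)"

end

theory Submission
  imports Defs
begin

text \<open>
  The topology of convergence in measure on sets of finite measure is generated by the functionals
  \<open>\<rho>\<^sub>S f = \<integral> min \<bar>f\<bar> 1 \<partial>M\<close> over \<open>S\<close>. It is uo-Lebesgue since a net decreasing to \<open>0\<close> has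
  \<open>\<rho>\<^sub>S\<close>-infimum \<open>0\<close>: a sequence in the net that minimises \<open>\<rho>\<^sub>S\<close> already has infimum \<open>0\<close> on \<open>S\<close>.

  Any Hausdorff uo-Lebesgue topology \<open>\<tau>\<close> coincides with it. It is coarser because functions vanishing on
  large sets of finite measure form a uo-null net, and on one such set a \<open>\<rho>\<^sub>S\<close>-null sequence has an
  almost everywhere null, hence \<open>\<tau>\<close>-null, subsequence. It is finer because otherwise
  \<open>C = inf\<^sub>V sup\<^sub>V \<rho>\<^sub>S > 0\<close>, \<open>V\<close> ranging over the solid neighbourhoods of \<open>0\<close>. Along a decreasing
  chain of neighbourhoods with \<open>sup\<^sub>V \<rho>\<^sub>S\<close> tending to \<open>C\<close>, a limit superior \<open>h\<close> lies in all of them and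
  has \<open>\<rho>\<^sub>S h = C\<close>. Shrinking the chain into a neighbourhood \<open>Z\<close> that misses \<open>h\<close> gives \<open>k \<in> Z\<close> with the
  same properties; maximality of \<open>\<rho>\<^sub>S\<close> at \<open>h\<close>, \<open>k\<close> and \<open>max h k\<close> forces \<open>h = k\<close> almost everywhere,
  a contradiction.
\<close>

section \<open>Truncated integrals\<close>

text \<open>Almost everywhere statements survive countable operations only, whereas nets may be
  uncountable, the sets of finite measure need not have a countable cofinal family, and a Hausdorff
  uo-Lebesgue topology is not known to have a countable base at zero. Every passage to a limit is
  therefore made along a sequence that is extremal for one \<open>\<rho>\<^sub>S\<close>. The
  integral then carries the result back to the uncountable family: if \<open>\<rho>\<^sub>S\<close>
  does not change between two comparable functions, they agree on \<open>S\<close> up to truncation.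
  In the last argument, a nonzero \<open>h\<close> lying in countably many neighbourhoods
  contradicts nothing, because Hausdorffness yields one neighbourhood without \<open>h\<close> and
  no countable family with trivial intersection. Functions with \<open>\<rho>\<^sub>S\<close> merely
  at least some fixed \<open>e\<close> would lead to a second witness \<open>k\<close> unrelated to
  \<open>h\<close>. The extremal value \<open>C\<close> makes the two comparable: the intersection
  of the chain is closed under sums, so it contains \<open>max h k\<close>, and nothing in it
  exceeds \<open>C\<close>.\<close>

lemma integrable_bounded_support:
  fixes f :: "'a \<Rightarrow> real"
  assumes "S \<in> finite_measure_sets M" "f \<in> borel_measurable M"
    and "\<And>x. x \<in> space M \<Longrightarrow> \<bar>f x\<bar> \<le> c * indicat_real S x"
  shows "integrable M f"
proof (rule Bochner_Integration.integrable_bound)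
  show "integrable M (\<lambda>x. c * indicat_real S x)"
    using assms(1) by (auto simp: finite_measure_sets_def)
  show "AE x in M. norm (f x) \<le> norm (c * indicat_real S x)"
    using order_trans[OF assms(3) abs_ge_self] by (intro AE_I2) simp
qed (use assms in auto)

lemma min_powr:
  fixes a b p :: real
  assumes "0 \<le> a" "0 \<le> b" "0 \<le> p"
  shows "min a b powr p = min (a powr p) (b powr p)"
  using assms powr_mono2[of p a b] powr_mono2[of p b a] by (auto simp: min_def)

lemma Lp_norm_powr:
  assumes "p \<noteq> 0"
  shows "Lp_norm M p f powr p = (\<integral>x. \<bar>f x\<bar> powr p \<partial>M)"
  using assms by (simp add: Lp_norm_def powr_powr)

section \<open>Sets of finite measure, convergence in measure on them, and integrals of truncated
  powers\<close>

lemma finite_measure_sets_Un: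
  "S \<in> finite_measure_sets M \<Longrightarrow> T \<in> finite_measure_sets M \<Longrightarrow> S \<union> T \<in> finite_measure_sets M"
  using emeasure_subadditive[of S M T]
  by (auto simp: finite_measure_sets_def less_top[symmetric] top_unique)

lemma finite_measure_sets_measurable [measurable_dest]:
  "S \<in> finite_measure_sets M \<Longrightarrow> S \<in> sets M"
  by (simp add: finite_measure_sets_def)

lemma emeasure_finite_measure_sets:
  "S \<in> finite_measure_sets M \<Longrightarrow> T \<in> sets M \<Longrightarrow> T \<subseteq> S \<Longrightarrow> emeasure M T = ennreal (measure M T)"
  using emeasure_mono[of T S M]
  by (intro emeasure_eq_ennreal_measure) (auto simp: finite_measure_sets_def)

text \<open>Markov's inequality gives one direction. For the other, \<open>S\<close> is split at a
  level \<open>e\<close> of the absolute value: below it the integrand is at most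
  \<open>e powr p\<close>, above it at most 1.\<close>

lemma powr_integral_tendsto_0_iff:
  fixes f :: "'i \<Rightarrow> 'a \<Rightarrow> real"
  assumes S: "S \<in> finite_measure_sets M" and p: "0 < p"
    and f: "\<forall>\<^sub>F \<alpha> in \<F>. f \<alpha> \<in> borel_measurable M"
  shows "((\<lambda>\<alpha>. \<integral>x. min (\<bar>f \<alpha> x\<bar> powr p) (indicat_real S x) \<partial>M) \<longlongrightarrow> 0) \<F> \<longleftrightarrow>
    (\<forall>e>0. ((\<lambda>\<alpha>. emeasure M {x \<in> S. e \<le> \<bar>f \<alpha> x\<bar>}) \<longlongrightarrow> 0) \<F>)"
    (is "(?I \<longlongrightarrow> 0) \<F> \<longleftrightarrow> ?R")
proof -
  note [measurable] = finite_measure_sets_measurable[OF S]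
  have SX: "S \<subseteq> space M" by (rule sets.sets_into_space) simp
  have meas: "{x \<in> S. e \<le> \<bar>g x\<bar>} \<in> sets M" if [measurable]: "g \<in> borel_measurable M" for g :: "'a \<Rightarrow> real" and e
  proof -
    have "{x \<in> S. e \<le> \<bar>g x\<bar>} = S \<inter> {x \<in> space M. e \<le> \<bar>g x\<bar>}" using SX by auto
    then show ?thesis by simp
  qed
  have int: "integrable M (\<lambda>x. min (\<bar>g x\<bar> powr p) (indicat_real S x))"
    if "g \<in> borel_measurable M" for g
    by (rule integrable_bounded_support[OF S, where c = 1]) (use that in \<open>auto simp: min_def indicator_def\<close>)
  have intS: "integrable M (indicat_real T)" if "T \<in> sets M" "T \<subseteq> S" for T
    by (rule integrable_bounded_support[OF S, where c = 1]) (use that in \<open>auto simp: indicator_def\<close>)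
  show ?thesis
  proof
    assume I: "(?I \<longlongrightarrow> 0) \<F>"
    show ?R
    proof (intro allI impI)
      fix e :: real assume "0 < e"
      \<comment> \<open>The integrand is capped at 1 on \<open>S\<close>, so on the exceptional set
        it is bounded below only by the smaller of 1 and \<open>e powr p\<close>.\<close>
      define d where "d = min 1 (e powr p)"
      have d: "0 < d" using \<open>0 < e\<close> by (simp add: d_def)
      have le: "measure M {x \<in> S. e \<le> \<bar>g x\<bar>} \<le> (\<integral>x. min (\<bar>g x\<bar> powr p) (indicat_real S x) \<partial>M) / d"
        if g: "g \<in> borel_measurable M" for g
      proof -
        have "measure M {x \<in> S. e \<le> \<bar>g x\<bar>} * d = (\<integral>x. indicat_real {x \<in> S. e \<le> \<bar>g x\<bar>} x * d \<partial>M)"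
          using meas[OF g] SX by (simp add: Int_absorb2 subset_iff)
        also have "\<dots> \<le> (\<integral>x. min (\<bar>g x\<bar> powr p) (indicat_real S x) \<partial>M)"
        proof (rule integral_mono)
          show "integrable M (\<lambda>x. indicat_real {x \<in> S. e \<le> \<bar>g x\<bar>} x * d)"
            using intS[OF meas[OF g]] by auto
          show "indicat_real {x \<in> S. e \<le> \<bar>g x\<bar>} x * d \<le> min (\<bar>g x\<bar> powr p) (indicat_real S x)" for x
            using powr_mono2[of p e "\<bar>g x\<bar>"] \<open>0 < e\<close> p
            by (auto simp: indicator_def d_def)
        qed (rule int[OF g])
        finally show ?thesis using d by (simp add: field_simps)
      qed
      have ev: "\<forall>\<^sub>F \<alpha> in \<F>. emeasure M {x \<in> S. e \<le> \<bar>f \<alpha> x\<bar>} \<le> ennreal (?I \<alpha> / d)"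
        using f
      proof eventually_elim
        case (elim \<alpha>)
        then show ?case
          by (subst emeasure_finite_measure_sets[OF S]) (auto intro: meas ennreal_leI le)
      qed
      have lim: "((\<lambda>\<alpha>. ennreal (?I \<alpha> / d)) \<longlongrightarrow> ennreal (0 / d)) \<F>"
        using d by (intro tendsto_ennrealI tendsto_divide I) auto
      show "((\<lambda>\<alpha>. emeasure M {x \<in> S. e \<le> \<bar>f \<alpha> x\<bar>}) \<longlongrightarrow> 0) \<F>"
        using tendsto_sandwich[OF _ ev tendsto_const lim[simplified]] by simp
    qed
  next
    assume R: ?R
    show "(?I \<longlongrightarrow> 0) \<F>"
    proof (rule order_tendstoI)
      fix a :: real assume "a < 0"
      then show "\<forall>\<^sub>F \<alpha> in \<F>. a < ?I \<alpha>"
        by (intro always_eventually allI order.strict_trans2[OF _ Bochner_Integration.integral_nonneg]) auto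
    next
      fix a :: real assume a: "0 < a"
      \<comment> \<open>The summand 1 keeps the divisor positive when \<open>S\<close> is a null
        set. The level \<open>e\<close> will be the \<open>p\<close>-th root of \<open>b\<close>, so
        that the part of \<open>S\<close> below the level contributes at most
        \<open>b * measure M S\<close>, which is less than \<open>a / 2\<close>.\<close>
      define m where "m = measure M S + 1"
      have m: "0 < m" by (simp add: m_def add_nonneg_pos)
      define b where "b = a / (2 * m)"
      have b: "0 < b" using a m by (simp add: b_def)
      have "b * measure M S < b * m" using b by (simp add: m_def)
      also have "b * m = a / 2" using m by (simp add: b_def)
      finally have bS: "b * measure M S < a / 2" .
      define e where "e = b powr (1 / p)"
      have e: "0 < e" "e powr p = b" using b p by (simp_all add: e_def powr_powr)
      have bnd: "(\<integral>x. min (\<bar>g x\<bar> powr p) (indicat_real S x) \<partial>M)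
          \<le> b * measure M S + measure M {x \<in> S. e \<le> \<bar>g x\<bar>}" if g: "g \<in> borel_measurable M" for g
      proof -
        have "(\<integral>x. min (\<bar>g x\<bar> powr p) (indicat_real S x) \<partial>M)
            \<le> (\<integral>x. b * indicat_real S x + indicat_real {x \<in> S. e \<le> \<bar>g x\<bar>} x \<partial>M)"
        proof (rule integral_mono[OF int[OF g]])
          show "integrable M (\<lambda>x. b * indicat_real S x + indicat_real {x \<in> S. e \<le> \<bar>g x\<bar>} x)"
            using intS[OF meas[OF g]] intS[of S] by auto
          show "min (\<bar>g x\<bar> powr p) (indicat_real S x)
              \<le> b * indicat_real S x + indicat_real {x \<in> S. e \<le> \<bar>g x\<bar>} x" for x
            using powr_mono2[of p "\<bar>g x\<bar>" e] e b p by (auto simp: indicator_def min_def)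
        qed
        also have "\<dots> = b * measure M S + measure M {x \<in> S. e \<le> \<bar>g x\<bar>}"
          using intS[OF meas[OF g]] intS[of S] meas[OF g] SX by (simp add: Int_absorb2 subset_iff)
        finally show ?thesis .
      qed
      have "\<forall>\<^sub>F \<alpha> in \<F>. emeasure M {x \<in> S. e \<le> \<bar>f \<alpha> x\<bar>} < ennreal (a / 2)"
        using R e(1) a by (intro order_tendstoD(2)[of _ 0]) auto
      then show "\<forall>\<^sub>F \<alpha> in \<F>. ?I \<alpha> < a"
        using f
      proof eventually_elim
        case (elim \<alpha>)
        then have "measure M {x \<in> S. e \<le> \<bar>f \<alpha> x\<bar>} < a / 2"
          by (subst (asm) emeasure_finite_measure_sets[OF S]) (auto intro: meas simp: ennreal_less_iff)
        then show ?case using bnd[OF elim(2)] bS by linarith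
      qed
    qed
  qed
qed

text \<open>An integrable function carries all but \<open>e\<close> of its integral on a set where
  it lies between two positive constants. The estimate is uniform in \<open>f\<close>, so one
  \<open>S\<close> and one \<open>k\<close> serve a whole net.\<close>

lemma Lp_tail_truncation:
  assumes "g \<in> Lp_functions M p" "0 < e" 
  shows "\<exists>S\<in>finite_measure_sets M. \<exists>k>0. \<forall>f\<in>borel_measurable M.
    (\<integral>x. min (\<bar>f x\<bar> powr p) (\<bar>g x\<bar> powr p) \<partial>M)
      \<le> e + k * (\<integral>x. min (\<bar>f x\<bar> powr p) (indicat_real S x) \<partial>M)"
proof -
  define \<phi> where "\<phi> x = \<bar>g x\<bar> powr p" for x
  have int: "integrable M \<phi>" and nn: "0 \<le> \<phi> x" for x
    using assms(1) by (simp_all add: Lp_functions_def \<phi>_def[abs_def])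
  then have [measurable]: "\<phi> \<in> borel_measurable M" by auto
  \<comment> \<open>The lower bound gives \<open>T n\<close> finite measure, the upper bound
    supplies the constant \<open>k\<close>. Points with \<open>\<phi> x = 0\<close> lie in no
    \<open>T n\<close>, but contribute nothing to the integral.\<close>
  define T where "T n = {x \<in> space M. 1 / real (Suc n) \<le> \<phi> x \<and> \<phi> x \<le> real (Suc n)}" for n
  have [measurable]: "T n \<in> sets M" for n by (simp add: T_def)
  have intT: "integrable M (indicat_real (T n))" for n
  proof (rule Bochner_Integration.integrable_bound[of _ "\<lambda>x. real (Suc n) * \<phi> x"])
    show "AE x in M. norm (indicat_real (T n) x) \<le> norm (real (Suc n) * \<phi> x)"
      using nn by (auto simp: T_def indicator_def divide_le_eq abs_mult field_simps)
  qed (use int in auto)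
  have T: "T n \<in> finite_measure_sets M" for n
    using intT[of n] by (simp add: finite_measure_sets_def integrable_indicator_iff)
  have "(\<lambda>n. \<integral>x. \<phi> x * indicat_real (- T n) x \<partial>M) \<longlonglongrightarrow> (\<integral>x. 0 \<partial>M)"
  proof (rule integral_dominated_convergence[where w = \<phi>])
    show "AE x in M. (\<lambda>n. \<phi> x * indicat_real (- T n) x) \<longlonglongrightarrow> 0"
    proof (rule AE_I2)
      fix x assume x: "x \<in> space M"
      show "(\<lambda>n. \<phi> x * indicat_real (- T n) x) \<longlonglongrightarrow> 0"
      proof (cases "\<phi> x = 0")
        case False
        then have pos: "0 < \<phi> x" using nn[of x] by simp
        obtain N :: nat where N: "max (\<phi> x) (1 / \<phi> x) \<le> real N" using real_arch_simple by blast
        have "x \<in> T n" if "N \<le> n" for n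
        proof -
          have "real N \<le> real (Suc n)" using that by simp
          then have "max (\<phi> x) (1 / \<phi> x) \<le> real (Suc n)" using N by linarith
          then show ?thesis using x pos by (auto simp: T_def field_simps)
        qed
        then have "\<forall>\<^sub>F n in sequentially. \<phi> x * indicat_real (- T n) x = 0"
          by (auto simp: eventually_sequentially intro!: exI[of _ N])
        then show ?thesis by (simp add: tendsto_eventually)
      qed simp
    qed
  qed (use int nn in \<open>auto simp: indicator_def\<close>)
  then have "\<forall>\<^sub>F n in sequentially. (\<integral>x. \<phi> x * indicat_real (- T n) x \<partial>M) < e"
    using assms(2) by (intro order_tendstoD(2)) auto
  then obtain n where n: "(\<integral>x. \<phi> x * indicat_real (- T n) x \<partial>M) < e"
    by (auto simp: eventually_sequentially)
  have i1: "integrable M (\<lambda>x. \<phi> x * indicat_real (- T n) x)"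
    by (rule Bochner_Integration.integrable_bound[OF int]) (auto simp: indicator_def)
  show ?thesis
  proof (intro bexI[OF _ T[of n]] exI[of _ "real (Suc n)"] conjI ballI)
    fix f :: "'a \<Rightarrow> real" assume [measurable]: "f \<in> borel_measurable M"
    have i2: "integrable M (\<lambda>x. min (\<bar>f x\<bar> powr p) (indicat_real (T n) x))"
      by (rule integrable_bounded_support[OF T, where c = 1]) (auto simp: min_def indicator_def)
    have "(\<integral>x. min (\<bar>f x\<bar> powr p) (\<phi> x) \<partial>M)
      \<le> (\<integral>x. \<phi> x * indicat_real (- T n) x
            + real (Suc n) * min (\<bar>f x\<bar> powr p) (indicat_real (T n) x) \<partial>M)"
    proof (rule integral_mono)
      show "integrable M (\<lambda>x. min (\<bar>f x\<bar> powr p) (\<phi> x))"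
        by (rule Bochner_Integration.integrable_bound[OF int]) (use nn in auto)
      fix x assume x: "x \<in> space M"
      \<comment> \<open>Lowering the cap from \<open>b\<close> to 1 costs a factor of at most
        \<open>Suc n\<close>, because this factor is at least 1 and bounds \<open>b\<close>.\<close>
      have "min a b \<le> real (Suc n) * min a 1" if "0 \<le> a" "b \<le> real (Suc n)" for a b
      proof (cases "a \<le> 1")
        case True
        have "1 * a \<le> real (Suc n) * a" by (rule mult_right_mono) (use that in auto)
        then show ?thesis using True by (simp del: of_nat_Suc)
      qed (use that in simp)
      then show "min (\<bar>f x\<bar> powr p) (\<phi> x)
        \<le> \<phi> x * indicat_real (- T n) x + real (Suc n) * min (\<bar>f x\<bar> powr p) (indicat_real (T n) x)"
        using x by (cases "x \<in> T n") (auto simp: T_def min_def)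
    qed (use i1 i2 in auto)
    also have "\<dots> \<le> e + real (Suc n) * (\<integral>x. min (\<bar>f x\<bar> powr p) (indicat_real (T n) x) \<partial>M)"
      using i1 i2 n by simp
    finally show "(\<integral>x. min (\<bar>f x\<bar> powr p) (\<bar>g x\<bar> powr p) \<partial>M) \<le> \<dots>" by (simp add: \<phi>_def)
  qed simp
qed

text \<open>Indicators of sets of finite measure are themselves \<open>p\<close>-integrable, which
  settles one direction. For the other, the tail of \<open>g\<close> gets \<open>a / 2\<close>
  through \<open>Lp_tail_truncation\<close>, and convergence on the resulting \<open>S\<close> takes
  care of the rest.\<close>

lemma Lp_integral_tendsto_0_iff:
  fixes f :: "'i \<Rightarrow> 'a \<Rightarrow> real"
  assumes p: "0 < p" and f: "\<forall>\<^sub>F \<alpha> in \<F>. f \<alpha> \<in> borel_measurable M"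
  shows "(\<forall>g\<in>Lp_functions M p. ((\<lambda>\<alpha>. \<integral>x. min (\<bar>f \<alpha> x\<bar> powr p) (\<bar>g x\<bar> powr p) \<partial>M) \<longlongrightarrow> 0) \<F>) \<longleftrightarrow>
    (\<forall>S\<in>finite_measure_sets M. ((\<lambda>\<alpha>. \<integral>x. min (\<bar>f \<alpha> x\<bar> powr p) (indicat_real S x) \<partial>M) \<longlongrightarrow> 0) \<F>)"
proof (intro iffI ballI)
  fix S assume L: "\<forall>g\<in>Lp_functions M p. ((\<lambda>\<alpha>. \<integral>x. min (\<bar>f \<alpha> x\<bar> powr p) (\<bar>g x\<bar> powr p) \<partial>M) \<longlongrightarrow> 0) \<F>"
    and S: "S \<in> finite_measure_sets M"
  have *: "\<bar>indicat_real S x\<bar> powr p = indicat_real S x" for x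
    using p by (simp add: indicator_def)
  have "indicat_real S \<in> Lp_functions M p"
    using S unfolding Lp_functions_def mem_Collect_eq * by (simp add: finite_measure_sets_def borel_measurable_indicator)
  from bspec[OF L this]
  show "((\<lambda>\<alpha>. \<integral>x. min (\<bar>f \<alpha> x\<bar> powr p) (indicat_real S x) \<partial>M) \<longlongrightarrow> 0) \<F>"
    by (simp only: *)
next
  fix g assume R: "\<forall>S\<in>finite_measure_sets M. ((\<lambda>\<alpha>. \<integral>x. min (\<bar>f \<alpha> x\<bar> powr p) (indicat_real S x) \<partial>M) \<longlongrightarrow> 0) \<F>"
    and g: "g \<in> Lp_functions M p"
  show "((\<lambda>\<alpha>. \<integral>x. min (\<bar>f \<alpha> x\<bar> powr p) (\<bar>g x\<bar> powr p) \<partial>M) \<longlongrightarrow> 0) \<F>"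
  proof (rule order_tendstoI)
    fix a :: real assume "a < 0"
    then show "\<forall>\<^sub>F \<alpha> in \<F>. a < (\<integral>x. min (\<bar>f \<alpha> x\<bar> powr p) (\<bar>g x\<bar> powr p) \<partial>M)"
      by (intro always_eventually allI order.strict_trans2[OF _ Bochner_Integration.integral_nonneg]) auto
  next
    fix a :: real assume a: "0 < a"
    from Lp_tail_truncation[OF g, of "a / 2"] a obtain S k where Sk: "S \<in> finite_measure_sets M" "0 < k"
      "\<And>h. h \<in> borel_measurable M \<Longrightarrow> (\<integral>x. min (\<bar>h x\<bar> powr p) (\<bar>g x\<bar> powr p) \<partial>M)
        \<le> a / 2 + k * (\<integral>x. min (\<bar>h x\<bar> powr p) (indicat_real S x) \<partial>M)" by auto
    have "\<forall>\<^sub>F \<alpha> in \<F>. (\<integral>x. min (\<bar>f \<alpha> x\<bar> powr p) (indicat_real S x) \<partial>M) < a / (2 * k)"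
      using R Sk a by (intro order_tendstoD(2)[of _ 0]) auto
    then show "\<forall>\<^sub>F \<alpha> in \<F>. (\<integral>x. min (\<bar>f \<alpha> x\<bar> powr p) (\<bar>g x\<bar> powr p) \<partial>M) < a"
      using f
    proof eventually_elim
      case (elim \<alpha>)
      have "k * (\<integral>x. min (\<bar>f \<alpha> x\<bar> powr p) (indicat_real S x) \<partial>M) < a / 2"
        using elim(1) Sk(2) by (simp add: field_simps)
      then show ?case using Sk(3)[OF elim(2)] by linarith
    qed
  qed
qed

section \<open>The truncated integral as a monotone, subadditive functional\<close>

definition trunc_integral :: "'a measure \<Rightarrow> 'a set \<Rightarrow> ('a \<Rightarrow> real) \<Rightarrow> real" where
  "trunc_integral M S f = (\<integral>x. min \<bar>f x\<bar> 1 * indicat_real S x \<partial>M)"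

lemma integrable_trunc:
  "S \<in> finite_measure_sets M \<Longrightarrow> f \<in> borel_measurable M \<Longrightarrow>
    integrable M (\<lambda>x. min \<bar>f x\<bar> 1 * indicat_real S x)"
  by (rule integrable_bounded_support[where c = 1]) (auto simp: indicator_def)

lemma trunc_integral_nonneg: "0 \<le> trunc_integral M S f"
  unfolding trunc_integral_def by (rule Bochner_Integration.integral_nonneg) simp

lemma trunc_integral_mono:
  assumes "S \<in> finite_measure_sets M" "f \<in> borel_measurable M" "g \<in> borel_measurable M"
    and "AE x in M. x \<in> S \<longrightarrow> \<bar>f x\<bar> \<le> \<bar>g x\<bar>"
  shows "trunc_integral M S f \<le> trunc_integral M S g"
  unfolding trunc_integral_def
proof (rule integral_mono_AE)
  show "AE x in M. min \<bar>f x\<bar> 1 * indicat_real S x \<le> min \<bar>g x\<bar> 1 * indicat_real S x"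
    using assms(4) by eventually_elim (auto simp: indicator_def)
qed (use assms integrable_trunc in auto)

lemma trunc_integral_cong:
  assumes "S \<in> finite_measure_sets M" "f \<in> borel_measurable M" "g \<in> borel_measurable M"
    and ae: "AE x in M. f x = g x"
  shows "trunc_integral M S f = trunc_integral M S g"
  by (intro antisym trunc_integral_mono assms; use ae in eventually_elim; simp)

lemma trunc_integral_superset_mono:
  assumes "S \<in> finite_measure_sets M" "T \<in> finite_measure_sets M" "f \<in> borel_measurable M" "S \<subseteq> T"
  shows "trunc_integral M S f \<le> trunc_integral M T f"
  unfolding trunc_integral_def
proof (rule integral_mono)
  show "min \<bar>f x\<bar> 1 * indicat_real S x \<le> min \<bar>f x\<bar> 1 * indicat_real T x" for x
    using assms(4) by (auto simp: indicator_def)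
qed (use assms integrable_trunc in auto)

lemma trunc_integral_triangle:
  assumes "S \<in> finite_measure_sets M" "f \<in> borel_measurable M" "g \<in> borel_measurable M"
  shows "trunc_integral M S (\<lambda>x. f x + g x) \<le> trunc_integral M S f + trunc_integral M S g"
proof -
  have "trunc_integral M S (\<lambda>x. f x + g x)
      \<le> (\<integral>x. min \<bar>f x\<bar> 1 * indicat_real S x + min \<bar>g x\<bar> 1 * indicat_real S x \<partial>M)"
    unfolding trunc_integral_def
  proof (rule integral_mono)
    show "min \<bar>f x + g x\<bar> 1 * indicat_real S x
        \<le> min \<bar>f x\<bar> 1 * indicat_real S x + min \<bar>g x\<bar> 1 * indicat_real S x" for x
      by (auto simp: indicator_def)
  qed (intro Bochner_Integration.integrable_add integrable_trunc borel_measurable_add assms)+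
  then show ?thesis using assms by (simp add: trunc_integral_def integrable_trunc)
qed

lemma trunc_integral_minus: "trunc_integral M S (\<lambda>x. - f x) = trunc_integral M S f"
  by (simp add: trunc_integral_def)

lemma trunc_integral_eq_0_iff:
  assumes "S \<in> finite_measure_sets M" "f \<in> borel_measurable M"
  shows "trunc_integral M S f = 0 \<longleftrightarrow> (AE x in M. x \<in> S \<longrightarrow> f x = 0)"
proof -
  have "trunc_integral M S f = 0 \<longleftrightarrow> (AE x in M. min \<bar>f x\<bar> 1 * indicat_real S x = 0)"
    unfolding trunc_integral_def
    by (rule integral_nonneg_eq_0_iff_AE) (use integrable_trunc[OF assms] in auto)
  moreover have "min \<bar>f x\<bar> 1 * indicat_real S x = 0 \<longleftrightarrow> (x \<in> S \<longrightarrow> f x = 0)" for x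
    by (auto simp: indicator_def min_def)
  ultimately show ?thesis by simp
qed

lemma trunc_integral_zero: "trunc_integral M S (\<lambda>x. 0) = 0"
  by (simp add: trunc_integral_def)

lemma trunc_integral_le_measure:
  assumes "S \<in> finite_measure_sets M" "f \<in> borel_measurable M"
  shows "trunc_integral M S f \<le> measure M S"
proof -
  have "trunc_integral M S f \<le> (\<integral>x. indicat_real S x \<partial>M)"
    unfolding trunc_integral_def
  proof (rule integral_mono[OF integrable_trunc[OF assms]])
    show "integrable M (indicat_real S)"
      using assms(1) by (auto simp: finite_measure_sets_def)
  qed (auto simp: indicator_def)
  also have "\<dots> = measure M S"
    using assms(1) sets.sets_into_space[of S M] by (simp add: finite_measure_sets_def Int_absorb2)
  finally show ?thesis .
qed

lemma trunc_integral_tendsto: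
  assumes S: "S \<in> finite_measure_sets M" and [measurable]: "\<And>n. f n \<in> borel_measurable M" "g \<in> borel_measurable M"
    and ae: "AE x in M. x \<in> S \<longrightarrow> (\<lambda>n. f n x) \<longlonglongrightarrow> g x"
  shows "(\<lambda>n. trunc_integral M S (f n)) \<longlonglongrightarrow> trunc_integral M S g"
  unfolding trunc_integral_def
proof (rule integral_dominated_convergence[where w = "indicat_real S"])
  note [measurable] = finite_measure_sets_measurable[OF S]
  show "(\<lambda>x. min \<bar>g x\<bar> 1 * indicat_real S x) \<in> borel_measurable M"
    and "(\<lambda>x. min \<bar>f n x\<bar> 1 * indicat_real S x) \<in> borel_measurable M" for n by measurable
  show "AE x in M. (\<lambda>n. min \<bar>f n x\<bar> 1 * indicat_real S x) \<longlonglongrightarrow> min \<bar>g x\<bar> 1 * indicat_real S x"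
    using ae
  proof eventually_elim
    case (elim x)
    then show ?case
      by (cases "x \<in> S") (auto intro!: tendsto_intros)
  qed
qed (use S in \<open>auto simp: finite_measure_sets_def indicator_def\<close>)

text \<open>The truncation destroys homogeneity: \<open>min (k * t) 1 \<le> k * min t 1\<close> can
  fail for \<open>k < 1\<close>. Hence the factor is a bound \<open>k\<close> that is at least 1,
  and small scalars need the separate estimate that follows.\<close>

lemma trunc_integral_scale_le:
  assumes "S \<in> finite_measure_sets M" "f \<in> borel_measurable M" "\<bar>c\<bar> \<le> k" "1 \<le> k"
  shows "trunc_integral M S (\<lambda>x. c * f x) \<le> k * trunc_integral M S f"
proof -
  have "min \<bar>c * f x\<bar> 1 \<le> k * min \<bar>f x\<bar> 1" for x
  proof -
    have "\<bar>c * f x\<bar> \<le> k * \<bar>f x\<bar>" using assms(3) by (simp add: abs_mult mult_right_mono)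
    then show ?thesis using assms(4) by (auto simp: min_def)
  qed
  then have "min \<bar>c * f x\<bar> 1 * indicat_real S x \<le> k * (min \<bar>f x\<bar> 1 * indicat_real S x)" for x
    by (auto simp: indicator_def)
  then have "trunc_integral M S (\<lambda>x. c * f x) \<le> (\<integral>x. k * (min \<bar>f x\<bar> 1 * indicat_real S x) \<partial>M)"
    unfolding trunc_integral_def
    by (intro integral_mono integrable_trunc integrable_mult_right borel_measurable_times
        borel_measurable_const assms)
  then show ?thesis by (simp add: trunc_integral_def)
qed

text \<open>Continuity of scalar multiplication at 0 for a fixed \<open>f\<close>. As
  \<open>f\<close> may be unbounded, no rate in \<open>c\<close> is available; dominated convergence
  along \<open>1 / Suc n\<close> gives one good scalar, and monotonicity covers all smaller
  ones.\<close>

lemma trunc_integral_scale_tendsto_0: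
  assumes "S \<in> finite_measure_sets M" "f \<in> borel_measurable M" "0 < e"
  shows "\<exists>d>0. \<forall>c. \<bar>c\<bar> < d \<longrightarrow> trunc_integral M S (\<lambda>x. c * f x) < e"
proof -
  have "(\<lambda>n. trunc_integral M S (\<lambda>x. (1 / real (Suc n)) * f x)) \<longlonglongrightarrow> trunc_integral M S (\<lambda>x. 0)"
  proof (rule trunc_integral_tendsto)
    have "(\<lambda>n. (1 / real (Suc n)) * f x) \<longlonglongrightarrow> 0 * f x" for x
      by (intro tendsto_intros LIMSEQ_inverse_real_of_nat[unfolded inverse_eq_divide])
    then show "AE x in M. x \<in> S \<longrightarrow> (\<lambda>n. (1 / real (Suc n)) * f x) \<longlonglongrightarrow> 0" by simp
  qed (use assms in auto)
  then have "\<forall>\<^sub>F n in sequentially. trunc_integral M S (\<lambda>x. (1 / real (Suc n)) * f x) < e"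
    using assms(3) by (intro order_tendstoD(2)) (auto simp: trunc_integral_zero)
  then obtain n where n: "trunc_integral M S (\<lambda>x. (1 / real (Suc n)) * f x) < e"
    by (auto simp: eventually_sequentially)
  have "trunc_integral M S (\<lambda>x. c * f x) < e" if "\<bar>c\<bar> < 1 / real (Suc n)" for c
  proof -
    have "trunc_integral M S (\<lambda>x. c * f x) \<le> trunc_integral M S (\<lambda>x. (1 / real (Suc n)) * f x)"
    proof (rule trunc_integral_mono)
      have "\<bar>c * f x\<bar> \<le> \<bar>(1 / real (Suc n)) * f x\<bar>" for x
        using mult_right_mono[of "\<bar>c\<bar>" "1 / real (Suc n)" "\<bar>f x\<bar>"] that
        by (simp add: abs_mult del: of_nat_Suc)
      then show "AE x in M. x \<in> S \<longrightarrow> \<bar>c * f x\<bar> \<le> \<bar>(1 / real (Suc n)) * f x\<bar>" by simp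
    qed (use assms in auto)
    then show ?thesis using n by simp
  qed
  then show ?thesis by (intro exI[of _ "1 / real (Suc n)"]) simp
qed

text \<open>Semi-finiteness enters here. Every part of the exceptional set with finite measure is
  null; an exceptional set of infinite measure would have a part of finite positive measure.\<close>

lemma semi_finite_AE_leI:
  fixes f g :: "'a \<Rightarrow> real"
  assumes M: "semi_finite M" and [measurable]: "f \<in> borel_measurable M" "g \<in> borel_measurable M"
    and le: "\<And>S. S \<in> finite_measure_sets M \<Longrightarrow> AE x in M. x \<in> S \<longrightarrow> f x \<le> g x"
  shows "AE x in M. f x \<le> g x"
proof -
  let ?N = "{x \<in> space M. \<not> f x \<le> g x}"
  have null: "emeasure M T = 0" if T: "T \<in> finite_measure_sets M" "T \<subseteq> ?N" for T
  proof -
    have [measurable]: "T \<in> sets M" using T by (simp add: finite_measure_sets_def)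
    have "AE x in M. x \<notin> T" using le[OF T(1)] T(2) by (auto elim!: AE_mp)
    then have "T \<in> null_sets M" by (simp add: AE_iff_null_sets)
    then show ?thesis by auto
  qed
  have N: "?N \<in> sets M" by measurable
  have "emeasure M ?N = 0"
  proof (cases "emeasure M ?N = \<infinity>")
    case True
    then obtain T where "T \<in> sets M" "T \<subseteq> ?N" "0 < emeasure M T" "emeasure M T < \<infinity>"
      using M N unfolding semi_finite_def by meson
    then show ?thesis using null[of T] by (auto simp: finite_measure_sets_def)
  next
    case False
    then show ?thesis using N by (intro null) (auto simp: finite_measure_sets_def less_top)
  qed
  then show ?thesis using N by (simp add: AE_iff_measurable[OF N])
qed

section \<open>The topology of convergence in measure\<close>

abbreviation ae_class :: "'a measure \<Rightarrow> ('a \<Rightarrow> real) \<Rightarrow> ('a \<Rightarrow> real) set" where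
  "ae_class M f \<equiv> ae_eq_rel M `` {f}"

definition L0_ball :: "'a measure \<Rightarrow> ('a \<Rightarrow> real) \<Rightarrow> 'a set \<Rightarrow> real \<Rightarrow> ('a \<Rightarrow> real) set set" where
  "L0_ball M f S e =
     ae_class M ` {g \<in> borel_measurable M. trunc_integral M S (\<lambda>x. g x - f x) < e}"

text \<open>A topology generated by a family of pseudometrics, one for each \<open>S\<close>, since
  the sets \<open>S\<close> need not have a countable cofinal family. Quantifying over
  representatives \<open>f\<close> is consistent because almost everywhere equal centres have the
  same balls.\<close>

definition measure_topology :: "'a measure \<Rightarrow> ('a \<Rightarrow> real) set topology" where
  "measure_topology M = topology (\<lambda>U. U \<subseteq> carrier (L0 M) \<and>
     (\<forall>f\<in>borel_measurable M. ae_class M f \<in> U \<longrightarrow>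
        (\<exists>S\<in>finite_measure_sets M. \<exists>e>0. L0_ball M f S e \<subseteq> U)))"

lemma empty_finite_measure_sets: "{} \<in> finite_measure_sets M"
  by (simp add: finite_measure_sets_def)

lemma L0_ball_subset_carrier: "L0_ball M f S e \<subseteq> carrier (L0 M)"
  by (auto simp: L0_ball_def L0_class_closed)

lemma ae_class_mem_L0_ball:
  assumes "S \<in> finite_measure_sets M" "f \<in> borel_measurable M" "h \<in> borel_measurable M"
  shows "ae_class M h \<in> L0_ball M f S e \<longleftrightarrow> trunc_integral M S (\<lambda>x. h x - f x) < e"
proof
  assume "ae_class M h \<in> L0_ball M f S e"
  then obtain g where g: "g \<in> borel_measurable M" "trunc_integral M S (\<lambda>x. g x - f x) < e"
    "ae_class M h = ae_class M g" by (auto simp: L0_ball_def)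
  then have "AE x in M. h x = g x" using assms by (simp add: L0_class_eq_iff)
  then have "AE x in M. h x - f x = g x - f x" by eventually_elim simp
  then have "trunc_integral M S (\<lambda>x. h x - f x) = trunc_integral M S (\<lambda>x. g x - f x)"
    by (intro trunc_integral_cong) (use assms g in auto)
  with g show "trunc_integral M S (\<lambda>x. h x - f x) < e" by simp
qed (use assms in \<open>auto simp: L0_ball_def\<close>)

lemma L0_ball_mono:
  assumes "S \<in> finite_measure_sets M" "T \<in> finite_measure_sets M" "f \<in> borel_measurable M"
    and "S \<subseteq> T" "d \<le> e"
  shows "L0_ball M f T d \<subseteq> L0_ball M f S e"
proof -
  have "trunc_integral M S (\<lambda>x. g x - f x) < e"
    if "g \<in> borel_measurable M" "trunc_integral M T (\<lambda>x. g x - f x) < d" for g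
    using trunc_integral_superset_mono[OF assms(1,2) borel_measurable_diff[OF that(1) assms(3)] assms(4)]
      that(2) assms(5) by linarith
  then show ?thesis unfolding L0_ball_def by (intro image_mono) auto
qed

text \<open>The defining predicate is stable under intersection because two balls with a common
  centre contain the ball for the union of their sets and the smaller radius.\<close>

lemma openin_measure_topology:
  "openin (measure_topology M) U \<longleftrightarrow> U \<subseteq> carrier (L0 M) \<and>
     (\<forall>f\<in>borel_measurable M. ae_class M f \<in> U \<longrightarrow>
        (\<exists>S\<in>finite_measure_sets M. \<exists>e>0. L0_ball M f S e \<subseteq> U))" (is "_ \<longleftrightarrow> ?open U")
proof -
  have "istopology ?open"
    unfolding istopology_def
  proof (intro conjI allI impI)
    fix U V assume "?open U" "?open V"
    then show "U \<inter> V \<subseteq> carrier (L0 M)" by auto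
    show "\<forall>f\<in>borel_measurable M. ae_class M f \<in> U \<inter> V \<longrightarrow>
        (\<exists>S\<in>finite_measure_sets M. \<exists>e>0. L0_ball M f S e \<subseteq> U \<inter> V)"
    proof (intro ballI impI)
      fix f assume f: "f \<in> borel_measurable M" "ae_class M f \<in> U \<inter> V"
      obtain S d where S: "S \<in> finite_measure_sets M" "0 < d" "L0_ball M f S d \<subseteq> U"
        using \<open>?open U\<close> f by blast
      obtain T e where T: "T \<in> finite_measure_sets M" "0 < e" "L0_ball M f T e \<subseteq> V"
        using \<open>?open V\<close> f by blast
      have "L0_ball M f (S \<union> T) (min d e) \<subseteq> L0_ball M f S d"
        "L0_ball M f (S \<union> T) (min d e) \<subseteq> L0_ball M f T e"
        by (intro L0_ball_mono f finite_measure_sets_Un S T; simp)+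
      then show "\<exists>S\<in>finite_measure_sets M. \<exists>e>0. L0_ball M f S e \<subseteq> U \<inter> V"
        using S T by (intro bexI[of _ "S \<union> T"] exI[of _ "min d e"]) (auto intro: finite_measure_sets_Un)
    qed
  next
    fix \<U> assume \<U>: "\<forall>U\<in>\<U>. ?open U"
    then show "\<Union>\<U> \<subseteq> carrier (L0 M)" by blast
    show "\<forall>f\<in>borel_measurable M. ae_class M f \<in> \<Union>\<U> \<longrightarrow>
        (\<exists>S\<in>finite_measure_sets M. \<exists>e>0. L0_ball M f S e \<subseteq> \<Union>\<U>)"
    proof (intro ballI impI)
      fix f assume f: "f \<in> borel_measurable M" "ae_class M f \<in> \<Union>\<U>"
      then obtain U where U: "U \<in> \<U>" "ae_class M f \<in> U" by blast
      with \<U> f obtain S d where "S \<in> finite_measure_sets M" "0 < d" "L0_ball M f S d \<subseteq> U"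
        by blast
      with U show "\<exists>S\<in>finite_measure_sets M. \<exists>e>0. L0_ball M f S e \<subseteq> \<Union>\<U>" by blast
    qed
  qed
  then show ?thesis unfolding measure_topology_def by (simp only: topology_inverse')
qed

lemma openin_L0_ball:
  assumes S: "S \<in> finite_measure_sets M" and f: "f \<in> borel_measurable M"
  shows "openin (measure_topology M) (L0_ball M f S e)"
  unfolding openin_measure_topology
proof (intro conjI ballI impI)
  fix g assume g: "g \<in> borel_measurable M" "ae_class M g \<in> L0_ball M f S e"
  then have lt: "trunc_integral M S (\<lambda>x. g x - f x) < e"
    by (simp add: ae_class_mem_L0_ball S f)
  have "L0_ball M g S (e - trunc_integral M S (\<lambda>x. g x - f x)) \<subseteq> L0_ball M f S e"
    unfolding L0_ball_def
  proof (intro image_mono Collect_mono impI conjI; elim conjE)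
    fix h assume h: "h \<in> borel_measurable M"
      "trunc_integral M S (\<lambda>x. h x - g x) < e - trunc_integral M S (\<lambda>x. g x - f x)"
    have "trunc_integral M S (\<lambda>x. (h x - g x) + (g x - f x))
        \<le> trunc_integral M S (\<lambda>x. h x - g x) + trunc_integral M S (\<lambda>x. g x - f x)"
      by (intro trunc_integral_triangle S borel_measurable_diff h g f)
    with h show "trunc_integral M S (\<lambda>x. h x - f x) < e" by simp
  qed
  with S lt show "\<exists>S'\<in>finite_measure_sets M. \<exists>e'>0. L0_ball M g S' e' \<subseteq> L0_ball M f S e"
    by (intro bexI[of _ S] exI[of _ "e - trunc_integral M S (\<lambda>x. g x - f x)"]) auto
qed (rule L0_ball_subset_carrier)

lemma centre_mem_L0_ball:
  "f \<in> borel_measurable M \<Longrightarrow> 0 < e \<Longrightarrow> ae_class M f \<in> L0_ball M f S e"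
  by (auto simp: L0_ball_def trunc_integral_zero)

lemma topspace_measure_topology: "topspace (measure_topology M) = carrier (L0 M)"
proof -
  have "openin (measure_topology M) (carrier (L0 M))"
    unfolding openin_measure_topology
    by (intro conjI ballI impI bexI[OF _ empty_finite_measure_sets] exI[of _ 1] L0_ball_subset_carrier) auto
  then show ?thesis
    unfolding topspace_def openin_measure_topology by blast
qed

lemma limitin_measure_topology:
  assumes g: "g \<in> borel_measurable M"
    and F: "\<forall>\<^sub>F \<alpha> in \<F>. f \<alpha> \<in> borel_measurable M \<and> F \<alpha> = ae_class M (f \<alpha>)"
  shows "limitin (measure_topology M) F (ae_class M g) \<F> \<longleftrightarrow>
    (\<forall>S\<in>finite_measure_sets M. ((\<lambda>\<alpha>. trunc_integral M S (\<lambda>x. f \<alpha> x - g x)) \<longlongrightarrow> 0) \<F>)"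
proof
  assume L: "limitin (measure_topology M) F (ae_class M g) \<F>"
  show "\<forall>S\<in>finite_measure_sets M. ((\<lambda>\<alpha>. trunc_integral M S (\<lambda>x. f \<alpha> x - g x)) \<longlongrightarrow> 0) \<F>"
  proof (rule ballI, rule order_tendstoI)
    fix S and a :: real
    assume S: "S \<in> finite_measure_sets M" and a: "0 < a"
    have "\<forall>\<^sub>F \<alpha> in \<F>. F \<alpha> \<in> L0_ball M g S a"
      using L openin_L0_ball[OF S g] centre_mem_L0_ball[OF g a] unfolding limitin_def by blast
    then show "\<forall>\<^sub>F \<alpha> in \<F>. trunc_integral M S (\<lambda>x. f \<alpha> x - g x) < a"
      using F by eventually_elim (simp add: ae_class_mem_L0_ball S g)
  qed (simp add: order.strict_trans2[OF _ trunc_integral_nonneg])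
next
  assume R: "\<forall>S\<in>finite_measure_sets M. ((\<lambda>\<alpha>. trunc_integral M S (\<lambda>x. f \<alpha> x - g x)) \<longlongrightarrow> 0) \<F>"
  show "limitin (measure_topology M) F (ae_class M g) \<F>"
    unfolding limitin_def topspace_measure_topology
  proof (intro conjI allI impI L0_class_closed g)
    fix U assume "openin (measure_topology M) U \<and> ae_class M g \<in> U"
    then obtain S e where S: "S \<in> finite_measure_sets M" "0 < e" "L0_ball M g S e \<subseteq> U"
      using g unfolding openin_measure_topology by blast
    have "\<forall>\<^sub>F \<alpha> in \<F>. trunc_integral M S (\<lambda>x. f \<alpha> x - g x) < e"
      using R S by (intro order_tendstoD(2)) auto
    then show "\<forall>\<^sub>F \<alpha> in \<F>. F \<alpha> \<in> U"
      using F
    proof eventually_elim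
      case (elim \<alpha>)
      then have "F \<alpha> \<in> L0_ball M g S e" by (simp add: ae_class_mem_L0_ball S g)
      then show ?case using S by blast
    qed
  qed
qed

lemma L0_ball_add:
  assumes S: "S \<in> finite_measure_sets M" and f: "f \<in> borel_measurable M" and g: "g \<in> borel_measurable M"
    and u: "u \<in> L0_ball M f S d" and v: "v \<in> L0_ball M g S e"
  shows "vadd (L0 M) u v \<in> L0_ball M (\<lambda>x. f x + g x) S (d + e)"
proof -
  obtain f' where f': "f' \<in> borel_measurable M" "trunc_integral M S (\<lambda>x. f' x - f x) < d" "u = ae_class M f'"
    using u by (auto simp: L0_ball_def)
  obtain g' where g': "g' \<in> borel_measurable M" "trunc_integral M S (\<lambda>x. g' x - g x) < e" "v = ae_class M g'"
    using v by (auto simp: L0_ball_def)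
  have "trunc_integral M S (\<lambda>x. (f' x - f x) + (g' x - g x))
      \<le> trunc_integral M S (\<lambda>x. f' x - f x) + trunc_integral M S (\<lambda>x. g' x - g x)"
    by (intro trunc_integral_triangle S borel_measurable_diff f g f' g')
  also have "(\<lambda>x. (f' x - f x) + (g' x - g x)) = (\<lambda>x. (f' x + g' x) - (f x + g x))" by auto
  finally show ?thesis
    using f' g' f g S by (simp add: L0_vadd_class ae_class_mem_L0_ball)
qed

section \<open>Vector space topology, solidity and separation\<close>

lemma linear_measure_topology: "linear_topology (L0 M) (measure_topology M)"
proof -
  interpret vector_lattice "L0 M" by (rule vector_lattice_L0)
  let ?\<tau> = "measure_topology M"
  have "continuous_map (prod_topology ?\<tau> ?\<tau>) ?\<tau> (\<lambda>(x, y). vadd (L0 M) x y)"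
    unfolding continuous_map_def
  proof (intro conjI allI impI)
    fix U assume U: "openin ?\<tau> U"
    show "openin (prod_topology ?\<tau> ?\<tau>)
        {z \<in> topspace (prod_topology ?\<tau> ?\<tau>). (case z of (x, y) \<Rightarrow> vadd (L0 M) x y) \<in> U}"
      unfolding openin_prod_topology_alt
    proof (intro allI impI)
      fix u v
      assume "(u, v) \<in> {z \<in> topspace (prod_topology ?\<tau> ?\<tau>). (case z of (x, y) \<Rightarrow> vadd (L0 M) x y) \<in> U}"
      then obtain f g where fg: "f \<in> borel_measurable M" "u = ae_class M f"
        "g \<in> borel_measurable M" "v = ae_class M g" "vadd (L0 M) u v \<in> U"
        by (auto simp: topspace_measure_topology elim!: L0_carrierE)
      then have "ae_class M (\<lambda>x. f x + g x) \<in> U" "(\<lambda>x. f x + g x) \<in> borel_measurable M"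
        by (auto simp: L0_vadd_class)
      then obtain S e where S: "S \<in> finite_measure_sets M" "0 < e" "L0_ball M (\<lambda>x. f x + g x) S e \<subseteq> U"
        using U unfolding openin_measure_topology by blast
      have "vadd (L0 M) x y \<in> U" if "x \<in> L0_ball M f S (e/2)" "y \<in> L0_ball M g S (e/2)" for x y
        using L0_ball_add[OF S(1) fg(1,3) that] S(3) by auto
      moreover have uv: "u \<in> L0_ball M f S (e/2)" "v \<in> L0_ball M g S (e/2)"
        using fg S(2) by (auto intro: centre_mem_L0_ball)
      moreover have "L0_ball M f S (e/2) \<times> L0_ball M g S (e/2) \<subseteq> topspace (prod_topology ?\<tau> ?\<tau>)"
        by (auto simp: topspace_measure_topology intro: subsetD[OF L0_ball_subset_carrier])
      ultimately have "L0_ball M f S (e/2) \<times> L0_ball M g S (e/2) \<subseteq>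
          {z \<in> topspace (prod_topology ?\<tau> ?\<tau>). (case z of (x, y) \<Rightarrow> vadd (L0 M) x y) \<in> U}"
        by auto
      then show "\<exists>V W. openin ?\<tau> V \<and> openin ?\<tau> W \<and> u \<in> V \<and> v \<in> W \<and> V \<times> W \<subseteq>
          {z \<in> topspace (prod_topology ?\<tau> ?\<tau>). (case z of (x, y) \<Rightarrow> vadd (L0 M) x y) \<in> U}"
        by (intro exI[of _ "L0_ball M f S (e/2)", OF exI[of _ "L0_ball M g S (e/2)"]] conjI
            openin_L0_ball S(1) fg(1,3) uv)
    qed
  qed (auto simp: topspace_measure_topology vadd_closed)
  moreover have "continuous_map (prod_topology euclideanreal ?\<tau>) ?\<tau> (\<lambda>(c, x). vscale (L0 M) c x)"
    unfolding continuous_map_def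
  proof (intro conjI allI impI)
    fix U assume U: "openin ?\<tau> U"
    show "openin (prod_topology euclideanreal ?\<tau>)
        {z \<in> topspace (prod_topology euclideanreal ?\<tau>). (case z of (c, x) \<Rightarrow> vscale (L0 M) c x) \<in> U}"
      unfolding openin_prod_topology_alt
    proof (intro allI impI)
      fix c u
      assume "(c, u) \<in> {z \<in> topspace (prod_topology euclideanreal ?\<tau>). (case z of (c, x) \<Rightarrow> vscale (L0 M) c x) \<in> U}"
      then obtain f where f: "f \<in> borel_measurable M" "u = ae_class M f" "vscale (L0 M) c u \<in> U"
        by (auto simp: topspace_measure_topology elim!: L0_carrierE)
      then have "ae_class M (\<lambda>x. c * f x) \<in> U" "(\<lambda>x. c * f x) \<in> borel_measurable M"
        by (auto simp: L0_vscale_class)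
      then obtain S e where S: "S \<in> finite_measure_sets M" "0 < e" "L0_ball M (\<lambda>x. c * f x) S e \<subseteq> U"
        using U unfolding openin_measure_topology by blast
      define k where "k = \<bar>c\<bar> + 1"
      have k: "1 \<le> k" by (simp add: k_def)
      obtain d where d: "0 < d" "\<And>a. \<bar>a\<bar> < d \<Longrightarrow> trunc_integral M S (\<lambda>x. a * f x) < e / 2"
        using trunc_integral_scale_tendsto_0[OF S(1) f(1), of "e / 2"] S(2) by auto
      have mem: "vscale (L0 M) a y \<in> U" if a: "\<bar>a - c\<bar> < min d 1" and y: "y \<in> L0_ball M f S (e / (2 * k))" for a y
      proof -
        obtain g where g: "g \<in> borel_measurable M" "trunc_integral M S (\<lambda>x. g x - f x) < e / (2 * k)" "y = ae_class M g"
          using y by (auto simp: L0_ball_def)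
        \<comment> \<open>The difference \<open>a * g - c * f\<close> is
          \<open>a * (g - f) + (a - c) * f\<close>. The constant \<open>k\<close> bounds all scalars
          within distance 1 of \<open>c\<close>, which handles the first term; the second is a small
          multiple of the fixed function \<open>f\<close>, for which \<open>d\<close> was
          chosen.\<close>
        have "trunc_integral M S (\<lambda>x. a * (g x - f x) + (a - c) * f x)
            \<le> trunc_integral M S (\<lambda>x. a * (g x - f x)) + trunc_integral M S (\<lambda>x. (a - c) * f x)"
          by (intro trunc_integral_triangle S) (use f g in auto)
        also have "trunc_integral M S (\<lambda>x. (a - c) * f x) < e / 2" using a by (intro d) simp
        also have "trunc_integral M S (\<lambda>x. a * (g x - f x)) \<le> k * trunc_integral M S (\<lambda>x. g x - f x)"
          by (intro trunc_integral_scale_le S k) (use f g a in \<open>auto simp: k_def\<close>)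
        also have "k * trunc_integral M S (\<lambda>x. g x - f x) \<le> k * (e / (2 * k))"
          using g(2) k by (intro mult_left_mono) auto
        also have "k * (e / (2 * k)) = e / 2" using k by simp
        also have "(\<lambda>x. a * (g x - f x) + (a - c) * f x) = (\<lambda>x. a * g x - c * f x)"
          by (auto simp: algebra_simps)
        finally have "ae_class M (\<lambda>x. a * g x) \<in> L0_ball M (\<lambda>x. c * f x) S e"
          using f g S by (simp add: ae_class_mem_L0_ball)
        then show ?thesis using S(3) g by (auto simp: L0_vscale_class)
      qed
      have car: "y \<in> carrier (L0 M)" if "y \<in> L0_ball M f S (e / (2 * k))" for y
        using that L0_ball_subset_carrier by blast
      show "\<exists>V W. openin euclideanreal V \<and> openin ?\<tau> W \<and> c \<in> V \<and> u \<in> W \<and> V \<times> W \<subseteq>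
          {z \<in> topspace (prod_topology euclideanreal ?\<tau>). (case z of (c, x) \<Rightarrow> vscale (L0 M) c x) \<in> U}"
      proof (intro exI conjI)
        show "openin euclideanreal (ball c (min d 1))" by simp
        show "openin ?\<tau> (L0_ball M f S (e / (2 * k)))" by (intro openin_L0_ball S f)
        show "c \<in> ball c (min d 1)" using d by simp
        show "u \<in> L0_ball M f S (e / (2 * k))" using f S k by (auto intro: centre_mem_L0_ball)
        show "ball c (min d 1) \<times> L0_ball M f S (e / (2 * k)) \<subseteq>
          {z \<in> topspace (prod_topology euclideanreal ?\<tau>). (case z of (c, x) \<Rightarrow> vscale (L0 M) c x) \<in> U}"
          using mem car by (auto simp: topspace_measure_topology dist_real_def abs_minus_commute)
      qed
    qed
  qed (auto simp: topspace_measure_topology vscale_closed)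
  ultimately show ?thesis by (simp add: linear_topology_def topspace_measure_topology)
qed

lemma vabs_le_iff:
  assumes "f \<in> borel_measurable M" "g \<in> borel_measurable M"
  shows "vabs (L0 M) (ae_class M f) \<sqsubseteq>\<^bsub>L0 M\<^esub> vabs (L0 M) (ae_class M g) \<longleftrightarrow> (AE x in M. \<bar>f x\<bar> \<le> \<bar>g x\<bar>)"
  using assms by (simp add: L0_vabs_class L0_le_iff)

lemma solid_L0_ball:
  assumes S: "S \<in> finite_measure_sets M"
  shows "solid (L0 M) (L0_ball M (\<lambda>x. 0) S e)"
  unfolding solid_def
proof (intro conjI ballI impI L0_ball_subset_carrier)
  fix u v assume u: "u \<in> L0_ball M (\<lambda>x. 0) S e" and v: "v \<in> carrier (L0 M)"
    and le: "vabs (L0 M) v \<sqsubseteq>\<^bsub>L0 M\<^esub> vabs (L0 M) u"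
  obtain f where f: "f \<in> borel_measurable M" "trunc_integral M S f < e" "u = ae_class M f"
    using u by (auto simp: L0_ball_def)
  obtain g where g: "g \<in> borel_measurable M" "v = ae_class M g" using L0_carrierE[OF v] .
  have "AE x in M. \<bar>g x\<bar> \<le> \<bar>f x\<bar>" using le f g by (simp add: vabs_le_iff)
  then have "trunc_integral M S g \<le> trunc_integral M S f"
    by (intro trunc_integral_mono S f g) (auto elim: AE_mp)
  then show "v \<in> L0_ball M (\<lambda>x. 0) S e" using f g S by (simp add: ae_class_mem_L0_ball)
qed

lemma locally_solid_measure_topology: "locally_solid_topology (L0 M) (measure_topology M)"
  unfolding locally_solid_topology_def
proof (intro conjI allI impI linear_measure_topology)
  fix U assume "nbhd_of (measure_topology M) (vzero (L0 M)) U"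
  then obtain W where W: "openin (measure_topology M) W" "ae_class M (\<lambda>x. 0) \<in> W" "W \<subseteq> U"
    by (auto simp: nbhd_of_def L0_vzero)
  have z: "(\<lambda>x. 0) \<in> borel_measurable M" by simp
  obtain S e where S: "S \<in> finite_measure_sets M" "0 < e" "L0_ball M (\<lambda>x. 0) S e \<subseteq> W"
    using W(1)[unfolded openin_measure_topology, THEN conjunct2, rule_format, OF z W(2)] by auto
  show "\<exists>V. nbhd_of (measure_topology M) (vzero (L0 M)) V \<and> solid (L0 M) V \<and> V \<subseteq> U"
  proof (rule exI[of _ "L0_ball M (\<lambda>x. 0) S e"], intro conjI)
    show "solid (L0 M) (L0_ball M (\<lambda>x. 0) S e)" by (rule solid_L0_ball[OF S(1)])
    show "L0_ball M (\<lambda>x. 0) S e \<subseteq> U" using S(3) W(3) by (rule order_trans)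
    show "nbhd_of (measure_topology M) (vzero (L0 M)) (L0_ball M (\<lambda>x. 0) S e)"
      unfolding nbhd_of_def topspace_measure_topology L0_vzero
      by (intro conjI exI[of _ "L0_ball M (\<lambda>x. 0) S e"] L0_ball_subset_carrier subset_refl
          openin_L0_ball[OF S(1) z] centre_mem_L0_ball[OF z S(2)])
  qed
qed

lemma semi_finite_AE_eqI:
  assumes "semi_finite M" "f \<in> borel_measurable M" "g \<in> borel_measurable M"
    and "\<And>S. S \<in> finite_measure_sets M \<Longrightarrow> AE x in M. x \<in> S \<longrightarrow> f x = (g x :: real)"
  shows "AE x in M. f x = g x"
proof -
  have "AE x in M. f x \<le> g x"
  proof (rule semi_finite_AE_leI[OF assms(1-3)])
    fix S assume "S \<in> finite_measure_sets M"
    from assms(4)[OF this] show "AE x in M. x \<in> S \<longrightarrow> f x \<le> g x" by eventually_elim simp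
  qed
  moreover have "AE x in M. g x \<le> f x"
  proof (rule semi_finite_AE_leI[OF assms(1,3,2)])
    fix S assume "S \<in> finite_measure_sets M"
    from assms(4)[OF this] show "AE x in M. x \<in> S \<longrightarrow> g x \<le> f x" by eventually_elim simp
  qed
  ultimately show ?thesis by eventually_elim simp
qed

lemma Hausdorff_measure_topology:
  assumes M: "semi_finite M"
  shows "Hausdorff_space (measure_topology M)"
  unfolding Hausdorff_space_def topspace_measure_topology
proof (intro allI impI; elim conjE)
  fix u v assume "u \<in> carrier (L0 M)" "v \<in> carrier (L0 M)" "u \<noteq> v"
  then obtain f g where fg: "f \<in> borel_measurable M" "u = ae_class M f"
    "g \<in> borel_measurable M" "v = ae_class M g" by (auto elim!: L0_carrierE)
  with \<open>u \<noteq> v\<close> have "\<not> (AE x in M. f x = g x)" by (simp add: L0_class_eq_iff)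
  then obtain S where S: "S \<in> finite_measure_sets M" "\<not> (AE x in M. x \<in> S \<longrightarrow> f x = g x)"
    using semi_finite_AE_eqI[OF M fg(1,3)] by blast
  define d where "d = trunc_integral M S (\<lambda>x. f x - g x)"
  have "d \<noteq> 0" unfolding d_def using S fg by (simp add: trunc_integral_eq_0_iff)
  moreover have "0 \<le> d" unfolding d_def by (rule trunc_integral_nonneg)
  ultimately have d: "0 < d" by simp
  have "disjnt (L0_ball M f S (d/2)) (L0_ball M g S (d/2))"
    unfolding disjnt_iff
  proof (intro allI notI; elim conjE)
    fix w assume w: "w \<in> L0_ball M f S (d/2)" "w \<in> L0_ball M g S (d/2)"
    obtain h where h: "h \<in> borel_measurable M" "w = ae_class M h"
      using w(1) by (auto simp: L0_ball_def)
    have hf: "trunc_integral M S (\<lambda>x. h x - f x) < d/2" and hg: "trunc_integral M S (\<lambda>x. h x - g x) < d/2"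
      using w h fg S by (simp_all add: ae_class_mem_L0_ball)
    have "trunc_integral M S (\<lambda>x. - (h x - f x) + (h x - g x))
        \<le> trunc_integral M S (\<lambda>x. - (h x - f x)) + trunc_integral M S (\<lambda>x. h x - g x)"
      by (intro trunc_integral_triangle S) (use fg h in auto)
    with hf hg show False
      by (simp only: trunc_integral_minus) (simp add: d_def)
  qed
  moreover have "u \<in> L0_ball M f S (d/2)" "v \<in> L0_ball M g S (d/2)"
    using fg d by (auto intro: centre_mem_L0_ball)
  ultimately show "\<exists>U V. openin (measure_topology M) U \<and> openin (measure_topology M) V \<and>
      u \<in> U \<and> v \<in> V \<and> disjnt U V"
    by (intro exI[of _ "L0_ball M f S (d/2)", OF exI[of _ "L0_ball M g S (d/2)"]] conjI
        openin_L0_ball S(1) fg(1,3))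
qed

text \<open>Strict monotonicity of the functional: the difference of the integrands is nonnegative
  with integral at most 0. Only the truncations can be compared, since values above 1 are invisible
  to it. Both extremal arguments, for decreasing nets and for neighbourhoods, end in this
  lemma.\<close>

lemma AE_eq_of_trunc_integral_le:
  assumes S: "S \<in> finite_measure_sets M" and [measurable]: "f \<in> borel_measurable M" "g \<in> borel_measurable M"
    and le: "AE x in M. x \<in> S \<longrightarrow> \<bar>f x\<bar> \<le> \<bar>g x\<bar>" and ge: "trunc_integral M S g \<le> trunc_integral M S f"
  shows "AE x in M. x \<in> S \<longrightarrow> min \<bar>f x\<bar> 1 = min \<bar>g x\<bar> 1"
proof -
  let ?d = "\<lambda>x. min \<bar>g x\<bar> 1 * indicat_real S x - min \<bar>f x\<bar> 1 * indicat_real S x"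
  have int: "integrable M (\<lambda>x. min \<bar>f x\<bar> 1 * indicat_real S x)"
    "integrable M (\<lambda>x. min \<bar>g x\<bar> 1 * indicat_real S x)"
    by (intro integrable_trunc S; measurable)+
  have nn: "AE x in M. 0 \<le> ?d x"
    using le by eventually_elim (auto simp: indicator_def)
  have "integral\<^sup>L M ?d = trunc_integral M S g - trunc_integral M S f"
    using int by (simp add: trunc_integral_def)
  then have "integral\<^sup>L M ?d = 0"
    using ge integral_nonneg_AE[OF nn] by linarith
  then have "AE x in M. ?d x = 0"
    using int nn by (subst (asm) integral_nonneg_eq_0_iff_AE) auto
  then show ?thesis by eventually_elim (auto simp: indicator_def)
qed

section \<open>Order and uo-convergence in terms of representatives\<close>

lemma L0_vdiff_class:
  assumes "f \<in> borel_measurable M" "g \<in> borel_measurable M"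
  shows "vdiff (L0 M) (ae_class M f) (ae_class M g) = ae_class M (\<lambda>x. f x - g x)"
  using assms by (simp add: vdiff_def L0_vscale_class L0_vadd_class)

lemma decreases_to_zero_L0_iff:
  assumes "\<And>b. b \<in> B \<Longrightarrow> Y b \<in> borel_measurable M" "\<And>b. b \<in> B \<Longrightarrow> y b = ae_class M (Y b)"
  shows "decreases_to_zero (L0 M) B s y \<longleftrightarrow>
    (\<forall>b\<in>B. \<forall>c\<in>B. (b, c) \<in> s \<longrightarrow> (AE x in M. Y c x \<le> Y b x)) \<and>
    (\<forall>b\<in>B. AE x in M. 0 \<le> Y b x) \<and>
    (\<forall>w\<in>borel_measurable M. (\<forall>b\<in>B. AE x in M. w x \<le> Y b x) \<longrightarrow> (AE x in M. w x \<le> 0))"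
proof -
  have car: "y ` B \<subseteq> carrier (L0 M)" using assms by (auto intro: L0_class_closed)
  have low: "ae_class M w \<in> Lower (L0 M) (y ` B) \<longleftrightarrow> (\<forall>b\<in>B. AE x in M. w x \<le> Y b x)"
    if "w \<in> borel_measurable M" for w
  proof -
    have "ae_class M w \<in> Lower (L0 M) (y ` B) \<longleftrightarrow> (\<forall>b\<in>B. ae_class M w \<sqsubseteq>\<^bsub>L0 M\<^esub> y b)"
      using car L0_class_closed[OF that] unfolding Lower_def by blast
    also have "\<dots> \<longleftrightarrow> (\<forall>b\<in>B. AE x in M. w x \<le> Y b x)"
      using that assms by (simp add: L0_le_iff)
    finally show ?thesis .
  qed
  have le: "y c \<sqsubseteq>\<^bsub>L0 M\<^esub> y b \<longleftrightarrow> (AE x in M. Y c x \<le> Y b x)" if "b \<in> B" "c \<in> B" for b c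
    using that assms by (simp add: L0_le_iff)
  have "greatest (L0 M) (vzero (L0 M)) (Lower (L0 M) (y ` B)) \<longleftrightarrow>
    (\<forall>b\<in>B. AE x in M. 0 \<le> Y b x) \<and>
    (\<forall>w\<in>borel_measurable M. (\<forall>b\<in>B. AE x in M. w x \<le> Y b x) \<longrightarrow> (AE x in M. w x \<le> 0))"
    (is "_ = (?P \<and> ?Q)")
  proof -
    have "Lower (L0 M) (y ` B) = ae_class M ` {w \<in> borel_measurable M. \<forall>b\<in>B. AE x in M. w x \<le> Y b x}"
    proof (intro equalityI subsetI)
      fix u assume u: "u \<in> Lower (L0 M) (y ` B)"
      then have "u \<in> carrier (L0 M)" by (simp add: Lower_def)
      then obtain w where w: "w \<in> borel_measurable M" "u = ae_class M w" by (rule L0_carrierE)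
      then show "u \<in> ae_class M ` {w \<in> borel_measurable M. \<forall>b\<in>B. AE x in M. w x \<le> Y b x}"
        using low[OF w(1)] u by simp
    next
      fix u assume "u \<in> ae_class M ` {w \<in> borel_measurable M. \<forall>b\<in>B. AE x in M. w x \<le> Y b x}"
      then show "u \<in> Lower (L0 M) (y ` B)" using low by auto
    qed
    moreover have "vzero (L0 M) \<in> Lower (L0 M) (y ` B) \<longleftrightarrow> ?P"
      unfolding L0_vzero by (rule low) simp
    moreover have "ae_class M w \<sqsubseteq>\<^bsub>L0 M\<^esub> vzero (L0 M) \<longleftrightarrow> (AE x in M. w x \<le> 0)" if "w \<in> borel_measurable M" for w
      using that unfolding L0_vzero by (simp add: L0_le_iff)
    moreover have "Lower (L0 M) (y ` B) \<subseteq> carrier (L0 M)" by (auto simp: Lower_def)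
    ultimately show ?thesis unfolding greatest_def by auto
  qed
  moreover have "(\<forall>b\<in>B. \<forall>c\<in>B. (b, c) \<in> s \<longrightarrow> y c \<sqsubseteq>\<^bsub>L0 M\<^esub> y b) \<longleftrightarrow>
      (\<forall>b\<in>B. \<forall>c\<in>B. (b, c) \<in> s \<longrightarrow> (AE x in M. Y c x \<le> Y b x))" using le by blast
  ultimately show ?thesis by (simp add: decreases_to_zero_def)
qed

lemma AE_class_representatives:
  assumes "x \<in> A \<rightarrow> carrier (L0 M)"
  obtains X where "\<And>a. a \<in> A \<Longrightarrow> X a \<in> borel_measurable M" "\<And>a. a \<in> A \<Longrightarrow> x a = ae_class M (X a)"
proof -
  have "\<forall>a\<in>A. \<exists>f. f \<in> borel_measurable M \<and> x a = ae_class M f"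
  proof
    fix a assume "a \<in> A"
    then have "x a \<in> carrier (L0 M)" using assms by blast
    then show "\<exists>f. f \<in> borel_measurable M \<and> x a = ae_class M f" by (rule L0_carrierE) blast
  qed
  then obtain X where "\<forall>a\<in>A. X a \<in> borel_measurable M \<and> x a = ae_class M (X a)" by (rule bchoice[THEN exE])
  then show ?thesis using that by blast
qed

text \<open>Let \<open>h\<close> be the infimum of a minimising sequence
  \<open>Y (\<beta> n)\<close>. For every index \<open>b\<close> the function
  \<open>min h (Y b)\<close> still has truncated integral at least \<open>I\<close>: by directedness
  some \<open>Y d\<close> lies below both \<open>Y (\<beta> n)\<close> and \<open>Y b\<close>. Since
  \<open>h\<close> itself has at most \<open>I\<close>, it cannot exceed \<open>Y b\<close> on
  \<open>S\<close>, up to truncation. So the truncation of \<open>h\<close> on \<open>S\<close> is a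
  lower bound of the entire net and vanishes.\<close>

lemma trunc_integral_decreasing_net:
  assumes B: "directed_preorder B s" and y: "y \<in> B \<rightarrow> carrier (L0 M)"
    and dec: "decreases_to_zero (L0 M) B s y" and S: "S \<in> finite_measure_sets M" and e: "0 < e"
  shows "\<exists>b\<in>B. y b \<in> L0_ball M (\<lambda>x. 0) S e"
proof -
  obtain Y where Y: "\<And>b. b \<in> B \<Longrightarrow> Y b \<in> borel_measurable M" "\<And>b. b \<in> B \<Longrightarrow> y b = ae_class M (Y b)"
    using AE_class_representatives[OF y] by blast
  note [measurable] = Y(1)
  have mono: "AE x in M. Y c x \<le> Y b x" if "b \<in> B" "c \<in> B" "(b, c) \<in> s" for b c
    using dec that by (simp add: decreases_to_zero_L0_iff[OF Y])
  have nn: "AE x in M. 0 \<le> Y b x" if "b \<in> B" for b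
    using dec that by (simp add: decreases_to_zero_L0_iff[OF Y])
  have glb: "AE x in M. w x \<le> 0" if "w \<in> borel_measurable M" "\<And>b. b \<in> B \<Longrightarrow> AE x in M. w x \<le> Y b x" for w
    using dec that by (simp add: decreases_to_zero_L0_iff[OF Y])
  have dir: "\<exists>c\<in>B. (a, c) \<in> s \<and> (b, c) \<in> s" if "a \<in> B" "b \<in> B" for a b
    using B that by (auto simp: directed_preorder_def)
  have ne: "B \<noteq> {}" using B by (simp add: directed_preorder_def)
  let ?\<rho> = "trunc_integral M S"
  have \<rho>mono: "?\<rho> (Y c) \<le> ?\<rho> (Y b)" if "b \<in> B" "c \<in> B" "(b, c) \<in> s" for b c
  proof (intro trunc_integral_mono S Y that)
    show "AE x in M. x \<in> S \<longrightarrow> \<bar>Y c x\<bar> \<le> \<bar>Y b x\<bar>"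
      using mono[OF that] nn[OF that(2)] by eventually_elim simp
  qed
  define I where "I = (INF b\<in>B. ?\<rho> (Y b))"
  have bdd: "bdd_below ((\<lambda>b. ?\<rho> (Y b)) ` B)"
    by (intro bdd_belowI2[of _ 0] trunc_integral_nonneg)
  have I_le: "I \<le> ?\<rho> (Y b)" if "b \<in> B" for b
    unfolding I_def using bdd that by (rule cINF_lower)
  have ex: "\<exists>b\<in>B. ?\<rho> (Y b) < I + d" if "0 < d" for d
    using cINF_less_iff[OF ne bdd, of "I + d"] that unfolding I_def by simp
  have "\<exists>\<beta>. \<forall>n. (\<beta> n \<in> B \<and> ?\<rho> (Y (\<beta> n)) < I + 1 / real (Suc n)) \<and> (\<beta> n, \<beta> (Suc n)) \<in> s"
  proof (rule dependent_nat_choice)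
    show "\<exists>b. b \<in> B \<and> ?\<rho> (Y b) < I + 1 / real (Suc 0)" using ex[of 1] by auto
    fix b n assume "b \<in> B \<and> ?\<rho> (Y b) < I + 1 / real (Suc n)"
    then have b: "b \<in> B" by simp
    obtain c where c: "c \<in> B" "?\<rho> (Y c) < I + 1 / real (Suc (Suc n))"
      using ex[of "1 / real (Suc (Suc n))"] by auto
    \<comment> \<open>Here \<open>c\<close> is nearly minimal, and \<open>d\<close> lies beyond
      \<open>b\<close> and \<open>c\<close>: monotonicity passes near-minimality on to
      \<open>d\<close>, and the chosen sequence decreases.\<close>
    obtain d where d: "d \<in> B" "(b, d) \<in> s" "(c, d) \<in> s" using dir[OF b c(1)] by blast
    then show "\<exists>d. (d \<in> B \<and> ?\<rho> (Y d) < I + 1 / real (Suc (Suc n))) \<and> (b, d) \<in> s"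
      using \<rho>mono[OF c(1) d(1,3)] c(2) by (intro exI[of _ d]) auto
  qed
  then obtain \<beta> where \<beta>: "\<And>n. \<beta> n \<in> B" "\<And>n. ?\<rho> (Y (\<beta> n)) < I + 1 / real (Suc n)"
    "\<And>n. (\<beta> n, \<beta> (Suc n)) \<in> s" by blast
  define h where "h x = (INF n. Y (\<beta> n) x)" for x
  have hm [measurable]: "h \<in> borel_measurable M"
    unfolding h_def by (rule borel_measurable_cINF_real) (auto intro: Y \<beta>)
  have ae: "AE x in M. \<forall>n. 0 \<le> Y (\<beta> n) x \<and> Y (\<beta> (Suc n)) x \<le> Y (\<beta> n) x"
    unfolding AE_all_countable
  proof
    fix n
    show "AE x in M. 0 \<le> Y (\<beta> n) x \<and> Y (\<beta> (Suc n)) x \<le> Y (\<beta> n) x"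
      using nn[OF \<beta>(1)[of n]] mono[OF \<beta>(1) \<beta>(1) \<beta>(3)[of n]] by eventually_elim simp
  qed
  then have h: "AE x in M. 0 \<le> h x \<and> (\<forall>n. h x \<le> Y (\<beta> n) x) \<and> (\<lambda>n. Y (\<beta> n) x) \<longlonglongrightarrow> h x"
  proof eventually_elim
    case (elim x)
    have bd: "bdd_below (range (\<lambda>n. Y (\<beta> n) x))" using elim by (intro bdd_belowI2[of _ 0]) auto
    have "decseq (\<lambda>n. Y (\<beta> n) x)" using elim by (simp add: decseq_Suc_iff)
    with bd elim show ?case unfolding h_def
      by (auto intro!: cINF_greatest LIMSEQ_decseq_INF cINF_lower)
  qed
  have \<rho>h: "?\<rho> h \<le> I"
  proof (rule field_le_epsilon)
    fix d :: real assume "0 < d"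
    then obtain n where n: "1 / real (Suc n) < d"
      using nat_approx_posE by metis
    have "?\<rho> h \<le> ?\<rho> (Y (\<beta> n))"
    proof (intro trunc_integral_mono S hm Y \<beta>)
      show "AE x in M. x \<in> S \<longrightarrow> \<bar>h x\<bar> \<le> \<bar>Y (\<beta> n) x\<bar>"
        using h by eventually_elim (auto intro: order_trans[OF _ abs_ge_self])
    qed
    with \<beta>(2)[of n] n show "?\<rho> h \<le> I + d" by linarith
  qed
  have I_min: "I \<le> ?\<rho> (\<lambda>x. min (h x) (Y b x))" if b: "b \<in> B" for b
  proof (rule LIMSEQ_le_const)
    note [measurable] = Y(1)[OF b] Y(1)[OF \<beta>(1)]
    show "(\<lambda>n. ?\<rho> (\<lambda>x. min (Y (\<beta> n) x) (Y b x))) \<longlonglongrightarrow> ?\<rho> (\<lambda>x. min (h x) (Y b x))"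
    proof (rule trunc_integral_tendsto[OF S])
      show "AE x in M. x \<in> S \<longrightarrow> (\<lambda>n. min (Y (\<beta> n) x) (Y b x)) \<longlonglongrightarrow> min (h x) (Y b x)"
        using h by eventually_elim (auto intro: tendsto_min)
    qed measurable
    have "I \<le> ?\<rho> (\<lambda>x. min (Y (\<beta> n) x) (Y b x))" for n
    proof -
      obtain d where d: "d \<in> B" "(\<beta> n, d) \<in> s" "(b, d) \<in> s" using dir[OF \<beta>(1) b] by blast
      have "?\<rho> (Y d) \<le> ?\<rho> (\<lambda>x. min (Y (\<beta> n) x) (Y b x))"
      proof (rule trunc_integral_mono[OF S Y(1)[OF d(1)]])
        show "AE x in M. x \<in> S \<longrightarrow> \<bar>Y d x\<bar> \<le> \<bar>min (Y (\<beta> n) x) (Y b x)\<bar>"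
          using mono[OF \<beta>(1) d(1,2)] mono[OF b d(1,3)] nn[OF d(1)] by eventually_elim auto
      qed measurable
      with I_le[OF d(1)] show ?thesis by linarith
    qed
    then show "\<exists>N. \<forall>n\<ge>N. I \<le> ?\<rho> (\<lambda>x. min (Y (\<beta> n) x) (Y b x))" by blast
  qed
  note [measurable] = finite_measure_sets_measurable[OF S]
  \<comment> \<open>The comparison of \<open>h\<close> with \<open>Y b\<close> is available only on
    \<open>S\<close> and only after truncation at 1; off \<open>S\<close> the function
    \<open>?z\<close> is 0 and \<open>Y b\<close> is nonnegative.\<close>
  let ?z = "\<lambda>x. min (h x) 1 * indicat_real S x"
  have "AE x in M. ?z x \<le> 0"
  proof (rule glb)
    fix b assume b: "b \<in> B"
    note [measurable] = Y(1)[OF b]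
    have "AE x in M. x \<in> S \<longrightarrow> min \<bar>min (h x) (Y b x)\<bar> 1 = min \<bar>h x\<bar> 1"
    proof (rule AE_eq_of_trunc_integral_le[OF S])
      show "AE x in M. x \<in> S \<longrightarrow> \<bar>min (h x) (Y b x)\<bar> \<le> \<bar>h x\<bar>"
        using h nn[OF b] by eventually_elim auto
      show "?\<rho> h \<le> ?\<rho> (\<lambda>x. min (h x) (Y b x))" using \<rho>h I_min[OF b] by linarith
    qed measurable
    then show "AE x in M. ?z x \<le> Y b x"
      using h nn[OF b] by eventually_elim (auto simp: indicator_def min_def split: if_splits)
  qed measurable
  then have "AE x in M. x \<in> S \<longrightarrow> h x = 0"
    using h by eventually_elim (auto simp: indicator_def min_def split: if_splits)
  then have \<rho>0: "?\<rho> h = 0" by (simp add: trunc_integral_eq_0_iff S)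
  \<comment> \<open>An arbitrary index suffices to conclude \<open>I \<le> 0\<close> from
    \<open>I_min\<close>, because \<open>min (h x) (Y b0 x)\<close> lies between 0 and
    \<open>h x\<close>.\<close>
  obtain b0 where b0: "b0 \<in> B" using ne by blast
  note [measurable] = Y(1)[OF b0]
  have "?\<rho> (\<lambda>x. min (h x) (Y b0 x)) \<le> ?\<rho> h"
  proof (rule trunc_integral_mono[OF S])
    show "AE x in M. x \<in> S \<longrightarrow> \<bar>min (h x) (Y b0 x)\<bar> \<le> \<bar>h x\<bar>"
      using h nn[OF b0] by eventually_elim auto
  qed measurable
  with I_min[OF b0] \<rho>0 have "I \<le> 0" by simp
  then obtain b where "b \<in> B" "?\<rho> (Y b) < e" using ex[OF e] by auto
  then show ?thesis using Y S by (intro bexI[of _ b]) (simp_all add: ae_class_mem_L0_ball)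
qed

text \<open>For each \<open>S\<close>, uo-convergence is tested against the indicator of
  \<open>S\<close> alone: the meet of \<open>\<bar>X a - g\<bar>\<close> with it is, on
  \<open>S\<close>, the integrand of \<open>trunc_integral M S\<close>. The dominating net enters
  every ball around zero by \<open>trunc_integral_decreasing_net\<close>.\<close>

lemma uo_Lebesgue_measure_topology: "uo_Lebesgue_topology (L0 M) (measure_topology M)"
  unfolding uo_Lebesgue_topology_def
proof (intro conjI allI impI locally_solid_measure_topology; elim conjE)
  fix A :: "(('a \<Rightarrow> real) set set \<times> ('a \<Rightarrow> real) set) set" and r x l
  assume A: "directed_preorder A r" and x: "x \<in> A \<rightarrow> carrier (L0 M)" and l: "l \<in> carrier (L0 M)"
    and uo: "uo_converges (L0 M) A r x l"
  obtain X where X: "\<And>a. a \<in> A \<Longrightarrow> X a \<in> borel_measurable M" "\<And>a. a \<in> A \<Longrightarrow> x a = ae_class M (X a)"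
    using AE_class_representatives[OF x] by blast
  obtain g where g: "g \<in> borel_measurable M" "l = ae_class M g" using L0_carrierE[OF l] .
  have tl: "\<forall>\<^sub>F a in tail_filter A r. X a \<in> borel_measurable M \<and> x a = ae_class M (X a)"
    using A X unfolding eventually_tail_filter[OF A] directed_preorder_def by blast
  have "((\<lambda>a. trunc_integral M S (\<lambda>t. X a t - g t)) \<longlongrightarrow> 0) (tail_filter A r)"
    if S: "S \<in> finite_measure_sets M" for S
  proof (rule order_tendstoI)
    fix e :: real assume e: "0 < e"
    note [measurable] = finite_measure_sets_measurable[OF S]
    have "ae_class M (indicat_real S) \<in> vpos (L0 M)"
      by (simp add: vpos_def L0_class_closed L0_vzero L0_le_iff)
    then obtain B :: "('a \<Rightarrow> real) set set" and s z where B: "directed_preorder B s" "z \<in> B \<rightarrow> carrier (L0 M)"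
      "decreases_to_zero (L0 M) B s z"
      and dom: "\<forall>b\<in>B. \<exists>a0\<in>A. \<forall>a\<in>A. (a0, a) \<in> r \<longrightarrow> vabs (L0 M) (vdiff (L0 M) (vzero (L0 M))
        (vabs (L0 M) (vdiff (L0 M) (x a) l) \<sqinter>\<^bsub>L0 M\<^esub> ae_class M (indicat_real S))) \<sqsubseteq>\<^bsub>L0 M\<^esub> z b"
      using uo unfolding uo_converges_def order_converges_def by blast
    obtain b where b: "b \<in> B" "z b \<in> L0_ball M (\<lambda>x. 0) S e"
      using trunc_integral_decreasing_net[OF B S e] by blast
    then obtain Z where Z: "Z \<in> borel_measurable M" "trunc_integral M S Z < e" "z b = ae_class M Z"
      by (auto simp: L0_ball_def)
    obtain a0 where a0: "a0 \<in> A" "\<And>a. a \<in> A \<Longrightarrow> (a0, a) \<in> r \<Longrightarrow> vabs (L0 M) (vdiff (L0 M) (vzero (L0 M))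
        (vabs (L0 M) (vdiff (L0 M) (x a) l) \<sqinter>\<^bsub>L0 M\<^esub> ae_class M (indicat_real S))) \<sqsubseteq>\<^bsub>L0 M\<^esub> z b"
      using dom b(1) by blast
    have "trunc_integral M S (\<lambda>t. X a t - g t) < e" if a: "a \<in> A" "(a0, a) \<in> r" for a
    proof -
      note [measurable] = X(1)[OF a(1)] g(1) Z(1)
      have "AE t in M. \<bar>0 - min \<bar>X a t - g t\<bar> (indicat_real S t)\<bar> \<le> Z t"
        using a0(2)[OF a] by (simp add: L0_vzero L0_vdiff_class L0_vabs_class L0_meet_class L0_le_iff X(2)[OF a(1)] g(2) Z(3))
      then have "AE t in M. min \<bar>X a t - g t\<bar> (indicat_real S t) \<le> Z t"
        by eventually_elim auto
      then have "AE t in M. min \<bar>X a t - g t\<bar> 1 * indicat_real S t \<le> min \<bar>Z t\<bar> 1 * indicat_real S t"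
        by eventually_elim (auto simp: indicator_def min_def split: if_splits)
      then have "trunc_integral M S (\<lambda>t. X a t - g t) \<le> trunc_integral M S Z"
        unfolding trunc_integral_def by (intro integral_mono_AE integrable_trunc S) auto
      then show ?thesis using Z(2) by linarith
    qed
    then show "\<forall>\<^sub>F a in tail_filter A r. trunc_integral M S (\<lambda>t. X a t - g t) < e"
      using a0(1) unfolding eventually_tail_filter[OF A] by blast
  qed (simp add: order.strict_trans2[OF _ trunc_integral_nonneg])
  then show "limitin (measure_topology M) x l (tail_filter A r)"
    unfolding g(2) by (simp add: limitin_measure_topology[OF g(1) tl])
qed

text \<open>Brings uo-nullness down to real functions and inequalities almost everywhere. The index
  type \<open>'j\<close> of the dominating net is free; it is used with natural numbers and with
  sets of finite measure.\<close>

lemma uo_converges_L0I: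
  fixes X :: "'i \<Rightarrow> 'a \<Rightarrow> real"
  assumes X: "\<And>a. a \<in> A \<Longrightarrow> X a \<in> borel_measurable M"
    and dom: "\<And>u. u \<in> borel_measurable M \<Longrightarrow> (\<And>x. 0 \<le> u x) \<Longrightarrow>
      \<exists>(B :: 'j set) s Z. directed_preorder B s \<and> (\<forall>b\<in>B. Z b \<in> borel_measurable M) \<and>
        (\<forall>b\<in>B. \<forall>c\<in>B. (b, c) \<in> s \<longrightarrow> (AE x in M. Z c x \<le> Z b x)) \<and>
        (\<forall>w\<in>borel_measurable M. (\<forall>b\<in>B. AE x in M. w x \<le> Z b x) \<longrightarrow> (AE x in M. w x \<le> 0)) \<and>
        (\<forall>b\<in>B. \<exists>a0\<in>A. \<forall>a\<in>A. (a0, a) \<in> r \<longrightarrow> (AE x in M. min \<bar>X a x\<bar> (u x) \<le> Z b x))"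
    and A: "directed_preorder A r"
  shows "uo_converges (L0 M) A r (\<lambda>a. ae_class M (X a)) (vzero (L0 M))"
  unfolding uo_converges_def
proof
  fix y assume "y \<in> vpos (L0 M)"
  then obtain v where v: "v \<in> borel_measurable M" "y = ae_class M v" "AE x in M. 0 \<le> v x"
    by (auto simp: vpos_def L0_vzero L0_le_iff elim!: L0_carrierE)
  \<comment> \<open>A representative of a positive class is nonnegative only almost everywhere; its
    absolute value represents the same class and is nonnegative everywhere.\<close>
  define u where "u x = \<bar>v x\<bar>" for x
  have u: "u \<in> borel_measurable M" "\<And>x. 0 \<le> u x" using v(1) by (simp_all add: u_def[abs_def])
  have "AE x in M. v x = u x" using v(3) by eventually_elim (simp add: u_def)
  then have y: "y = ae_class M u" using v(1,2) u(1) by (simp add: L0_class_eq_iff)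
  from dom[OF u] obtain B :: "'j set" and s Z where B: "directed_preorder B s"
    and Z0: "\<forall>b\<in>B. Z b \<in> borel_measurable M"
    and mono: "\<forall>b\<in>B. \<forall>c\<in>B. (b, c) \<in> s \<longrightarrow> (AE x in M. Z c x \<le> Z b x)"
    and glb: "\<forall>w\<in>borel_measurable M. (\<forall>b\<in>B. AE x in M. w x \<le> Z b x) \<longrightarrow> (AE x in M. w x \<le> 0)"
    and le: "\<forall>b\<in>B. \<exists>a0\<in>A. \<forall>a\<in>A. (a0, a) \<in> r \<longrightarrow> (AE x in M. min \<bar>X a x\<bar> (u x) \<le> Z b x)"
    by (elim exE conjE) (rule that)
  note Z = bspec[OF Z0]
  have nn: "AE x in M. 0 \<le> Z b x" if b: "b \<in> B" for b
  proof -
    obtain a0 where a0: "a0 \<in> A" "\<forall>a\<in>A. (a0, a) \<in> r \<longrightarrow> (AE x in M. min \<bar>X a x\<bar> (u x) \<le> Z b x)"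
      using bspec[OF le b] by blast
    \<comment> \<open>Reflexivity puts \<open>a0\<close> into its own tail, so \<open>Z b\<close>
      dominates at least one minimum of nonnegative functions.\<close>
    have "(a0, a0) \<in> r" using A a0(1) by (auto simp: directed_preorder_def preorder_on_def refl_on_def)
    with a0 have "AE x in M. min \<bar>X a0 x\<bar> (u x) \<le> Z b x" by blast
    then show ?thesis
    proof eventually_elim
      case (elim x)
      have "0 \<le> min \<bar>X a0 x\<bar> (u x)" using u(2)[of x] by simp
      with elim show ?case by (rule order_trans[rotated])
    qed
  qed
  show "order_converges (L0 M) A r
      (\<lambda>a. vabs (L0 M) (vdiff (L0 M) (ae_class M (X a)) (vzero (L0 M))) \<sqinter>\<^bsub>L0 M\<^esub> y) (vzero (L0 M))"
  proof (rule order_convergesI[OF B, where y = "\<lambda>b. ae_class M (Z b)"])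
    show "(\<lambda>b. ae_class M (Z b)) \<in> B \<rightarrow> carrier (L0 M)" using Z by (auto intro: L0_class_closed)
    show "decreases_to_zero (L0 M) B s (\<lambda>b. ae_class M (Z b))"
      using mono nn glb by (simp add: decreases_to_zero_L0_iff[OF Z])
    show "\<forall>b\<in>B. \<exists>a0\<in>A. \<forall>a\<in>A. (a0, a) \<in> r \<longrightarrow>
        vabs (L0 M) (vdiff (L0 M) (vzero (L0 M))
          (vabs (L0 M) (vdiff (L0 M) (ae_class M (X a)) (vzero (L0 M))) \<sqinter>\<^bsub>L0 M\<^esub> y)) \<sqsubseteq>\<^bsub>L0 M\<^esub> ae_class M (Z b)"
    proof
      fix b assume b: "b \<in> B"
      have "vabs (L0 M) (vdiff (L0 M) (vzero (L0 M))
          (vabs (L0 M) (vdiff (L0 M) (ae_class M (X a)) (vzero (L0 M))) \<sqinter>\<^bsub>L0 M\<^esub> y)) \<sqsubseteq>\<^bsub>L0 M\<^esub> ae_class M (Z b)"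
        if a: "a \<in> A" and "AE x in M. min \<bar>X a x\<bar> (u x) \<le> Z b x" for a
      proof -
        note [measurable] = X[OF a] u(1) Z[OF b]
        have "\<bar>min \<bar>X a x\<bar> (u x)\<bar> = min \<bar>X a x\<bar> (u x)" for x using u(2)[of x] by simp
        then show ?thesis using that(2)
          by (simp add: L0_vzero L0_vdiff_class L0_vabs_class L0_meet_class L0_le_iff y)
      qed
      then show "\<exists>a0\<in>A. \<forall>a\<in>A. (a0, a) \<in> r \<longrightarrow> vabs (L0 M) (vdiff (L0 M) (vzero (L0 M))
          (vabs (L0 M) (vdiff (L0 M) (ae_class M (X a)) (vzero (L0 M))) \<sqinter>\<^bsub>L0 M\<^esub> y)) \<sqsubseteq>\<^bsub>L0 M\<^esub> ae_class M (Z b)"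
        using bspec[OF le b] by meson
    qed
  qed (rule partial_order_L0)
qed

section \<open>Uniqueness\<close>

lemma directed_preorder_nat: "directed_preorder (UNIV :: nat set) {(m, n). m \<le> n}"
proof -
  have "\<exists>c\<ge>a. b \<le> c" for a b :: nat by (rule exI[of _ "max a b"]) simp
  then show ?thesis by (auto simp: directed_preorder_def preorder_on_def refl_on_def trans_def)
qed

text \<open>The dominating sequence consists of the suprema of \<open>min \<bar>f m\<bar> u\<close>
  over the tails \<open>m \<ge> n\<close>. The cap \<open>u\<close> keeps these suprema finite
  whatever the size of the \<open>f m\<close>.\<close>

lemma uo_converges_L0_sequence:
  assumes f: "\<And>n. f n \<in> borel_measurable M" and lim: "AE x in M. (\<lambda>n. f n x) \<longlonglongrightarrow> 0"
  shows "uo_converges (L0 M) UNIV {(m, n). m \<le> n} (\<lambda>n. ae_class M (f n)) (vzero (L0 M))"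
proof (rule uo_converges_L0I[OF f _ directed_preorder_nat])
  fix u :: "'a \<Rightarrow> real" assume [measurable]: "u \<in> borel_measurable M" and u: "\<And>x. 0 \<le> u x"
  note [measurable] = f
  define Z where "Z n x = (SUP k. min \<bar>f (n + k) x\<bar> (u x))" for n x
  have bdd: "bdd_above (range (\<lambda>k. min \<bar>f (n + k) x\<bar> (u x)))" for n x
    by (rule bdd_aboveI2[of _ _ "u x"]) simp
  have up: "min \<bar>f m x\<bar> (u x) \<le> Z n x" if "n \<le> m" for m n x
    using cSUP_upper[OF UNIV_I bdd, of n "m - n" x] that by (simp add: Z_def)
  have Zm: "Z n \<in> borel_measurable M" for n
    unfolding Z_def by (rule borel_measurable_cSUP) (use bdd in auto)
  have mono: "Z n x \<le> Z m x" if "m \<le> n" for m n x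
    unfolding Z_def[of n] by (rule cSUP_least) (use that in \<open>auto intro: up\<close>)
  have glb: "AE x in M. w x \<le> 0" if w: "\<And>n. AE x in M. w x \<le> Z n x" for w
  proof -
    have "AE x in M. \<forall>n. w x \<le> Z n x" using w by (simp add: AE_all_countable)
    then show ?thesis
      using lim
    proof eventually_elim
      case (elim x)
      show ?case
      proof (rule field_le_epsilon)
        fix e :: real assume "0 < e"
        then obtain N where N: "\<And>n. N \<le> n \<Longrightarrow> \<bar>f n x\<bar> < e"
          using LIMSEQ_D[OF elim(2), of e] by auto
        have "Z N x \<le> e"
          unfolding Z_def by (rule cSUP_least) (use N in \<open>auto intro!: min.coboundedI1 less_imp_le[OF N]\<close>)
        with elim(1) show "w x \<le> 0 + e" by (auto intro: order_trans)
      qed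
    qed
  qed
  show "\<exists>(B :: nat set) s Z. directed_preorder B s \<and> (\<forall>b\<in>B. Z b \<in> borel_measurable M) \<and>
        (\<forall>b\<in>B. \<forall>c\<in>B. (b, c) \<in> s \<longrightarrow> (AE x in M. Z c x \<le> Z b x)) \<and>
        (\<forall>w\<in>borel_measurable M. (\<forall>b\<in>B. AE x in M. w x \<le> Z b x) \<longrightarrow> (AE x in M. w x \<le> 0)) \<and>
        (\<forall>b\<in>B. \<exists>a0\<in>UNIV. \<forall>a\<in>UNIV. (a0, a) \<in> {(m, n). m \<le> n} \<longrightarrow> (AE x in M. min \<bar>f a x\<bar> (u x) \<le> Z b x))"
  proof (rule exI[of _ UNIV], rule exI[of _ "{(m, n). m \<le> n}"], rule exI[of _ Z],
      intro conjI directed_preorder_nat)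
    show "\<forall>b\<in>UNIV. \<exists>a0\<in>UNIV. \<forall>a\<in>UNIV. (a0, a) \<in> {(m, n). m \<le> n} \<longrightarrow>
        (AE x in M. min \<bar>f a x\<bar> (u x) \<le> Z b x)"
    proof
      fix b :: nat
      show "\<exists>a0\<in>UNIV. \<forall>a\<in>UNIV. (a0, a) \<in> {(m, n). m \<le> n} \<longrightarrow>
          (AE x in M. min \<bar>f a x\<bar> (u x) \<le> Z b x)"
        by (rule bexI[of _ b]) (simp_all add: up)
    qed
    show "\<forall>w\<in>borel_measurable M. (\<forall>b\<in>UNIV. AE x in M. w x \<le> Z b x) \<longrightarrow> (AE x in M. w x \<le> 0)"
      by (intro ballI impI glb) simp
  qed (simp_all add: Zm mono)
qed

text \<open>Nets of functions vanishing on ever larger sets of finite measure are uo-null; this reduces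
  neighbourhoods of zero to sets of finite measure without any countability assumption.\<close>

definition vanishing_index :: "'a measure \<Rightarrow> ('a set \<times> ('a \<Rightarrow> real)) set" where
  "vanishing_index M =
    {(S, h). S \<in> finite_measure_sets M \<and> h \<in> borel_measurable M \<and> (\<forall>x\<in>S. h x = 0)}"

text \<open>Only the sets are compared, so the tail after \<open>(S, h)\<close> contains every
  measurable function vanishing on \<open>S\<close>. Being eventually in a neighbourhood thus
  becomes a statement about all those functions at once, as \<open>solid_nbhd_vanishing\<close>
  exploits.\<close>

definition vanishing_order :: "'a measure \<Rightarrow> ('a set \<times> ('a \<Rightarrow> real)) rel" where
  "vanishing_order M =
    {(p, q). p \<in> vanishing_index M \<and> q \<in> vanishing_index M \<and> fst p \<subseteq> fst q}"

lemma directed_preorder_finite_measure_sets: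
  "directed_preorder (finite_measure_sets M)
    {(S, T). S \<in> finite_measure_sets M \<and> T \<in> finite_measure_sets M \<and> S \<subseteq> T}"
  unfolding directed_preorder_def
proof (intro conjI ballI)
  fix S T assume "S \<in> finite_measure_sets M" "T \<in> finite_measure_sets M"
  then show "\<exists>c\<in>finite_measure_sets M.
      (S, c) \<in> {(S, T). S \<in> finite_measure_sets M \<and> T \<in> finite_measure_sets M \<and> S \<subseteq> T} \<and>
      (T, c) \<in> {(S, T). S \<in> finite_measure_sets M \<and> T \<in> finite_measure_sets M \<and> S \<subseteq> T}"
    using finite_measure_sets_Un[of S M T] by (intro bexI[of _ "S \<union> T"]) auto
qed (use empty_finite_measure_sets in \<open>auto simp: preorder_on_def refl_on_def trans_def\<close>)

lemma zero_mem_vanishing_index: "S \<in> finite_measure_sets M \<Longrightarrow> (S, \<lambda>x. 0) \<in> vanishing_index M"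
  by (simp add: vanishing_index_def)

lemma directed_preorder_vanishing: "directed_preorder (vanishing_index M) (vanishing_order M)"
  unfolding directed_preorder_def
proof (intro conjI ballI)
  show "vanishing_index M \<noteq> {}"
    using zero_mem_vanishing_index[OF empty_finite_measure_sets] by blast
  show "preorder_on (vanishing_index M) (vanishing_order M)"
    by (auto simp: preorder_on_def refl_on_def trans_def vanishing_order_def)
  fix p q assume pq: "p \<in> vanishing_index M" "q \<in> vanishing_index M"
  then have "fst p \<union> fst q \<in> finite_measure_sets M"
    by (auto simp: vanishing_index_def intro: finite_measure_sets_Un)
  from zero_mem_vanishing_index[OF this] pq
  show "\<exists>c\<in>vanishing_index M. (p, c) \<in> vanishing_order M \<and> (q, c) \<in> vanishing_order M"
    by (intro bexI[of _ "(fst p \<union> fst q, \<lambda>x. 0)"]) (auto simp: vanishing_order_def)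
qed

text \<open>The dominating net is \<open>u\<close> restricted to the complement of \<open>S\<close>.
  A lower bound of it is at most 0 on every set of finite measure, hence almost everywhere by
  \<open>semi_finite_AE_leI\<close>.\<close>

lemma uo_converges_L0_vanishing:
  assumes M: "semi_finite M"
  shows "uo_converges (L0 M) (vanishing_index M) (vanishing_order M)
    (\<lambda>p. ae_class M (snd p)) (vzero (L0 M))"
proof (rule uo_converges_L0I[OF _ _ directed_preorder_vanishing])
  show "snd p \<in> borel_measurable M" if "p \<in> vanishing_index M" for p
    using that by (auto simp: vanishing_index_def)
  fix u :: "'a \<Rightarrow> real" assume [measurable]: "u \<in> borel_measurable M" and u: "\<And>x. 0 \<le> u x"
  define Z where "Z S x = u x * indicat_real (- S) x" for S x
  have Zm: "\<forall>S\<in>finite_measure_sets M. Z S \<in> borel_measurable M"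
  proof
    fix S assume "S \<in> finite_measure_sets M"
    note [measurable] = finite_measure_sets_measurable[OF this]
    show "Z S \<in> borel_measurable M" unfolding Z_def by measurable
  qed
  let ?s = "{(S, T). S \<in> finite_measure_sets M \<and> T \<in> finite_measure_sets M \<and> S \<subseteq> T}"
  have mono: "\<forall>S\<in>finite_measure_sets M. \<forall>T\<in>finite_measure_sets M.
      (S, T) \<in> ?s \<longrightarrow> (AE x in M. Z T x \<le> Z S x)"
    using u by (auto simp: Z_def indicator_def)
  have glb: "\<forall>w\<in>borel_measurable M.
      (\<forall>S\<in>finite_measure_sets M. AE x in M. w x \<le> Z S x) \<longrightarrow> (AE x in M. w x \<le> 0)"
  proof (intro ballI impI)
    fix w assume w: "w \<in> borel_measurable M" "\<forall>S\<in>finite_measure_sets M. AE x in M. w x \<le> Z S x"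
    show "AE x in M. w x \<le> 0"
    proof (rule semi_finite_AE_leI[OF M w(1)])
      fix S assume "S \<in> finite_measure_sets M"
      with w(2) have "AE x in M. w x \<le> Z S x" by blast
      then show "AE x in M. x \<in> S \<longrightarrow> w x \<le> 0" by eventually_elim (auto simp: Z_def indicator_def)
    qed simp
  qed
  have dom: "\<forall>S\<in>finite_measure_sets M. \<exists>p0\<in>vanishing_index M. \<forall>p\<in>vanishing_index M.
      (p0, p) \<in> vanishing_order M \<longrightarrow> (AE x in M. min \<bar>snd p x\<bar> (u x) \<le> Z S x)"
  proof
    fix S assume S: "S \<in> finite_measure_sets M"
    have "min \<bar>snd p x\<bar> (u x) \<le> Z S x"
      if "p \<in> vanishing_index M" "((S, \<lambda>x. 0), p) \<in> vanishing_order M" for p x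
    proof (cases "x \<in> S")
      case True
      then have "snd p x = 0" using that by (auto simp: vanishing_index_def vanishing_order_def)
      then show ?thesis using True u[of x] by (simp add: Z_def)
    qed (simp add: Z_def)
    then show "\<exists>p0\<in>vanishing_index M. \<forall>p\<in>vanishing_index M.
      (p0, p) \<in> vanishing_order M \<longrightarrow> (AE x in M. min \<bar>snd p x\<bar> (u x) \<le> Z S x)"
      by (intro bexI[OF _ zero_mem_vanishing_index[OF S]]) simp
  qed
  show "\<exists>(B :: 'a set set) s Z. directed_preorder B s \<and> (\<forall>b\<in>B. Z b \<in> borel_measurable M) \<and>
        (\<forall>b\<in>B. \<forall>c\<in>B. (b, c) \<in> s \<longrightarrow> (AE x in M. Z c x \<le> Z b x)) \<and>
        (\<forall>w\<in>borel_measurable M. (\<forall>b\<in>B. AE x in M. w x \<le> Z b x) \<longrightarrow> (AE x in M. w x \<le> 0)) \<and>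
        (\<forall>b\<in>B. \<exists>p0\<in>vanishing_index M. \<forall>p\<in>vanishing_index M.
          (p0, p) \<in> vanishing_order M \<longrightarrow> (AE x in M. min \<bar>snd p x\<bar> (u x) \<le> Z b x))"
    by (rule exI[of _ "finite_measure_sets M"], rule exI[of _ ?s], rule exI[of _ Z],
        intro conjI directed_preorder_finite_measure_sets Zm mono glb dom)
qed

section \<open>Solid neighbourhoods of zero in a uo-Lebesgue topology\<close>

locale uo_Lebesgue_L0 =
  fixes M :: "'a measure" and \<tau> :: "('a \<Rightarrow> real) set topology"
  assumes semi_finite: "semi_finite M" and uo_Lebesgue: "uo_Lebesgue_topology (L0 M) \<tau>"
begin

text \<open>Solid neighbourhoods of zero, as sets of representatives rather than classes.\<close>

definition solid_nbhd :: "('a \<Rightarrow> real) set \<Rightarrow> bool" where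
  "solid_nbhd V \<longleftrightarrow> V \<subseteq> borel_measurable M \<and>
    (\<exists>W. openin \<tau> W \<and> ae_class M (\<lambda>x. 0) \<in> W \<and> (\<forall>f\<in>borel_measurable M. ae_class M f \<in> W \<longrightarrow> f \<in> V)) \<and>
    (\<forall>f\<in>V. \<forall>g\<in>borel_measurable M. (AE x in M. \<bar>g x\<bar> \<le> \<bar>f x\<bar>) \<longrightarrow> g \<in> V)"

lemma locally_solid: "locally_solid_topology (L0 M) \<tau>"
  using uo_Lebesgue by (simp add: uo_Lebesgue_topology_def)

lemma topspace_eq: "topspace \<tau> = carrier (L0 M)"
  using locally_solid by (simp add: locally_solid_topology_def linear_topology_def)

lemma openin_add:
  assumes U: "openin \<tau> U" and f: "f \<in> borel_measurable M" and g: "g \<in> borel_measurable M"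
    and fg: "ae_class M (\<lambda>x. f x + g x) \<in> U"
  shows "\<exists>V W. openin \<tau> V \<and> openin \<tau> W \<and> ae_class M f \<in> V \<and> ae_class M g \<in> W \<and>
    (\<forall>f'\<in>borel_measurable M. \<forall>g'\<in>borel_measurable M.
      ae_class M f' \<in> V \<longrightarrow> ae_class M g' \<in> W \<longrightarrow> ae_class M (\<lambda>x. f' x + g' x) \<in> U)"
proof -
  let ?P = "{z \<in> topspace (prod_topology \<tau> \<tau>). (case z of (x, y) \<Rightarrow> vadd (L0 M) x y) \<in> U}"
  have "openin (prod_topology \<tau> \<tau>) ?P"
    using locally_solid U unfolding locally_solid_topology_def linear_topology_def
    by (intro openin_continuous_map_preimage) auto
  moreover have "(ae_class M f, ae_class M g) \<in> ?P"
    using f g fg by (simp add: topspace_eq L0_class_closed L0_vadd_class)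
  ultimately obtain V W where VW: "openin \<tau> V" "openin \<tau> W" "ae_class M f \<in> V" "ae_class M g \<in> W" "V \<times> W \<subseteq> ?P"
    unfolding openin_prod_topology_alt by meson
  have "ae_class M (\<lambda>x. f' x + g' x) \<in> U"
    if "f' \<in> borel_measurable M" "g' \<in> borel_measurable M" "ae_class M f' \<in> V" "ae_class M g' \<in> W" for f' g'
  proof -
    have "vadd (L0 M) (ae_class M f') (ae_class M g') \<in> U" using VW(5) that(3,4) by auto
    then show ?thesis using that by (simp add: L0_vadd_class)
  qed
  with VW show ?thesis by (intro exI[of _ V, OF exI[of _ W]]) simp
qed

lemma solid_nbhd_subset_openin:
  assumes W: "openin \<tau> W" "ae_class M (\<lambda>x. 0) \<in> W"
  shows "\<exists>V. solid_nbhd V \<and> (\<forall>f\<in>V. ae_class M f \<in> W)"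
proof -
  have "nbhd_of \<tau> (vzero (L0 M)) W"
    using W openin_subset[OF W(1)] unfolding nbhd_of_def L0_vzero by blast
  then obtain V where V: "nbhd_of \<tau> (vzero (L0 M)) V" "solid (L0 M) V" "V \<subseteq> W"
    using locally_solid unfolding locally_solid_topology_def by blast
  obtain W' where W': "openin \<tau> W'" "ae_class M (\<lambda>x. 0) \<in> W'" "W' \<subseteq> V"
    using V(1) by (auto simp: nbhd_of_def L0_vzero)
  have "solid_nbhd {f \<in> borel_measurable M. ae_class M f \<in> V}"
    unfolding solid_nbhd_def
  proof (intro conjI ballI impI)
    show "\<exists>W. openin \<tau> W \<and> ae_class M (\<lambda>x. 0) \<in> W \<and>
        (\<forall>f\<in>borel_measurable M. ae_class M f \<in> W \<longrightarrow> f \<in> {f \<in> borel_measurable M. ae_class M f \<in> V})"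
      using W' by (intro exI[of _ W']) auto
    fix f g assume f: "f \<in> {f \<in> borel_measurable M. ae_class M f \<in> V}"
      and g: "g \<in> borel_measurable M" "AE x in M. \<bar>g x\<bar> \<le> \<bar>f x\<bar>"
    have "vabs (L0 M) (ae_class M g) \<sqsubseteq>\<^bsub>L0 M\<^esub> vabs (L0 M) (ae_class M f)"
      using f g by (simp add: vabs_le_iff)
    then show "g \<in> {f \<in> borel_measurable M. ae_class M f \<in> V}"
      using V(2) f g(1) L0_class_closed[OF g(1)] unfolding solid_def by blast
  qed auto
  with V(3) show ?thesis by blast
qed

lemma solid_nbhdD:
  assumes "solid_nbhd V"
  shows solid_nbhd_measurable: "f \<in> V \<Longrightarrow> f \<in> borel_measurable M"
    and solid_nbhd_solid: "f \<in> V \<Longrightarrow> g \<in> borel_measurable M \<Longrightarrow> AE x in M. \<bar>g x\<bar> \<le> \<bar>f x\<bar> \<Longrightarrow> g \<in> V"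
    and solid_nbhd_openin: "\<exists>W. openin \<tau> W \<and> ae_class M (\<lambda>x. 0) \<in> W \<and>
      (\<forall>f\<in>borel_measurable M. ae_class M f \<in> W \<longrightarrow> f \<in> V)"
  using assms unfolding solid_nbhd_def by blast+

lemma solid_nbhd_zero: "solid_nbhd V \<Longrightarrow> (\<lambda>x. 0) \<in> V"
  using solid_nbhd_openin[of V] by auto

lemma solid_nbhd_Int:
  assumes U: "solid_nbhd U" and V: "solid_nbhd V"
  shows "solid_nbhd (U \<inter> V)"
proof -
  obtain W where W: "openin \<tau> W" "ae_class M (\<lambda>x. 0) \<in> W" "\<forall>f\<in>borel_measurable M. ae_class M f \<in> W \<longrightarrow> f \<in> U"
    using solid_nbhd_openin[OF U] by blast
  obtain W' where W': "openin \<tau> W'" "ae_class M (\<lambda>x. 0) \<in> W'" "\<forall>f\<in>borel_measurable M. ae_class M f \<in> W' \<longrightarrow> f \<in> V"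
    using solid_nbhd_openin[OF V] by blast
  show ?thesis
    unfolding solid_nbhd_def
  proof (intro conjI ballI impI)
    show "\<exists>W. openin \<tau> W \<and> ae_class M (\<lambda>x. 0) \<in> W \<and>
        (\<forall>f\<in>borel_measurable M. ae_class M f \<in> W \<longrightarrow> f \<in> U \<inter> V)"
      using W W' by (intro exI[of _ "W \<inter> W'"]) auto
    show "U \<inter> V \<subseteq> borel_measurable M" using solid_nbhd_measurable[OF U] by blast
    fix f g assume "f \<in> U \<inter> V" "g \<in> borel_measurable M" "AE x in M. \<bar>g x\<bar> \<le> \<bar>f x\<bar>"
    then show "g \<in> U \<inter> V" using solid_nbhd_solid[OF U, of f g] solid_nbhd_solid[OF V, of f g] by simp
  qed
qed

lemma solid_nbhd_half:
  assumes V: "solid_nbhd V"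
  shows "\<exists>U. solid_nbhd U \<and> (\<forall>f\<in>U. \<forall>g\<in>U. (\<lambda>x. f x + g x) \<in> V)"
proof -
  obtain W where W: "openin \<tau> W" "ae_class M (\<lambda>x. 0) \<in> W" "\<forall>f\<in>borel_measurable M. ae_class M f \<in> W \<longrightarrow> f \<in> V"
    using solid_nbhd_openin[OF V] by blast
  have "\<exists>U U'. openin \<tau> U \<and> openin \<tau> U' \<and> ae_class M (\<lambda>x. 0) \<in> U \<and> ae_class M (\<lambda>x. 0) \<in> U' \<and>
    (\<forall>f'\<in>borel_measurable M. \<forall>g'\<in>borel_measurable M.
      ae_class M f' \<in> U \<longrightarrow> ae_class M g' \<in> U' \<longrightarrow> ae_class M (\<lambda>x. f' x + g' x) \<in> W)"
    by (rule openin_add[OF W(1)]) (use W(2) in simp_all)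
  then obtain U U' where U: "openin \<tau> U" "openin \<tau> U'" "ae_class M (\<lambda>x. 0) \<in> U" "ae_class M (\<lambda>x. 0) \<in> U'"
    "\<forall>f'\<in>borel_measurable M. \<forall>g'\<in>borel_measurable M.
      ae_class M f' \<in> U \<longrightarrow> ae_class M g' \<in> U' \<longrightarrow> ae_class M (\<lambda>x. f' x + g' x) \<in> W" by blast
  have "openin \<tau> (U \<inter> U')" "ae_class M (\<lambda>x. 0) \<in> U \<inter> U'" using U by auto
  from solid_nbhd_subset_openin[OF this]
  obtain N where N: "solid_nbhd N" "\<forall>f\<in>N. ae_class M f \<in> U \<inter> U'" by blast
  have "(\<lambda>x. f x + g x) \<in> V" if "f \<in> N" "g \<in> N" for f g
  proof -
    have fg: "f \<in> borel_measurable M" "g \<in> borel_measurable M" "ae_class M f \<in> U" "ae_class M g \<in> U'"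
      using that N solid_nbhd_measurable[OF N(1)] by auto
    then have "ae_class M (\<lambda>x. f x + g x) \<in> W" using U(5) by simp
    moreover have "(\<lambda>x. f x + g x) \<in> borel_measurable M" using fg by simp
    ultimately show ?thesis using W(3) by blast
  qed
  with N(1) show ?thesis by blast
qed

text \<open>The index type is arbitrary, thanks to \<open>uo_Lebesgue_topologyD\<close>; this admits
  both sequences and nets indexed by pairs of a set and a function.\<close>

lemma solid_nbhd_uo_net:
  assumes V: "solid_nbhd V" and A: "directed_preorder A r"
    and X: "\<And>a. a \<in> A \<Longrightarrow> X a \<in> borel_measurable M"
    and uo: "uo_converges (L0 M) A r (\<lambda>a. ae_class M (X a)) (vzero (L0 M))"
  shows "\<exists>a0\<in>A. \<forall>a\<in>A. (a0, a) \<in> r \<longrightarrow> X a \<in> V"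
proof -
  obtain W where W: "openin \<tau> W" "ae_class M (\<lambda>x. 0) \<in> W" "\<forall>f\<in>borel_measurable M. ae_class M f \<in> W \<longrightarrow> f \<in> V"
    using solid_nbhd_openin[OF V] by blast
  have "limitin \<tau> (\<lambda>a. ae_class M (X a)) (vzero (L0 M)) (tail_filter A r)"
    by (rule uo_Lebesgue_topologyD[OF uo_Lebesgue A _ _ uo])
      (use X in \<open>auto intro: L0_class_closed simp: L0_vzero\<close>)
  then have "\<forall>\<^sub>F a in tail_filter A r. ae_class M (X a) \<in> W"
    using W(1,2) unfolding limitin_def L0_vzero by blast
  then show ?thesis using W(3) X unfolding eventually_tail_filter[OF A] by meson
qed

lemma solid_nbhd_sequence:
  assumes "solid_nbhd V" and f: "\<And>n. f n \<in> borel_measurable M" and "AE x in M. (\<lambda>n. f n x) \<longlonglongrightarrow> 0"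
  shows "\<exists>N. \<forall>n\<ge>N. f n \<in> V"
  using solid_nbhd_uo_net[OF assms(1) directed_preorder_nat f uo_converges_L0_sequence[OF assms(2,3)]]
  by auto

lemma solid_nbhd_vanishing:
  assumes V: "solid_nbhd V"
  shows "\<exists>S\<in>finite_measure_sets M. \<forall>h\<in>borel_measurable M. (\<forall>x\<in>S. h x = 0) \<longrightarrow> h \<in> V"
proof -
  have "\<exists>p\<in>vanishing_index M. \<forall>q\<in>vanishing_index M. (p, q) \<in> vanishing_order M \<longrightarrow> snd q \<in> V"
    by (rule solid_nbhd_uo_net[OF V directed_preorder_vanishing _ uo_converges_L0_vanishing[OF semi_finite]])
      (auto simp: vanishing_index_def)
  then obtain S h where p: "(S, h) \<in> vanishing_index M"
    "\<forall>q\<in>vanishing_index M. ((S, h), q) \<in> vanishing_order M \<longrightarrow> snd q \<in> V" by auto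
  have "k \<in> V" if "k \<in> borel_measurable M" "\<forall>x\<in>S. k x = 0" for k
  proof -
    have "(S, k) \<in> vanishing_index M" using p(1) that by (simp add: vanishing_index_def)
    then show ?thesis using p by (force simp: vanishing_order_def)
  qed
  moreover have "S \<in> finite_measure_sets M" using p(1) by (simp add: vanishing_index_def)
  ultimately show ?thesis by blast
qed

lemma trunc_integral_small_imp_solid_nbhd:
  assumes V: "solid_nbhd V"
  shows "\<exists>S\<in>finite_measure_sets M. \<exists>e>0. \<forall>g\<in>borel_measurable M. trunc_integral M S g < e \<longrightarrow> g \<in> V"
proof -
  obtain U where U: "solid_nbhd U" "\<forall>f\<in>U. \<forall>g\<in>U. (\<lambda>x. f x + g x) \<in> V"
    using solid_nbhd_half[OF V] by blast
  obtain S where S: "S \<in> finite_measure_sets M"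
    "\<forall>h\<in>borel_measurable M. (\<forall>x\<in>S. h x = 0) \<longrightarrow> h \<in> U"
    using solid_nbhd_vanishing[OF U(1)] by blast
  note [measurable] = finite_measure_sets_measurable[OF S(1)]
  have "\<exists>e>0. \<forall>g\<in>borel_measurable M. trunc_integral M S g < e \<longrightarrow> (\<lambda>x. g x * indicat_real S x) \<in> U"
  proof (rule ccontr)
    assume "\<not> ?thesis"
    then have "\<forall>n. \<exists>g. g \<in> borel_measurable M \<and> trunc_integral M S g < 1 / real (Suc n) \<and>
        (\<lambda>x. g x * indicat_real S x) \<notin> U"
      by (metis of_nat_0_less_iff zero_less_Suc zero_less_divide_1_iff)
    then obtain g where g: "\<And>n. g n \<in> borel_measurable M" "\<And>n. trunc_integral M S (g n) < 1 / real (Suc n)"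
      "\<And>n. (\<lambda>x. g n x * indicat_real S x) \<notin> U" by metis
    note [measurable] = g(1)
    have "(\<lambda>n. trunc_integral M S (g n)) \<longlonglongrightarrow> 0"
    proof (rule tendsto_sandwich[OF _ _ tendsto_const])
      show "(\<lambda>n. 1 / real (Suc n)) \<longlonglongrightarrow> 0"
        by (rule LIMSEQ_inverse_real_of_nat[unfolded inverse_eq_divide])
      show "\<forall>\<^sub>F n in sequentially. trunc_integral M S (g n) \<le> 1 / real (Suc n)"
        using g(2) by (intro always_eventually allI less_imp_le)
    qed (simp add: trunc_integral_nonneg)
    then have "(\<lambda>n. \<integral>x. norm (min \<bar>g n x\<bar> 1 * indicat_real S x) \<partial>M) \<longlonglongrightarrow> 0"
      by (simp add: trunc_integral_def abs_mult)
    from tendsto_L1_AE_subseq[OF integrable_trunc[OF S(1) g(1)] this]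
    obtain r :: "nat \<Rightarrow> nat" where r: "AE x in M. (\<lambda>n. min \<bar>g (r n) x\<bar> 1 * indicat_real S x) \<longlonglongrightarrow> 0"
      by blast
    have "AE x in M. (\<lambda>n. g (r n) x * indicat_real S x) \<longlonglongrightarrow> 0"
      using r
    proof eventually_elim
      case (elim x)
      \<comment> \<open>Once the truncated values are below 1, the truncation is inactive, so the
        untruncated functions tend to zero as well.\<close>
      have "\<forall>\<^sub>F n in sequentially. min \<bar>g (r n) x\<bar> 1 * indicat_real S x < 1"
        using elim by (rule order_tendstoD) simp
      then have "\<forall>\<^sub>F n in sequentially.
          \<bar>min \<bar>g (r n) x\<bar> 1 * indicat_real S x\<bar> = \<bar>g (r n) x * indicat_real S x\<bar>"
        by eventually_elim (auto simp: indicator_def abs_mult)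
      moreover have "(\<lambda>n. \<bar>min \<bar>g (r n) x\<bar> 1 * indicat_real S x\<bar>) \<longlonglongrightarrow> 0"
        using tendsto_rabs_zero[OF elim] .
      ultimately have "(\<lambda>n. \<bar>g (r n) x * indicat_real S x\<bar>) \<longlonglongrightarrow> 0"
        by (rule Lim_transform_eventually[rotated])
      then show ?case by (rule tendsto_rabs_zero_cancel)
    qed
    then have "\<exists>N. \<forall>n\<ge>N. (\<lambda>x. g (r n) x * indicat_real S x) \<in> U"
      by (intro solid_nbhd_sequence[OF U(1)]) measurable
    with g(3) show False by blast
  qed
  then obtain e where e: "0 < e"
    "\<forall>g\<in>borel_measurable M. trunc_integral M S g < e \<longrightarrow> (\<lambda>x. g x * indicat_real S x) \<in> U" by blast
  have "g \<in> V" if g: "g \<in> borel_measurable M" "trunc_integral M S g < e" for g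
  proof -
    note [measurable] = g(1)
    \<comment> \<open>The part of \<open>g\<close> off \<open>S\<close> vanishes on \<open>S\<close>
      and lies in \<open>U\<close> whatever its size. Joining it to the part on \<open>S\<close> is
      the reason for halving \<open>V\<close>.\<close>
    have "(\<lambda>x. g x * indicat_real (- S) x) \<in> U" using S(2) by (simp add: g(1))
    moreover have "(\<lambda>x. g x * indicat_real S x) \<in> U" using e(2) g by blast
    ultimately have "(\<lambda>x. g x * indicat_real (- S) x + g x * indicat_real S x) \<in> V"
      by (rule U(2)[rule_format])
    also have "(\<lambda>x. g x * indicat_real (- S) x + g x * indicat_real S x) = g"
      by (auto simp: indicator_def)
    finally show ?thesis .
  qed
  with S(1) e(1) show ?thesis by blast
qed

section \<open>Chains of solid neighbourhoods and the finer direction\<close>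

lemma solid_nbhd_chain:
  assumes U: "\<And>n. solid_nbhd (U n)"
  shows "\<exists>V. \<forall>n::nat. solid_nbhd (V n) \<and> V n \<subseteq> U n \<and>
    (\<forall>f\<in>V (Suc n). \<forall>g\<in>V (Suc n). (\<lambda>x. f x + g x) \<in> V n)"
proof -
  have "\<exists>V. \<forall>n. (solid_nbhd (V n) \<and> V n \<subseteq> U n) \<and>
    (\<forall>f\<in>V (Suc n). \<forall>g\<in>V (Suc n). (\<lambda>x. f x + g x) \<in> V n)"
  proof (rule dependent_nat_choice)
    show "\<exists>V. solid_nbhd V \<and> V \<subseteq> U 0" using U by blast
    fix V n assume "solid_nbhd V \<and> V \<subseteq> U n"
    then obtain W where W: "solid_nbhd W" "\<forall>f\<in>W. \<forall>g\<in>W. (\<lambda>x. f x + g x) \<in> V"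
      using solid_nbhd_half by blast
    \<comment> \<open>Successive halving has two effects: finite sums of members of
      \<open>V (n + 1)\<close>, ..., \<open>V (n + j)\<close>, one from each, stay in
      \<open>V n\<close>, and the intersection of the chain is closed under addition.\<close>
    show "\<exists>V'. (solid_nbhd V' \<and> V' \<subseteq> U (Suc n)) \<and> (\<forall>f\<in>V'. \<forall>g\<in>V'. (\<lambda>x. f x + g x) \<in> V)"
      using solid_nbhd_Int[OF W(1) U[of "Suc n"]] W(2) by (intro exI[of _ "W \<inter> U (Suc n)"]) auto
  qed
  then show ?thesis by (simp add: conj_assoc)
qed

text \<open>The witness is the limit superior of truncated near-maximisers \<open>h n \<in> V n\<close>, bounded through
  \<open>min 1 (\<Sum>i. h (n + i))\<close> so that the halving property of the chain applies.\<close>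

lemma solid_nbhd_chain_limsup:
  assumes V: "\<And>n. solid_nbhd (V n)"
    and add: "\<And>n f g. f \<in> V (Suc n) \<Longrightarrow> g \<in> V (Suc n) \<Longrightarrow> (\<lambda>x. f x + g x) \<in> V n"
    and S: "S \<in> finite_measure_sets M"
    and ex: "\<And>n. \<exists>h\<in>V n. c - 1 / real (Suc n) < trunc_integral M S h"
  shows "\<exists>h\<in>borel_measurable M. (\<forall>x. 0 \<le> h x \<and> h x \<le> 1) \<and> (\<forall>x. x \<notin> S \<longrightarrow> h x = 0) \<and>
    (\<forall>n. h \<in> V n) \<and> c \<le> trunc_integral M S h"
proof -
  have "\<forall>n. \<exists>h. h \<in> V n \<and> c - 1 / real (Suc n) < trunc_integral M S h" using ex by blast
  then obtain k where k: "\<And>n. k n \<in> V n" "\<And>n. c - 1 / real (Suc n) < trunc_integral M S (k n)"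
    by metis
  note [measurable] = finite_measure_sets_measurable[OF S] solid_nbhd_measurable[OF V k(1)]
  \<comment> \<open>Solidity keeps the cut-off function in \<open>V n\<close>, and
    \<open>trunc_integral M S\<close> does not see the cut-off.\<close>
  define h where "h n x = min \<bar>k n x\<bar> 1 * indicat_real S x" for n x
  have hm [measurable]: "h n \<in> borel_measurable M" for n unfolding h_def by measurable
  have h01: "0 \<le> h n x" "h n x \<le> 1" for n x by (auto simp: h_def indicator_def)
  have h_off: "h n x = 0" if "x \<notin> S" for n x using that by (simp add: h_def)
  have hV: "h n \<in> V n" for n
    by (rule solid_nbhd_solid[OF V k(1) hm]) (auto simp: h_def indicator_def)
  have h\<rho>: "c - 1 / real (Suc n) < trunc_integral M S (h n)" for n
  proof -
    have "min \<bar>h n x\<bar> 1 * indicat_real S x = min \<bar>k n x\<bar> 1 * indicat_real S x" for x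
      by (auto simp: h_def indicator_def)
    then have "trunc_integral M S (h n) = trunc_integral M S (k n)"
      by (simp only: trunc_integral_def)
    then show ?thesis using k(2)[of n] by simp
  qed
  \<comment> \<open>The sum starts at index \<open>Suc n\<close>, which is what keeps it in
    \<open>V n\<close> for every length \<open>j\<close>.\<close>
  define s where "s n j x = (\<Sum>i<j. h (Suc n + i) x)" for n j x
  have sm [measurable]: "s n j \<in> borel_measurable M" for n j unfolding s_def by measurable
  have s0: "0 \<le> s n j x" for n j x unfolding s_def by (intro sum_nonneg h01)
  have s_shift: "s n (Suc j) x = h (Suc n) x + s (Suc n) j x" for n j x
    unfolding s_def by (subst sum.lessThan_Suc_shift) simp
  have sV: "s n j \<in> V n" for n j
  proof (induction j arbitrary: n)
    case 0
    then show ?case using solid_nbhd_zero[OF V[of n]] by (simp add: s_def[abs_def])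
  next
    case (Suc j)
    have "(\<lambda>x. h (Suc n) x + s (Suc n) j x) \<in> V n" by (intro add hV Suc.IH)
    then show ?case by (simp add: s_shift[abs_def])
  qed
  define g where "g n x = (SUP j. min 1 (s n j x))" for n x
  have bdd: "bdd_above (range (\<lambda>j. min 1 (s n j x)))" for n x by (rule bdd_aboveI2[of _ _ 1]) simp
  have gm [measurable]: "g n \<in> borel_measurable M" for n
    unfolding g_def by (rule borel_measurable_cSUP) (use bdd in auto)
  have g_ge: "min 1 (s n j x) \<le> g n x" for n j x
    unfolding g_def by (rule cSUP_upper[OF UNIV_I bdd])
  have g1: "g n x \<le> 1" for n x unfolding g_def by (rule cSUP_least) auto
  have g0: "0 \<le> g n x" for n x
    using g_ge[of n 0 x] by (simp add: s_def)
  have g_off: "g n x = 0" if "x \<notin> S" for n x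
    using that by (simp add: g_def s_def h_off)
  have g_lim: "(\<lambda>j. min 1 (s n j x)) \<longlonglongrightarrow> g n x" for n x
  proof -
    have "incseq (\<lambda>j. s n j x)" unfolding s_def by (intro incseq_SucI) (simp add: h01)
    then have "incseq (\<lambda>j. min 1 (s n j x))"
      unfolding incseq_def by (blast intro: min.mono order_refl)
    then show ?thesis unfolding g_def by (rule LIMSEQ_incseq_SUP[OF bdd])
  qed
  have hg: "h (Suc n) x \<le> g n x" for n x
    using g_ge[of n "Suc 0" x] h01(2)[of "Suc n" x] by (simp add: s_def)
  have g_dec: "g (Suc n) x \<le> g n x" for n x
    unfolding g_def[of "Suc n"]
  proof (rule cSUP_least)
    fix j
    have "min 1 (s (Suc n) j x) \<le> min 1 (s n (Suc j) x)" using h01(1)[of "Suc n" x] by (simp add: s_shift)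
    also have "\<dots> \<le> g n x" by (rule g_ge)
    finally show "min 1 (s (Suc n) j x) \<le> g n x" .
  qed simp
  have gV: "g (Suc n) \<in> V n" for n
  proof -
    \<comment> \<open>The supremum \<open>g (Suc n)\<close> is a truncated partial sum, in
      \<open>V (Suc n)\<close> by solidity, plus a remainder that tends to 0 pointwise and so lies
      in \<open>V (Suc n)\<close> for large \<open>j\<close>. Adding the two costs one
      index.\<close>
    have "\<exists>N. \<forall>j\<ge>N. (\<lambda>x. g (Suc n) x - min 1 (s (Suc n) j x)) \<in> V (Suc n)"
    proof (rule solid_nbhd_sequence[OF V])
      have "(\<lambda>j. g (Suc n) x - min 1 (s (Suc n) j x)) \<longlonglongrightarrow> g (Suc n) x - g (Suc n) x" for x
        by (intro tendsto_diff tendsto_const g_lim)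
      then show "AE x in M. (\<lambda>j. g (Suc n) x - min 1 (s (Suc n) j x)) \<longlonglongrightarrow> 0" by simp
    qed measurable
    then obtain j where j: "(\<lambda>x. g (Suc n) x - min 1 (s (Suc n) j x)) \<in> V (Suc n)" by blast
    have "(\<lambda>x. min 1 (s (Suc n) j x)) \<in> V (Suc n)"
      by (rule solid_nbhd_solid[OF V sV[of "Suc n" j]]) (use s0 in auto)
    from add[OF j this] show ?thesis by simp
  qed
  \<comment> \<open>Here \<open>g n\<close> is a tail of the series of the \<open>h i\<close>,
    capped at 1, so \<open>H\<close> is 1 where the series diverges and 0 elsewhere. By
    \<open>hg\<close> it dominates the limit superior of the \<open>h i\<close>.\<close>
  define H where "H x = (INF n. g n x)" for x
  have bddb: "bdd_below (range (\<lambda>n. g n x))" for x by (rule bdd_belowI2[of _ 0]) (rule g0)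
  have Hm [measurable]: "H \<in> borel_measurable M"
    unfolding H_def by (rule borel_measurable_cINF_real) auto
  have Hg: "H x \<le> g n x" for n x unfolding H_def by (rule cINF_lower[OF bddb]) simp
  have H0: "0 \<le> H x" for x unfolding H_def by (rule cINF_greatest) (auto intro: g0)
  have H_lim: "(\<lambda>n. g n x) \<longlonglongrightarrow> H x" for x
    unfolding H_def by (rule LIMSEQ_decseq_INF[OF bddb]) (simp add: decseq_Suc_iff g_dec)
  show ?thesis
  proof (intro bexI[OF _ Hm] conjI allI impI)
    show "0 \<le> H x" for x by (rule H0)
    show "H x \<le> 1" for x using Hg[of x 0] g1[of 0 x] by linarith
    show "H x = 0" if "x \<notin> S" for x using Hg[of x 0] H0[of x] g_off[OF that, of 0] by linarith
    show "H \<in> V n" for n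
      by (rule solid_nbhd_solid[OF V gV Hm]) (simp add: H0 g0 Hg)
    show "c \<le> trunc_integral M S H"
    proof (rule LIMSEQ_le)
      show "(\<lambda>n. trunc_integral M S (g n)) \<longlonglongrightarrow> trunc_integral M S H"
        by (rule trunc_integral_tendsto[OF S]) (simp_all add: H_lim)
      show "(\<lambda>n. c - 1 / real (Suc (Suc n))) \<longlonglongrightarrow> c"
        using tendsto_diff[OF tendsto_const LIMSEQ_Suc[OF LIMSEQ_inverse_real_of_nat[unfolded inverse_eq_divide]], of c]
        by simp
      \<comment> \<open>The shift by one comes from \<open>hg\<close>: \<open>g n\<close> dominates
        \<open>h (Suc n)\<close>.\<close>
      have "c - 1 / real (Suc (Suc n)) \<le> trunc_integral M S (g n)" for n
      proof -
        have "trunc_integral M S (h (Suc n)) \<le> trunc_integral M S (g n)"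
          by (rule trunc_integral_mono[OF S hm gm]) (simp add: h01 g0 hg)
        with h\<rho>[of "Suc n"] show ?thesis by linarith
      qed
      then show "\<exists>N. \<forall>n\<ge>N. c - 1 / real (Suc (Suc n)) \<le> trunc_integral M S (g n)" by blast
    qed
  qed
qed

lemma solid_nbhd_ex: "\<exists>V. solid_nbhd V"
proof -
  have "ae_class M (\<lambda>x. 0) \<in> topspace \<tau>" by (simp add: topspace_eq L0_class_closed)
  from solid_nbhd_subset_openin[OF openin_topspace this] show ?thesis by blast
qed

lemma solid_nbhd_imp_trunc_integral_small:
  assumes H: "Hausdorff_space \<tau>" and S: "S \<in> finite_measure_sets M" and e: "0 < e"
  shows "\<exists>V. solid_nbhd V \<and> (\<forall>f\<in>V. trunc_integral M S f < e)"
proof (rule ccontr)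
  assume contra: "\<not> ?thesis"
  let ?\<rho> = "trunc_integral M S"
  define sup\<rho> where "sup\<rho> V = (SUP f\<in>V. ?\<rho> f)" for V
  have bdd: "bdd_above (?\<rho> ` V)" if "solid_nbhd V" for V
    using trunc_integral_le_measure[OF S solid_nbhd_measurable[OF that]] by (rule bdd_aboveI2)
  have le_sup: "?\<rho> f \<le> sup\<rho> V" if "solid_nbhd V" "f \<in> V" for f V
    unfolding sup\<rho>_def by (rule cSUP_upper[OF that(2) bdd[OF that(1)]])
  \<comment> \<open>Every solid neighbourhood contains functions with \<open>?\<rho>\<close>
    arbitrarily close to \<open>C\<close> or above it, while a well chosen sequence of
    neighbourhoods admits nothing above \<open>C\<close> in its intersection.\<close>
  define C where "C = (INF V\<in>Collect solid_nbhd. sup\<rho> V)"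
  have ge_e: "e \<le> sup\<rho> V" if V: "solid_nbhd V" for V
  proof -
    obtain f where "f \<in> V" "e \<le> ?\<rho> f" using contra V by (auto simp: not_less)
    with le_sup[OF V] show ?thesis by (meson order_trans)
  qed
  have ne: "Collect solid_nbhd \<noteq> {}" using solid_nbhd_ex by blast
  have C_e: "e \<le> C" unfolding C_def by (rule cINF_greatest[OF ne]) (simp add: ge_e)
  have bddC: "bdd_below (sup\<rho> ` Collect solid_nbhd)" by (rule bdd_belowI2[of _ e]) (simp add: ge_e)
  have C_le: "C \<le> sup\<rho> V" if "solid_nbhd V" for V
    unfolding C_def by (rule cINF_lower[OF bddC]) (simp add: that)
  have near: "\<exists>h\<in>V. C - 1 / real (Suc n) < ?\<rho> h" if V: "solid_nbhd V" for V n
  proof -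
    have "C - 1 / real (Suc n) < C" by simp
    also have "C \<le> sup\<rho> V" by (rule C_le[OF V])
    finally show ?thesis
      unfolding sup\<rho>_def using less_cSUP_iff[OF _ bdd[OF V]] solid_nbhd_zero[OF V] by blast
  qed
  have "\<exists>V. solid_nbhd V \<and> sup\<rho> V < C + 1 / real (Suc n)" for n
  proof -
    have "C < C + 1 / real (Suc n)" by simp
    then show ?thesis using cINF_less_iff[OF ne bddC] unfolding C_def by blast
  qed
  then obtain U where U: "\<And>n. solid_nbhd (U n)" "\<And>n. sup\<rho> (U n) < C + 1 / real (Suc n)"
    by metis
  obtain V where V: "\<And>n. solid_nbhd (V n)" "\<And>n. V n \<subseteq> U n"
    and V_add: "\<And>n f g. f \<in> V (Suc n) \<Longrightarrow> g \<in> V (Suc n) \<Longrightarrow> (\<lambda>x. f x + g x) \<in> V n"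
    using solid_nbhd_chain[of U, OF U(1)] by blast
  have le_C: "?\<rho> f \<le> C" if "\<And>n. f \<in> V n" for f
  proof (rule field_le_epsilon)
    fix d :: real assume "0 < d"
    then obtain n where n: "1 / real (Suc n) < d" using nat_approx_posE by metis
    have "?\<rho> f \<le> sup\<rho> (U n)" using that[of n] V(2)[of n] by (intro le_sup U(1)) auto
    with U(2)[of n] n show "?\<rho> f \<le> C + d" by linarith
  qed
  obtain h where h: "h \<in> borel_measurable M" "\<And>x. 0 \<le> h x" "\<And>x. h x \<le> 1" "\<And>x. x \<notin> S \<Longrightarrow> h x = 0"
    "\<And>n. h \<in> V n" "C \<le> ?\<rho> h"
    using solid_nbhd_chain_limsup[of V, OF V(1) V_add S near[OF V(1)]] by blast
  have "\<not> (AE x in M. h x = 0)"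
  proof
    assume "AE x in M. h x = 0"
    then have "AE x in M. x \<in> S \<longrightarrow> h x = 0" by eventually_elim simp
    then have "?\<rho> h = 0" using trunc_integral_eq_0_iff[OF S h(1)] by simp
    with h(6) C_e e show False by linarith
  qed
  then have "ae_class M h \<noteq> ae_class M (\<lambda>x. 0)" using h(1) by (simp add: L0_class_eq_iff)
  \<comment> \<open>The Hausdorff property is applied to this one class, which is nonzero because
    \<open>?\<rho> h\<close> is at least \<open>C\<close>, hence at least \<open>e\<close>.\<close>
  then obtain W where W: "openin \<tau> W" "ae_class M (\<lambda>x. 0) \<in> W" "ae_class M h \<notin> W"
    using H h(1) L0_class_closed unfolding Hausdorff_space_def topspace_eq disjnt_iff
    by (metis borel_measurable_const)
  obtain Z where Z: "solid_nbhd Z" "\<forall>f\<in>Z. ae_class M f \<in> W"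
    using solid_nbhd_subset_openin[OF W(1,2)] by blast
  have hZ: "h \<notin> Z" using Z(2) W(3) by blast
  \<comment> \<open>Since \<open>near\<close> holds for every solid neighbourhood, passing to a
    chain inside \<open>Z\<close> does not lower the value that can be reached: the new witness
    attains \<open>C\<close> again.\<close>
  obtain V' where V': "\<And>n. solid_nbhd (V' n)" "\<And>n. V' n \<subseteq> V n \<inter> Z"
    and V'_add: "\<And>n f g. f \<in> V' (Suc n) \<Longrightarrow> g \<in> V' (Suc n) \<Longrightarrow> (\<lambda>x. f x + g x) \<in> V' n"
    using solid_nbhd_chain[of "\<lambda>n. V n \<inter> Z", OF solid_nbhd_Int[OF V(1) Z(1)]] by blast
  obtain k where k: "k \<in> borel_measurable M" "\<And>x. 0 \<le> k x" "\<And>x. k x \<le> 1" "\<And>x. x \<notin> S \<Longrightarrow> k x = 0"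
    "\<And>n. k \<in> V' n" "C \<le> ?\<rho> k"
    using solid_nbhd_chain_limsup[of V', OF V'(1) V'_add S near[OF V'(1)]] by blast
  have kVZ: "k \<in> V n" "k \<in> Z" for n using k(5)[of n] V'(2)[of n] by auto
  note [measurable] = h(1) k(1)
  have mm: "(\<lambda>x. max (h x) (k x)) \<in> borel_measurable M" by measurable
  \<comment> \<open>The maximum of two nonnegative functions is at most their sum, and sums stay in
    the intersection of the chain.\<close>
  have "(\<lambda>x. max (h x) (k x)) \<in> V n" for n
  proof (rule solid_nbhd_solid[OF V(1) V_add[OF h(5) kVZ(1)] mm])
    have "\<bar>max (h x) (k x)\<bar> \<le> \<bar>h x + k x\<bar>" for x using h(2)[of x] k(2)[of x] by simp
    then show "AE x in M. \<bar>max (h x) (k x)\<bar> \<le> \<bar>h x + k x\<bar>" by simp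
  qed
  then have "?\<rho> (\<lambda>x. max (h x) (k x)) \<le> C" by (rule le_C)
  with h(6) k(6) have le: "?\<rho> (\<lambda>x. max (h x) (k x)) \<le> ?\<rho> h" "?\<rho> (\<lambda>x. max (h x) (k x)) \<le> ?\<rho> k"
    by linarith+
  have "\<bar>h x\<bar> \<le> \<bar>max (h x) (k x)\<bar>" "\<bar>k x\<bar> \<le> \<bar>max (h x) (k x)\<bar>" for x
    using h(2)[of x] k(2)[of x] by auto
  then have "AE x in M. x \<in> S \<longrightarrow> min \<bar>h x\<bar> 1 = min \<bar>max (h x) (k x)\<bar> 1"
    "AE x in M. x \<in> S \<longrightarrow> min \<bar>k x\<bar> 1 = min \<bar>max (h x) (k x)\<bar> 1"
    by (intro AE_eq_of_trunc_integral_le[OF S] le mm h(1) k(1); simp)+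
  \<comment> \<open>Both functions take values between 0 and 1, so equal truncations mean equal
    values; off \<open>S\<close> it is enough that \<open>h\<close> vanishes. Solidity of
    \<open>Z\<close> then moves \<open>h\<close> into \<open>Z\<close>.\<close>
  then have "AE x in M. \<bar>h x\<bar> \<le> \<bar>k x\<bar>"
  proof eventually_elim
    case (elim x)
    show ?case
    proof (cases "x \<in> S")
      case True
      then have "min \<bar>h x\<bar> 1 = min \<bar>k x\<bar> 1" using elim by simp
      then show ?thesis using h(2,3)[of x] k(2,3)[of x] by simp
    qed (simp add: h(4))
  qed
  from solid_nbhd_solid[OF Z(1) kVZ(2) h(1) this] hZ show False by blast
qed

theorem eq_measure_topology:
  assumes H: "Hausdorff_space \<tau>"
  shows "\<tau> = measure_topology M"
  unfolding topology_eq
proof (intro allI iffI)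
  fix U assume U: "openin \<tau> U"
  show "openin (measure_topology M) U"
    unfolding openin_measure_topology
  proof (intro conjI ballI impI)
    show "U \<subseteq> carrier (L0 M)" using openin_subset[OF U] by (simp add: topspace_eq)
    fix f assume f: "f \<in> borel_measurable M" "ae_class M f \<in> U"
    \<comment> \<open>Continuity of addition at \<open>(f, 0)\<close> stands in for translation:
      with the first argument kept at \<open>f\<close>, the translate of \<open>W\<close> lies in
      \<open>U\<close>.\<close>
    have "\<exists>V W. openin \<tau> V \<and> openin \<tau> W \<and> ae_class M f \<in> V \<and> ae_class M (\<lambda>x. 0) \<in> W \<and>
      (\<forall>f'\<in>borel_measurable M. \<forall>g'\<in>borel_measurable M.
        ae_class M f' \<in> V \<longrightarrow> ae_class M g' \<in> W \<longrightarrow> ae_class M (\<lambda>x. f' x + g' x) \<in> U)"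
      by (rule openin_add[OF U f(1)]) (use f in simp_all)
    then obtain V W where W: "openin \<tau> W" "ae_class M f \<in> V" "ae_class M (\<lambda>x. 0) \<in> W"
      "\<forall>f'\<in>borel_measurable M. \<forall>g'\<in>borel_measurable M.
        ae_class M f' \<in> V \<longrightarrow> ae_class M g' \<in> W \<longrightarrow> ae_class M (\<lambda>x. f' x + g' x) \<in> U" by blast
    obtain Z where Z: "solid_nbhd Z" "\<forall>g\<in>Z. ae_class M g \<in> W"
      using solid_nbhd_subset_openin[OF W(1,3)] by blast
    obtain S e where S: "S \<in> finite_measure_sets M" "0 < e"
      "\<forall>g\<in>borel_measurable M. trunc_integral M S g < e \<longrightarrow> g \<in> Z"
      using trunc_integral_small_imp_solid_nbhd[OF Z(1)] by blast
    have "L0_ball M f S e \<subseteq> U"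
      unfolding L0_ball_def
    proof (intro image_subsetI; elim CollectE conjE)
      fix g assume g: "g \<in> borel_measurable M" "trunc_integral M S (\<lambda>x. g x - f x) < e"
      have gf: "(\<lambda>x. g x - f x) \<in> borel_measurable M" using f g by simp
      with S(3) g(2) Z(2) have "ae_class M (\<lambda>x. g x - f x) \<in> W" by blast
      with W(2,4) f(1) gf have "ae_class M (\<lambda>x. f x + (g x - f x)) \<in> U" by blast
      then show "ae_class M g \<in> U" by simp
    qed
    with S show "\<exists>S\<in>finite_measure_sets M. \<exists>e>0. L0_ball M f S e \<subseteq> U" by blast
  qed
next
  fix U assume U: "openin (measure_topology M) U"
  show "openin \<tau> U"
  proof (subst openin_subopen, intro ballI)
    fix u assume u: "u \<in> U"
    then have "u \<in> carrier (L0 M)" using openin_subset[OF U] by (auto simp: topspace_measure_topology)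
    then obtain f where f: "f \<in> borel_measurable M" "u = ae_class M f" by (rule L0_carrierE)
    obtain S e where S: "S \<in> finite_measure_sets M" "0 < e" "L0_ball M f S e \<subseteq> U"
      using U[unfolded openin_measure_topology, THEN conjunct2, rule_format, OF f(1)] u f(2) by auto
    obtain Z where Z: "solid_nbhd Z" "\<forall>g\<in>Z. trunc_integral M S g < e"
      using solid_nbhd_imp_trunc_integral_small[OF H S(1,2)] by blast
    obtain W where W: "openin \<tau> W" "ae_class M (\<lambda>x. 0) \<in> W" "\<forall>g\<in>borel_measurable M. ae_class M g \<in> W \<longrightarrow> g \<in> Z"
      using solid_nbhd_openin[OF Z(1)] by blast
    \<comment> \<open>Continuity at \<open>(f, - f)\<close>, with the second argument kept at
      \<open>- f\<close>, yields an open set around \<open>f\<close> whose differences from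
      \<open>f\<close> lie in \<open>W\<close>.\<close>
    have "\<exists>T T'. openin \<tau> T \<and> openin \<tau> T' \<and> ae_class M f \<in> T \<and> ae_class M (\<lambda>x. - f x) \<in> T' \<and>
      (\<forall>f'\<in>borel_measurable M. \<forall>g'\<in>borel_measurable M.
        ae_class M f' \<in> T \<longrightarrow> ae_class M g' \<in> T' \<longrightarrow> ae_class M (\<lambda>x. f' x + g' x) \<in> W)"
      by (rule openin_add[OF W(1) f(1)]) (use f(1) W(2) in simp_all)
    then obtain T T' where T: "openin \<tau> T" "ae_class M f \<in> T" "ae_class M (\<lambda>x. - f x) \<in> T'"
      "\<forall>f'\<in>borel_measurable M. \<forall>g'\<in>borel_measurable M.
        ae_class M f' \<in> T \<longrightarrow> ae_class M g' \<in> T' \<longrightarrow> ae_class M (\<lambda>x. f' x + g' x) \<in> W" by blast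
    have "T \<subseteq> U"
    proof
      fix v assume v: "v \<in> T"
      then have "v \<in> carrier (L0 M)" using openin_subset[OF T(1)] by (auto simp: topspace_eq)
      then obtain g where g: "g \<in> borel_measurable M" "v = ae_class M g" by (rule L0_carrierE)
      have "(\<lambda>x. - f x) \<in> borel_measurable M" using f(1) by simp
      with T(3,4) v g have "ae_class M (\<lambda>x. g x + - f x) \<in> W" by blast
      moreover have "(\<lambda>x. g x + - f x) \<in> borel_measurable M" using f(1) g(1) by simp
      ultimately have "(\<lambda>x. g x + - f x) \<in> Z" using W(3) by blast
      with Z(2) have "trunc_integral M S (\<lambda>x. g x + - f x) < e" by blast
      then have "v \<in> L0_ball M f S e" using g f S by (simp add: ae_class_mem_L0_ball)
      with S(3) show "v \<in> U" by blast
    qed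
    with T(1,2) f(2) show "\<exists>T. openin \<tau> T \<and> u \<in> T \<and> T \<subseteq> U" by blast
  qed
qed

end

text \<open>Convergence in measure is the hub because it mentions no exponent. With exponent 1 the
  integral is \<open>trunc_integral\<close>, which describes the topology; the same equivalence with
  exponent \<open>p\<close> gives the integrals of the theorem.\<close>

lemma limitin_measure_topology_zero_iff:
  fixes f :: "'i \<Rightarrow> 'a \<Rightarrow> real"
  assumes F: "\<forall>\<^sub>F \<alpha> in \<F>. f \<alpha> \<in> borel_measurable M \<and> F \<alpha> = ae_class M (f \<alpha>)" and p: "0 < p"
  shows "limitin (measure_topology M) F (vzero (L0 M)) \<F> \<longleftrightarrow>
      tendsto_in_measure_on_finite M f (\<lambda>x. 0) \<F>" (is "?lim \<longleftrightarrow> ?meas")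
    and "tendsto_in_measure_on_finite M f (\<lambda>x. 0) \<F> \<longleftrightarrow>
      (\<forall>S\<in>finite_measure_sets M.
        ((\<lambda>\<alpha>. \<integral>x. min (\<bar>f \<alpha> x\<bar> powr p) (indicat_real S x) \<partial>M) \<longlongrightarrow> 0) \<F>)"
proof -
  have f: "\<forall>\<^sub>F \<alpha> in \<F>. f \<alpha> \<in> borel_measurable M" using F by eventually_elim simp
  have iff: "?meas \<longleftrightarrow> (\<forall>S\<in>finite_measure_sets M.
        ((\<lambda>\<alpha>. \<integral>x. min (\<bar>f \<alpha> x\<bar> powr q) (indicat_real S x) \<partial>M) \<longlongrightarrow> 0) \<F>)" if "0 < q" for q
    using that by (simp add: tendsto_in_measure_on_finite_def powr_integral_tendsto_0_iff[OF _ _ f])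
  from this[OF p] show "?meas \<longleftrightarrow> (\<forall>S\<in>finite_measure_sets M.
        ((\<lambda>\<alpha>. \<integral>x. min (\<bar>f \<alpha> x\<bar> powr p) (indicat_real S x) \<partial>M) \<longlongrightarrow> 0) \<F>)" .
  have eq: "min \<bar>a\<bar> 1 * indicat_real S x = min (\<bar>a\<bar> powr 1) (indicat_real S x)" for a and S :: "'a set" and x
    by (auto simp: indicator_def)
  have "?meas \<longleftrightarrow> (\<forall>S\<in>finite_measure_sets M. ((\<lambda>\<alpha>. trunc_integral M S (f \<alpha>)) \<longlongrightarrow> 0) \<F>)"
    unfolding trunc_integral_def eq by (rule iff) simp
  then show "?lim \<longleftrightarrow> ?meas"
    unfolding L0_vzero by (simp add: limitin_measure_topology[OF _ F])
qed

theorem theorem6p1: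
  fixes M :: "'a measure"
  assumes "semi_finite M"
  shows "(\<exists>!\<tau>. Hausdorff_space \<tau> \<and> uo_Lebesgue_topology (L0 M) \<tau>) \<and>
    (\<forall>\<tau> (A :: 'i set) r F f (p :: real).
       Hausdorff_space \<tau> \<and> uo_Lebesgue_topology (L0 M) \<tau> \<and>
       directed_preorder A r \<and> F \<in> A \<rightarrow> carrier (L0 M) \<and> (\<forall>\<alpha>\<in>A. f \<alpha> \<in> F \<alpha>) \<and> 1 \<le> p \<longrightarrow>
       (\<forall>\<alpha>\<in>A. \<forall>S\<in>finite_measure_sets M.
          (\<integral>x. min (\<bar>f \<alpha> x\<bar> powr p) (indicat_real S x) \<partial>M)
            = Lp_norm M p (\<lambda>x. min \<bar>f \<alpha> x\<bar> \<bar>indicat_real S x\<bar>) powr p) \<and>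
       (\<forall>\<alpha>\<in>A. \<forall>g\<in>Lp_functions M p.
          (\<integral>x. min (\<bar>f \<alpha> x\<bar> powr p) (\<bar>g x\<bar> powr p) \<partial>M)
            = Lp_norm M p (\<lambda>x. min \<bar>f \<alpha> x\<bar> \<bar>g x\<bar>) powr p) \<and>
       (limitin \<tau> F (vzero (L0 M)) (tail_filter A r) \<longleftrightarrow>
          (\<forall>S\<in>finite_measure_sets M.
             ((\<lambda>\<alpha>. \<integral>x. min (\<bar>f \<alpha> x\<bar> powr p) (indicat_real S x) \<partial>M) \<longlongrightarrow> 0) (tail_filter A r))) \<and>
       (limitin \<tau> F (vzero (L0 M)) (tail_filter A r) \<longleftrightarrow>
          (\<forall>g\<in>Lp_functions M p.
             ((\<lambda>\<alpha>. \<integral>x. min (\<bar>f \<alpha> x\<bar> powr p) (\<bar>g x\<bar> powr p) \<partial>M) \<longlongrightarrow> 0) (tail_filter A r))) \<and>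
       (limitin \<tau> F (vzero (L0 M)) (tail_filter A r) \<longleftrightarrow>
          tendsto_in_measure_on_finite M f (\<lambda>x. 0) (tail_filter A r)))"
proof (intro conjI allI impI)
  have M: "uo_Lebesgue_L0 M \<tau>" if "uo_Lebesgue_topology (L0 M) \<tau>" for \<tau>
    using assms that by (rule uo_Lebesgue_L0.intro)
  show "\<exists>!\<tau>. Hausdorff_space \<tau> \<and> uo_Lebesgue_topology (L0 M) \<tau>"
    using Hausdorff_measure_topology[OF assms] uo_Lebesgue_measure_topology
      uo_Lebesgue_L0.eq_measure_topology[OF M] by blast
  fix \<tau> :: "('a \<Rightarrow> real) set topology" and A :: "'i set" and r F f and p :: real
  assume asm: "Hausdorff_space \<tau> \<and> uo_Lebesgue_topology (L0 M) \<tau> \<and>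
       directed_preorder A r \<and> F \<in> A \<rightarrow> carrier (L0 M) \<and> (\<forall>\<alpha>\<in>A. f \<alpha> \<in> F \<alpha>) \<and> 1 \<le> p"
  then have p: "0 < p" and A: "directed_preorder A r" by auto
  have \<tau>: "\<tau> = measure_topology M" using uo_Lebesgue_L0.eq_measure_topology[OF M] asm by blast
  \<comment> \<open>The net \<open>F\<close> consists of classes and \<open>f\<close> is an
    arbitrary choice of representatives; any member of a class determines it.\<close>
  have F: "f \<alpha> \<in> borel_measurable M \<and> F \<alpha> = ae_class M (f \<alpha>)" if "\<alpha> \<in> A" for \<alpha>
  proof -
    have "F \<alpha> \<in> carrier (L0 M)" "f \<alpha> \<in> F \<alpha>" using asm that by auto
    then obtain h where "F \<alpha> = ae_class M h" "(h, f \<alpha>) \<in> ae_eq_rel M" by (auto elim: L0_carrierE)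
    then show ?thesis using equiv_class_eq[OF equiv_ae_eq_rel] by (auto simp: ae_eq_rel_def)
  qed
  then have ev: "\<forall>\<^sub>F \<alpha> in tail_filter A r. f \<alpha> \<in> borel_measurable M \<and> F \<alpha> = ae_class M (f \<alpha>)"
    using A unfolding eventually_tail_filter[OF A] directed_preorder_def by blast
  then have f: "\<forall>\<^sub>F \<alpha> in tail_filter A r. f \<alpha> \<in> borel_measurable M" by eventually_elim simp
  note iff = limitin_measure_topology_zero_iff[OF ev p]
  show "\<forall>\<alpha>\<in>A. \<forall>g\<in>Lp_functions M p.
          (\<integral>x. min (\<bar>f \<alpha> x\<bar> powr p) (\<bar>g x\<bar> powr p) \<partial>M)
            = Lp_norm M p (\<lambda>x. min \<bar>f \<alpha> x\<bar> \<bar>g x\<bar>) powr p"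
    using p by (simp add: Lp_norm_powr min_powr)
  have "indicat_real S x powr p = indicat_real S x" for S :: "'a set" and x using p by (simp add: indicator_def)
  then show "\<forall>\<alpha>\<in>A. \<forall>S\<in>finite_measure_sets M.
          (\<integral>x. min (\<bar>f \<alpha> x\<bar> powr p) (indicat_real S x) \<partial>M)
            = Lp_norm M p (\<lambda>x. min \<bar>f \<alpha> x\<bar> \<bar>indicat_real S x\<bar>) powr p"
    using p by (simp add: Lp_norm_powr min_powr)
  show "limitin \<tau> F (vzero (L0 M)) (tail_filter A r) \<longleftrightarrow>
          tendsto_in_measure_on_finite M f (\<lambda>x. 0) (tail_filter A r)"
    unfolding \<tau> by (rule iff(1))
  show "limitin \<tau> F (vzero (L0 M)) (tail_filter A r) \<longleftrightarrow>
          (\<forall>S\<in>finite_measure_sets M.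
             ((\<lambda>\<alpha>. \<integral>x. min (\<bar>f \<alpha> x\<bar> powr p) (indicat_real S x) \<partial>M) \<longlongrightarrow> 0) (tail_filter A r))"
    unfolding \<tau> iff(1) by (rule iff(2))
  then show "limitin \<tau> F (vzero (L0 M)) (tail_filter A r) \<longleftrightarrow>
          (\<forall>g\<in>Lp_functions M p.
             ((\<lambda>\<alpha>. \<integral>x. min (\<bar>f \<alpha> x\<bar> powr p) (\<bar>g x\<bar> powr p) \<partial>M) \<longlongrightarrow> 0) (tail_filter A r))"
    using Lp_integral_tendsto_0_iff[OF p f] by simp
qed

end
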